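(* Let $k$ be a field and let $<$ be a monomial preorder on $k[X]=k[x_1,\dots,x_n]$ such that $1$ is comparable to all other monomials. (This assumption is satisfied if $x_i>1$ for all $i$, or if $x_i<1$ for all $i$, or if $<$ is a monomial order.) Let $\mathbb{P}$ be an open and faithful property of local rings, and let $I$ be a proper ideal in $k[X]_<$. If $\mathbb{P}$ holds at the maximal ideal $\mathfrak{m}=(X)/L_<(I)$ of $k[X]/L_<(I)$, where $(X)=(x_1,\dots,x_n)$, then it also holds at all primes of $k[X]_</I$.
   Context: For $a\in\mathbb{N}^n$ write $x^a=x_1^{\alpha_1}\cdots x_n^{\alpha_n}$. A weak order on a set is a strict partial order for which incomparability is an equivalence relation. A monomial preorder on $k[X]$ is a weak order $<$ on the monomials such that for all $a,b,c\in\mathbb{N}^n$: $x^a<x^b$ if and only if $x^ax^c<x^bx^c$; it is a monomial order if it is a total order. Two distinct monomials $s,t$ are comparable if $s<t$ or $t<s$. For $f=\sum c_ax^a\in k[X]$, the leading part $L_<(f)$ is the sum of those terms $c_ax^a$ ($c_a\ne0$) such that no monomial $x^b$ occurring in $f$ satisfies $x^a<x^b$. Put $S_<=\{u\in k[X]\mid L_<(u)=1\}$ (a multiplicative set) and $k[X]_<=S_<^{-1}k[X]$. For $f\in k[X]_<$ choose $u\in S_<$ with $uf\in k[X]$ and set $L_<(f)=L_<(uf)$ (independent of $u$). For a subset $G\subseteq k[X]_<$, the leading ideal $L_<(G)$ is the ideal of $k[X]$ generated by all $L_<(f)$, $f\in G$. $\mathbb{P}$ denotes a property (invariant under ring isomorphism)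 which a local ring may or may not have; it holds at a prime $P$ of a noetherian ring $A$ if $A_P$ has $\mathbb{P}$, and $\operatorname{Spec}_{\mathbb{P}}(A)$ is the set of such primes. $\mathbb{P}$ is open if for every finitely generated algebra $A$ over a field, $\operatorname{Spec}_{\mathbb{P}}(A)$ is Zariski-open in $\operatorname{Spec}(A)$. $\mathbb{P}$ is faithful if for every noetherian local ring $(A,\mathfrak{m})$: (F1) if $A[t]_{\mathfrak{m}A[t]}$ has $\mathbb{P}$, where $t$ is an indeterminate, then $A$ has $\mathbb{P}$; (F2) if $A/tA$ has $\mathbb{P}$ for some non-zerodivisor $t\in\mathfrak{m}$, then $A$ has $\mathbb{P}$. *)

theory Defs
  imports
    "HOL-Library.Poly_Mapping"
    "HOL-Library.Equipollence"
    "HOL-Algebra.Algebra"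
    "HOL-Algebra.UnivPoly"
    "HOL-Algebra.Algebraic_Closure_Type"
begin

section \<open>Localization\<close>

definition loc_rel :: "('a, 'm) ring_scheme \<Rightarrow> 'a set \<Rightarrow> (('a \<times> 'a) \<times> ('a \<times> 'a)) set" where
  "loc_rel R S = {((a, s), (b, t)). a \<in> carrier R \<and> s \<in> S \<and> b \<in> carrier R \<and> t \<in> S \<and>
     (\<exists>u\<in>S. u \<otimes>\<^bsub>R\<^esub> (t \<otimes>\<^bsub>R\<^esub> a) = u \<otimes>\<^bsub>R\<^esub> (s \<otimes>\<^bsub>R\<^esub> b))}"

type_synonym 'a fraction = "('a \<times> 'a) set"

definition fraction_of :: "('a, 'm) ring_scheme \<Rightarrow> 'a set \<Rightarrow> 'a \<Rightarrow> 'a \<Rightarrow> 'a fraction" where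
  "fraction_of R S a s = loc_rel R S `` {(a, s)}"

text \<open>Meaningful for a commutative ring \<open>R\<close> and a multiplicative subset \<open>S\<close> of its carrier; the
  unions are then unions of equal classes.\<close>

definition localization :: "('a, 'm) ring_scheme \<Rightarrow> 'a set \<Rightarrow> 'a fraction ring" where
  "localization R S = \<lparr>
     carrier = (carrier R \<times> S) // loc_rel R S,
     monoid.mult = (\<lambda>x y. \<Union>(a, s)\<in>x. \<Union>(b, t)\<in>y. fraction_of R S (a \<otimes>\<^bsub>R\<^esub> b) (s \<otimes>\<^bsub>R\<^esub> t)),
     one = fraction_of R S \<one>\<^bsub>R\<^esub> \<one>\<^bsub>R\<^esub>,
     ring.zero = fraction_of R S \<zero>\<^bsub>R\<^esub> \<one>\<^bsub>R\<^esub>,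
     add = (\<lambda>x y. \<Union>(a, s)\<in>x. \<Union>(b, t)\<in>y.
              fraction_of R S (t \<otimes>\<^bsub>R\<^esub> a \<oplus>\<^bsub>R\<^esub> s \<otimes>\<^bsub>R\<^esub> b) (s \<otimes>\<^bsub>R\<^esub> t)) \<rparr>"

definition localization_at :: "('a, 'm) ring_scheme \<Rightarrow> 'a set \<Rightarrow> 'a fraction ring" where
  "localization_at R Q = localization R (carrier R - Q)"

section \<open>Properties of local rings\<close>

definition local_ring :: "('a, 'm) ring_scheme \<Rightarrow> bool" where
  "local_ring A \<longleftrightarrow> cring A \<and> (\<exists>!m. maximalideal m A)"

text \<open>A property of local rings is given by its values on the rings carried by subsets of a
  universe type \<open>'u\<close> (where it has to be invariant under isomorphism). A ring over another type has
  the property if it is isomorphic to a local ring over \<open>'u\<close> which has it. For this reading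
  \<open>'u\<close> must be large enough to contain copies of all rings under consideration. If \<open>'u\<close> is
  infinite, it contains copies of all quotients and localizations of polynomial rings in finitely
  many variables over rings which are themselves carried by subsets of \<open>'u\<close>.\<close>

definition local_ring_property :: "('u ring \<Rightarrow> bool) \<Rightarrow> bool" where
  "local_ring_property P \<longleftrightarrow>
     (\<forall>A B. local_ring A \<longrightarrow> local_ring B \<longrightarrow> A \<simeq> B \<longrightarrow> P A \<longrightarrow> P B)"

definition has_property :: "('u ring \<Rightarrow> bool) \<Rightarrow> ('a, 'm) ring_scheme \<Rightarrow> bool" where
  "has_property P R \<longleftrightarrow> (\<exists>B :: 'u ring. local_ring B \<and> B \<simeq> R \<and> P B)"

definition holds_at :: "('u ring \<Rightarrow> bool) \<Rightarrow> ('a, 'm) ring_scheme \<Rightarrow> 'a set \<Rightarrow> bool" where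
  "holds_at P A Q \<longleftrightarrow> has_property P (localization_at A Q)"

definition Spec :: "('a, 'm) ring_scheme \<Rightarrow> 'a set set" where
  "Spec A = {Q. primeideal Q A}"

definition Spec_property :: "('u ring \<Rightarrow> bool) \<Rightarrow> ('a, 'm) ring_scheme \<Rightarrow> 'a set set" where
  "Spec_property P A = {Q \<in> Spec A. holds_at P A Q}"

definition zariski_open :: "('a, 'm) ring_scheme \<Rightarrow> 'a set set \<Rightarrow> bool" where
  "zariski_open A U \<longleftrightarrow> (\<exists>E \<subseteq> carrier A. U = {Q \<in> Spec A. \<not> E \<subseteq> Q})"

definition fin_gen_algebra_over_field :: "'u ring \<Rightarrow> bool" where
  "fin_gen_algebra_over_field A \<longleftrightarrow> cring A \<and>
     (\<exists>(K :: 'u ring) \<phi> F. field K \<and> \<phi> \<in> ring_hom K A \<and> finite F \<and> F \<subseteq> carrier A \<and>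
        generate_ring A (\<phi> ` carrier K \<union> F) = carrier A)"

definition open_property :: "('u ring \<Rightarrow> bool) \<Rightarrow> bool" where
  "open_property P \<longleftrightarrow>
     (\<forall>A :: 'u ring. fin_gen_algebra_over_field A \<longrightarrow> zariski_open A (Spec_property P A))"

definition extend_to_UP :: "('a, 'm) ring_scheme \<Rightarrow> 'a set \<Rightarrow> (nat \<Rightarrow> 'a) set" where
  "extend_to_UP A m = Idl\<^bsub>UP A\<^esub> ((\<lambda>a. up_ring.monom (UP A) a 0) ` m)"

definition faithful_property :: "('u ring \<Rightarrow> bool) \<Rightarrow> bool" where
  "faithful_property P \<longleftrightarrow>
     (\<forall>(A :: 'u ring) m. noetherian_ring A \<longrightarrow> local_ring A \<longrightarrow> maximalideal m A \<longrightarrow>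
        (has_property P (localization_at (UP A) (extend_to_UP A m)) \<longrightarrow> has_property P A) \<and>
        (\<forall>t\<in>m. (\<forall>x\<in>carrier A. t \<otimes>\<^bsub>A\<^esub> x = \<zero>\<^bsub>A\<^esub> \<longrightarrow> x = \<zero>\<^bsub>A\<^esub>) \<longrightarrow>
           has_property P (A Quot (PIdl\<^bsub>A\<^esub> t)) \<longrightarrow> has_property P A))"

section \<open>Monomial preorders\<close>

text \<open>A monomial in the variables indexed by \<open>'n\<close> is represented by its exponent vector, so that
  the monomial 1 is the vector 0 and the product of monomials is the sum of vectors.\<close>

type_synonym 'n monomial = "'n \<Rightarrow>\<^sub>0 nat"
type_synonym ('n, 'k) mpoly = "'n monomial \<Rightarrow>\<^sub>0 'k"

definition mpoly_ring :: "('n, 'k::field) mpoly ring" where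
  "mpoly_ring = ring_of_type_algebra"

definition var_monomial :: "'n \<Rightarrow> 'n monomial" where
  "var_monomial i = Poly_Mapping.single i 1"

definition var :: "'n \<Rightarrow> ('n, 'k::field) mpoly" where
  "var i = Poly_Mapping.single (var_monomial i) 1"

definition vars_ideal :: "('n, 'k::field) mpoly set" where
  "vars_ideal = Idl\<^bsub>mpoly_ring\<^esub> (range var)"

definition weak_order :: "('a \<Rightarrow> 'a \<Rightarrow> bool) \<Rightarrow> bool" where
  "weak_order lt \<longleftrightarrow> irreflp lt \<and> transp lt \<and> equivp (\<lambda>a b. \<not> lt a b \<and> \<not> lt b a)"

definition monomial_preorder :: "('n monomial \<Rightarrow> 'n monomial \<Rightarrow> bool) \<Rightarrow> bool" where
  "monomial_preorder lt \<longleftrightarrow> weak_order lt \<and> (\<forall>a b c. lt a b \<longleftrightarrow> lt (a + c) (b + c))"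

definition monomial_order :: "('n monomial \<Rightarrow> 'n monomial \<Rightarrow> bool) \<Rightarrow> bool" where
  "monomial_order lt \<longleftrightarrow> monomial_preorder lt \<and> totalp lt"

definition comparable :: "('a \<Rightarrow> 'a \<Rightarrow> bool) \<Rightarrow> 'a \<Rightarrow> 'a \<Rightarrow> bool" where
  "comparable lt s t \<longleftrightarrow> lt s t \<or> lt t s"

definition one_comparable :: "('n monomial \<Rightarrow> 'n monomial \<Rightarrow> bool) \<Rightarrow> bool" where
  "one_comparable lt \<longleftrightarrow> (\<forall>a. a \<noteq> 0 \<longrightarrow> comparable lt 0 a)"

definition leading_part ::
  "('n monomial \<Rightarrow> 'n monomial \<Rightarrow> bool) \<Rightarrow> ('n, 'k::field) mpoly \<Rightarrow> ('n, 'k) mpoly" where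
  "leading_part lt f = (\<Sum>a \<in> {a \<in> Poly_Mapping.keys f. \<forall>b \<in> Poly_Mapping.keys f. \<not> lt a b}.
     Poly_Mapping.single a (Poly_Mapping.lookup f a))"

definition unit_leading :: "('n monomial \<Rightarrow> 'n monomial \<Rightarrow> bool) \<Rightarrow> ('n, 'k::field) mpoly set" where
  "unit_leading lt = {u. leading_part lt u = 1}"

text \<open>The ring \<open>k[X]\<^sub><\<close>.\<close>

definition loc_mpoly_ring ::
  "('n monomial \<Rightarrow> 'n monomial \<Rightarrow> bool) \<Rightarrow> ('n, 'k::field) mpoly fraction ring" where
  "loc_mpoly_ring lt = localization mpoly_ring (unit_leading lt)"

definition embed ::
  "('n monomial \<Rightarrow> 'n monomial \<Rightarrow> bool) \<Rightarrow> ('n, 'k::field) mpoly \<Rightarrow> ('n, 'k) mpoly fraction" where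
  "embed lt g = fraction_of mpoly_ring (unit_leading lt) g 1"

text \<open>The choice below does not affect the leading part: if \<open>u f = g\<close> and \<open>v f = h\<close> in
  \<open>k[X]\<^sub><\<close> with \<open>u, v\<close> having leading part 1, then \<open>g\<close> and \<open>h\<close> have the same leading part.\<close>

definition loc_leading_part ::
  "('n monomial \<Rightarrow> 'n monomial \<Rightarrow> bool) \<Rightarrow> ('n, 'k::field) mpoly fraction \<Rightarrow> ('n, 'k) mpoly" where
  "loc_leading_part lt f = leading_part lt
     (SOME g. \<exists>u \<in> unit_leading lt. embed lt u \<otimes>\<^bsub>loc_mpoly_ring lt\<^esub> f = embed lt g)"

definition leading_ideal ::
  "('n monomial \<Rightarrow> 'n monomial \<Rightarrow> bool) \<Rightarrow> ('n, 'k::field) mpoly fraction set \<Rightarrow> ('n, 'k) mpoly set"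
  where "leading_ideal lt G = Idl\<^bsub>mpoly_ring\<^esub> (loc_leading_part lt ` G)"

text \<open>The image of an ideal \<open>M\<close> in the quotient by \<open>J\<close>; it is written \<open>M / J\<close> if \<open>J\<close> is contained
  in \<open>M\<close>.\<close>

definition quot_ideal :: "('a, 'm) ring_scheme \<Rightarrow> 'a set \<Rightarrow> 'a set \<Rightarrow> 'a set set" where
  "quot_ideal R M J = (\<lambda>x. J +>\<^bsub>R\<^esub> x) ` M"

end

theory Submission
  imports Defs
begin

text \<open>
  Let \<open>Q\<close> be the contraction to \<open>k[X]\<close> of a prime of \<open>k[X]\<^sub><\<close> which contains \<open>I\<close>, and let \<open>J \<subseteq> Q\<close> be
  the contraction of \<open>I\<close>. Since \<open>1\<close> is comparable to all monomials and \<open>Q\<close> does not meet \<open>S\<^sub><\<close>, no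
  leading part of an element of \<open>Q\<close> has a constant term. There is an integral weight \<open>w\<close> for which
  \<open>J\<close> and \<open>Q\<close> have the same leading ideals as for \<open><\<close>. In the extended Rees ring \<open>C\<close> of \<open>w\<close>, which
  is spanned by the \<open>X\<^sup>a t\<^sup>e\<close> with \<open>w(a) \<le> e\<close>, the element \<open>t\<close> is regular modulo \<open>J[t, 1/t] \<inter> C\<close>, and
  setting \<open>t = 0\<close> gives \<open>k[X]/L(J)\<close>. By (F2), \<open>P\<close> holds at the origin of \<open>C/(J[t, 1/t] \<inter> C)\<close>. The
  prime \<open>Q[t, 1/t] \<inter> C\<close> lies below the origin because \<open>L(Q) \<subseteq> (X)\<close>, hence \<open>P\<close> holds there by
  openness. The local ring at this prime is \<open>A[t]\<^bsub>mA[t]\<^esub>\<close> for \<open>A = (k[X]/J)\<^sub>Q\<close>, and (F1) concludes.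
\<close>

section \<open>Rings of fractions\<close>

text \<open>The Rees construction needs a grading by the integers, but a monomial preorder need not
  come from an integral weight; only its restriction to finitely many monomials always does. This is
  why standard bases enter: they reduce the comparison of leading ideals to the finitely many
  monomials of a finite set of polynomials, and one weight has to serve \<open>J\<close> and
  \<open>Q\<close> together. Since variables may be smaller than 1, division need not terminate
  without a degree bound, and weights may be negative, so that the Rees ring lives in the Laurent
  polynomials in \<open>t\<close> over \<open>k[X]\<close>. Openness enters through one consequence:
  an open set of primes contains with a prime also every prime below it. The ring
  \<open>(k[X]/J)\<close> localized at \<open>Q\<close> is already the local ring in question,
  because the elements of \<open>S_<\<close> lie outside \<open>Q\<close>. A further obstacle is
  formal: openness and faithfulness speak about rings carried by subsets of \<open>'u\<close>. Every
  ring to which they are applied is first copied there, which is the reason for the cardinality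
  estimates.\<close>

text \<open>All local rings in the argument are rings of fractions of a homomorphic image of some ring \<open>R\<close>.
  As such they are determined up to isomorphism by the denominators \<open>S\<close> and the kernel of \<open>\<phi>\<close>,
  so that no isomorphism has to be constructed from iterated quotients and localizations.\<close>

definition frac_hom :: "('a, 'm) ring_scheme \<Rightarrow> 'a set \<Rightarrow> ('b, 'n) ring_scheme \<Rightarrow> ('a \<Rightarrow> 'b) \<Rightarrow> bool" where
  "frac_hom R S T \<phi> \<longleftrightarrow> cring R \<and> cring T \<and> \<phi> \<in> ring_hom R T \<and> S \<subseteq> carrier R \<and> \<one>\<^bsub>R\<^esub> \<in> S \<and>
     (\<forall>s\<in>S. \<forall>t\<in>S. s \<otimes>\<^bsub>R\<^esub> t \<in> S) \<and> \<phi> ` S \<subseteq> Units T \<and>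
     (\<forall>x\<in>carrier T. \<exists>a\<in>carrier R. \<exists>s\<in>S. x \<otimes>\<^bsub>T\<^esub> \<phi> s = \<phi> a)"

lemma (in cring) mult_Units_cancel:
  assumes "u \<in> Units R" "x \<in> carrier R" "y \<in> carrier R" "x \<otimes> u = y \<otimes> u"
  shows "x = y"
  using assms by (metis Units_closed Units_l_cancel m_comm)

locale frac =
  fixes R :: "('a, 'm) ring_scheme" and S T and \<phi> :: "'a \<Rightarrow> 'b"
  assumes frac: "frac_hom R S T \<phi>"
begin

sublocale R: cring R using frac by (simp add: frac_hom_def)
sublocale T: cring T using frac by (simp add: frac_hom_def)
sublocale \<phi>: ring_hom_cring R T \<phi>
  using frac by (auto simp: frac_hom_def intro!: ring_hom_cring.intro ring_hom_cring_axioms.intro R.cring_axioms T.cring_axioms)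

lemma S_carrier [simp]: "s \<in> S \<Longrightarrow> s \<in> carrier R"
  using frac by (auto simp: frac_hom_def)

lemma S_one [simp]: "\<one>\<^bsub>R\<^esub> \<in> S"
  using frac by (auto simp: frac_hom_def)

lemma S_mult [simp]: "s \<in> S \<Longrightarrow> t \<in> S \<Longrightarrow> s \<otimes>\<^bsub>R\<^esub> t \<in> S"
  using frac by (auto simp: frac_hom_def)

lemma S_unit [simp]: "s \<in> S \<Longrightarrow> \<phi> s \<in> Units T"
  using frac by (auto simp: frac_hom_def)

lemma S_inv_closed [simp]: "s \<in> S \<Longrightarrow> inv\<^bsub>T\<^esub> (\<phi> s) \<in> carrier T"
  by simp

lemma S_inv [simp]: "s \<in> S \<Longrightarrow> \<phi> s \<otimes>\<^bsub>T\<^esub> inv\<^bsub>T\<^esub> (\<phi> s) = \<one>\<^bsub>T\<^esub>"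
  "s \<in> S \<Longrightarrow> inv\<^bsub>T\<^esub> (\<phi> s) \<otimes>\<^bsub>T\<^esub> \<phi> s = \<one>\<^bsub>T\<^esub>"
  by (simp_all)

lemma fraction:
  assumes "x \<in> carrier T"
  obtains a s where "a \<in> carrier R" "s \<in> S" "x \<otimes>\<^bsub>T\<^esub> \<phi> s = \<phi> a"
  using frac assms unfolding frac_hom_def by blast

lemma cancel:
  assumes "s \<in> S" "x \<in> carrier T" "y \<in> carrier T" "x \<otimes>\<^bsub>T\<^esub> \<phi> s = y \<otimes>\<^bsub>T\<^esub> \<phi> s"
  shows "x = y"
  using T.mult_Units_cancel[of "\<phi> s" x y] assms by simp

text \<open>Denominators become units in \<open>T\<close>, so cross-multiplication needs no
  additional annihilator: all annihilators are already absorbed in the kernel of \<phi>. Hence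
  equality of fractions is visible in \<open>R\<close> through this kernel alone.\<close>

lemma quotient_eq_iff:
  assumes "a \<in> carrier R" "b \<in> carrier R" "s \<in> S" "t \<in> S" "x \<in> carrier T" "y \<in> carrier T"
    "x \<otimes>\<^bsub>T\<^esub> \<phi> s = \<phi> a" "y \<otimes>\<^bsub>T\<^esub> \<phi> t = \<phi> b"
  shows "x = y \<longleftrightarrow> \<phi> (a \<otimes>\<^bsub>R\<^esub> t \<ominus>\<^bsub>R\<^esub> b \<otimes>\<^bsub>R\<^esub> s) = \<zero>\<^bsub>T\<^esub>"
proof -
  have st: "\<phi> (s \<otimes>\<^bsub>R\<^esub> t) \<in> Units T" using assms by (intro S_unit S_mult)
  have c: "\<phi> s \<in> carrier T" "\<phi> t \<in> carrier T" using assms by auto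
  have "\<phi> (a \<otimes>\<^bsub>R\<^esub> t \<ominus>\<^bsub>R\<^esub> b \<otimes>\<^bsub>R\<^esub> s) = \<phi> a \<otimes>\<^bsub>T\<^esub> \<phi> t \<ominus>\<^bsub>T\<^esub> \<phi> b \<otimes>\<^bsub>T\<^esub> \<phi> s"
    using assms by (simp add: R.minus_eq T.minus_eq)
  also have "\<dots> = (x \<ominus>\<^bsub>T\<^esub> y) \<otimes>\<^bsub>T\<^esub> \<phi> (s \<otimes>\<^bsub>R\<^esub> t)"
    unfolding assms(7,8)[symmetric] using assms(1-6) c by (simp, algebra)
  finally have eq: "\<phi> (a \<otimes>\<^bsub>R\<^esub> t \<ominus>\<^bsub>R\<^esub> b \<otimes>\<^bsub>R\<^esub> s) = (x \<ominus>\<^bsub>T\<^esub> y) \<otimes>\<^bsub>T\<^esub> \<phi> (s \<otimes>\<^bsub>R\<^esub> t)" .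
  show ?thesis
  proof
    assume "x = y"
    then show "\<phi> (a \<otimes>\<^bsub>R\<^esub> t \<ominus>\<^bsub>R\<^esub> b \<otimes>\<^bsub>R\<^esub> s) = \<zero>\<^bsub>T\<^esub>" 
      unfolding eq using assms(1-6) by (simp add: T.minus_eq T.r_neg)
  next
    assume "\<phi> (a \<otimes>\<^bsub>R\<^esub> t \<ominus>\<^bsub>R\<^esub> b \<otimes>\<^bsub>R\<^esub> s) = \<zero>\<^bsub>T\<^esub>"
    then have "(x \<ominus>\<^bsub>T\<^esub> y) \<otimes>\<^bsub>T\<^esub> \<phi> (s \<otimes>\<^bsub>R\<^esub> t) = \<zero>\<^bsub>T\<^esub>" by (simp only: eq)
    also have "\<dots> = \<zero>\<^bsub>T\<^esub> \<otimes>\<^bsub>T\<^esub> \<phi> (s \<otimes>\<^bsub>R\<^esub> t)" using T.Units_closed[OF st] by (simp only: T.l_null)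
    finally have "(x \<ominus>\<^bsub>T\<^esub> y) \<otimes>\<^bsub>T\<^esub> \<phi> (s \<otimes>\<^bsub>R\<^esub> t) = \<zero>\<^bsub>T\<^esub> \<otimes>\<^bsub>T\<^esub> \<phi> (s \<otimes>\<^bsub>R\<^esub> t)" .
    then have "x \<ominus>\<^bsub>T\<^esub> y = \<zero>\<^bsub>T\<^esub>"
      by (rule T.mult_Units_cancel[OF st T.minus_closed[OF assms(5,6)] T.zero_closed])
    then show "x = y" using assms(5,6) by simp
  qed
qed

lemma
  assumes "a \<in> carrier R" "b \<in> carrier R" "s \<in> S" "t \<in> S" "x \<in> carrier T" "y \<in> carrier T"
    "x \<otimes>\<^bsub>T\<^esub> \<phi> s = \<phi> a" "y \<otimes>\<^bsub>T\<^esub> \<phi> t = \<phi> b"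
  shows fraction_mult: "(x \<otimes>\<^bsub>T\<^esub> y) \<otimes>\<^bsub>T\<^esub> \<phi> (s \<otimes>\<^bsub>R\<^esub> t) = \<phi> (a \<otimes>\<^bsub>R\<^esub> b)"
    and fraction_add: "(x \<oplus>\<^bsub>T\<^esub> y) \<otimes>\<^bsub>T\<^esub> \<phi> (s \<otimes>\<^bsub>R\<^esub> t) = \<phi> (a \<otimes>\<^bsub>R\<^esub> t \<oplus>\<^bsub>R\<^esub> b \<otimes>\<^bsub>R\<^esub> s)"
proof -
  have c: "\<phi> s \<in> carrier T" "\<phi> t \<in> carrier T" using assms by auto
  have "(x \<otimes>\<^bsub>T\<^esub> y) \<otimes>\<^bsub>T\<^esub> \<phi> (s \<otimes>\<^bsub>R\<^esub> t) = (x \<otimes>\<^bsub>T\<^esub> \<phi> s) \<otimes>\<^bsub>T\<^esub> (y \<otimes>\<^bsub>T\<^esub> \<phi> t)"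
    using assms(1-6) c by (simp, algebra)
  then show "(x \<otimes>\<^bsub>T\<^esub> y) \<otimes>\<^bsub>T\<^esub> \<phi> (s \<otimes>\<^bsub>R\<^esub> t) = \<phi> (a \<otimes>\<^bsub>R\<^esub> b)" using assms by simp
  have "(x \<oplus>\<^bsub>T\<^esub> y) \<otimes>\<^bsub>T\<^esub> \<phi> (s \<otimes>\<^bsub>R\<^esub> t) = (x \<otimes>\<^bsub>T\<^esub> \<phi> s) \<otimes>\<^bsub>T\<^esub> \<phi> t \<oplus>\<^bsub>T\<^esub> (y \<otimes>\<^bsub>T\<^esub> \<phi> t) \<otimes>\<^bsub>T\<^esub> \<phi> s"
    using assms(1-6) c by (simp, algebra)
  then show "(x \<oplus>\<^bsub>T\<^esub> y) \<otimes>\<^bsub>T\<^esub> \<phi> (s \<otimes>\<^bsub>R\<^esub> t) = \<phi> (a \<otimes>\<^bsub>R\<^esub> t \<oplus>\<^bsub>R\<^esub> b \<otimes>\<^bsub>R\<^esub> s)" using assms by simp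
qed

lemma quotient_exists:
  assumes "a \<in> carrier R" "s \<in> S"
  obtains x where "x \<in> carrier T" "x \<otimes>\<^bsub>T\<^esub> \<phi> s = \<phi> a"
proof
  show "\<phi> a \<otimes>\<^bsub>T\<^esub> inv\<^bsub>T\<^esub> (\<phi> s) \<in> carrier T" using assms by simp
  show "\<phi> a \<otimes>\<^bsub>T\<^esub> inv\<^bsub>T\<^esub> (\<phi> s) \<otimes>\<^bsub>T\<^esub> \<phi> s = \<phi> a" using assms by (simp add: T.m_assoc)
qed

end

text \<open>The source of all nontrivial isomorphisms in the argument. Elements of \<open>T1\<close>
  and \<open>T2\<close> correspond if they are represented by the same numerator and denominator in
  \<open>R\<close>; by \<open>quotient_eq_iff\<close> this correspondence depends on the kernels
  only.\<close>

lemma frac_hom_imp_ring_iso: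
  fixes T1 :: "('b, 'n) ring_scheme" and T2 :: "('c, 'o) ring_scheme"
  assumes "frac_hom R S T1 \<phi>1" "frac_hom R S T2 \<phi>2"
    and ker: "\<And>a. a \<in> carrier R \<Longrightarrow> \<phi>1 a = \<zero>\<^bsub>T1\<^esub> \<longleftrightarrow> \<phi>2 a = \<zero>\<^bsub>T2\<^esub>"
  shows "T1 \<simeq> T2"
proof -
  interpret f1: frac R S T1 \<phi>1 by unfold_locales fact
  interpret f2: frac R S T2 \<phi>2 by unfold_locales fact
  define rel where "rel x y \<longleftrightarrow> x \<in> carrier T1 \<and> y \<in> carrier T2 \<and>
    (\<exists>a\<in>carrier R. \<exists>s\<in>S. x \<otimes>\<^bsub>T1\<^esub> \<phi>1 s = \<phi>1 a \<and> y \<otimes>\<^bsub>T2\<^esub> \<phi>2 s = \<phi>2 a)" for x y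
  \<comment> \<open>One direction makes the correspondence a function, the other makes it
    injective.\<close>
  have uniq: "x = x' \<longleftrightarrow> y = y'" if "rel x y" "rel x' y'" for x y x' y'
  proof -
    from that obtain a s a' s' where *: "a \<in> carrier R" "s \<in> S" "a' \<in> carrier R" "s' \<in> S"
      "x \<otimes>\<^bsub>T1\<^esub> \<phi>1 s = \<phi>1 a" "y \<otimes>\<^bsub>T2\<^esub> \<phi>2 s = \<phi>2 a"
      "x' \<otimes>\<^bsub>T1\<^esub> \<phi>1 s' = \<phi>1 a'" "y' \<otimes>\<^bsub>T2\<^esub> \<phi>2 s' = \<phi>2 a'"
      "x \<in> carrier T1" "x' \<in> carrier T1" "y \<in> carrier T2" "y' \<in> carrier T2"
      unfolding rel_def by blast
    show ?thesis
      unfolding f1.quotient_eq_iff[OF *(1,3,2,4,9,10,5,7)] f2.quotient_eq_iff[OF *(1,3,2,4,11,12,6,8)]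
      using * by (intro ker) auto
  qed
  define h where "h x = (THE y. rel x y)" for x
  have ex: "\<exists>y. rel x y" if "x \<in> carrier T1" for x
    using that f1.fraction[OF that] f2.quotient_exists unfolding rel_def by metis
  have ex': "\<exists>x. rel x y" if "y \<in> carrier T2" for y
    using that f2.fraction[OF that] f1.quotient_exists unfolding rel_def by metis
  have hI: "h x = y" if "rel x y" for x y
    unfolding h_def using that uniq by (intro the_equality) auto
  have rel_h: "rel x (h x)" if "x \<in> carrier T1" for x
    using ex[OF that] hI by blast
  have rel_mult: "rel (x \<otimes>\<^bsub>T1\<^esub> x') (y \<otimes>\<^bsub>T2\<^esub> y')" and rel_add: "rel (x \<oplus>\<^bsub>T1\<^esub> x') (y \<oplus>\<^bsub>T2\<^esub> y')"
    if r: "rel x y" "rel x' y'" for x y x' y'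
  proof -
    from that obtain a s a' s' where *: "a \<in> carrier R" "s \<in> S" "a' \<in> carrier R" "s' \<in> S"
      "x \<otimes>\<^bsub>T1\<^esub> \<phi>1 s = \<phi>1 a" "y \<otimes>\<^bsub>T2\<^esub> \<phi>2 s = \<phi>2 a"
      "x' \<otimes>\<^bsub>T1\<^esub> \<phi>1 s' = \<phi>1 a'" "y' \<otimes>\<^bsub>T2\<^esub> \<phi>2 s' = \<phi>2 a'"
      "x \<in> carrier T1" "x' \<in> carrier T1" "y \<in> carrier T2" "y' \<in> carrier T2"
      unfolding rel_def by blast
    note 1 = f1.fraction_mult[OF *(1,3,2,4,9,10,5,7)] and 2 = f2.fraction_mult[OF *(1,3,2,4,11,12,6,8)]
      and 3 = f1.fraction_add[OF *(1,3,2,4,9,10,5,7)] and 4 = f2.fraction_add[OF *(1,3,2,4,11,12,6,8)]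
    show "rel (x \<otimes>\<^bsub>T1\<^esub> x') (y \<otimes>\<^bsub>T2\<^esub> y')"
      unfolding rel_def using * 1 2 by (intro conjI bexI[of _ "a \<otimes>\<^bsub>R\<^esub> a'"] bexI[of _ "s \<otimes>\<^bsub>R\<^esub> s'"]) auto
    show "rel (x \<oplus>\<^bsub>T1\<^esub> x') (y \<oplus>\<^bsub>T2\<^esub> y')"
      unfolding rel_def using * 3 4 by (intro conjI bexI[of _ "a \<otimes>\<^bsub>R\<^esub> s' \<oplus>\<^bsub>R\<^esub> a' \<otimes>\<^bsub>R\<^esub> s"] bexI[of _ "s \<otimes>\<^bsub>R\<^esub> s'"]) auto
  qed
  have rel_one: "rel \<one>\<^bsub>T1\<^esub> \<one>\<^bsub>T2\<^esub>"
    unfolding rel_def by (intro conjI bexI[of _ "\<one>\<^bsub>R\<^esub>"]) auto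
  have "h \<in> ring_iso T1 T2"
  proof (rule ring_iso_memI)
    show "h x \<in> carrier T2" if "x \<in> carrier T1" for x
      using rel_h[OF that] unfolding rel_def by blast
    show "bij_betw h (carrier T1) (carrier T2)"
      unfolding bij_betw_def
    proof
      show "inj_on h (carrier T1)" by (intro inj_onI) (metis rel_h uniq)
      show "h ` carrier T1 = carrier T2" using rel_h ex' hI unfolding rel_def by (auto simp: image_iff) metis
    qed
  qed (auto intro!: hI rel_mult rel_add rel_one rel_h)
  then show ?thesis unfolding is_ring_iso_def by blast
qed

section \<open>Classes of pairs as a ring of fractions\<close>

locale mult_subset = cring R for R :: "('a, 'm) ring_scheme" (structure) +
  fixes S
  assumes subset: "S \<subseteq> carrier R" and one_S: "\<one> \<in> S" and mult_S: "s \<in> S \<Longrightarrow> t \<in> S \<Longrightarrow> s \<otimes> t \<in> S"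
begin

abbreviation "fr \<equiv> fraction_of R S"

lemma S_closed [simp]: "s \<in> S \<Longrightarrow> s \<in> carrier R"
  using subset by blast

lemma loc_rel_iff:
  "((a, s), (b, t)) \<in> loc_rel R S \<longleftrightarrow> a \<in> carrier R \<and> s \<in> S \<and> b \<in> carrier R \<and> t \<in> S \<and>
     (\<exists>u\<in>S. u \<otimes> (t \<otimes> a) = u \<otimes> (s \<otimes> b))"
  by (simp add: loc_rel_def)

lemma equiv_loc_rel: "equiv (carrier R \<times> S) (loc_rel R S)"
proof (rule equivI)
  show "loc_rel R S \<subseteq> (carrier R \<times> S) \<times> (carrier R \<times> S)"
    by (auto simp: loc_rel_def)
  show "refl_on (carrier R \<times> S) (loc_rel R S)"
    using one_S by (auto simp: refl_on_def loc_rel_def)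
  show "sym (loc_rel R S)"
  proof (rule symI)
    fix x y assume "(x, y) \<in> loc_rel R S"
    then show "(y, x) \<in> loc_rel R S" by (cases x; cases y) (auto simp: loc_rel_iff eq_commute)
  qed
  show "trans (loc_rel R S)"
  proof (rule transI)
    fix x y z assume xy: "(x, y) \<in> loc_rel R S" and yz: "(y, z) \<in> loc_rel R S"
    obtain a s b t c r where [simp]: "x = (a, s)" "y = (b, t)" "z = (c, r)"
      by (cases x; cases y; cases z)
    from xy obtain u where u: "u \<in> S" "u \<otimes> (t \<otimes> a) = u \<otimes> (s \<otimes> b)"
      and c: "a \<in> carrier R" "s \<in> S" "b \<in> carrier R" "t \<in> S" by (auto simp: loc_rel_iff)
    from yz obtain v where v: "v \<in> S" "v \<otimes> (r \<otimes> b) = v \<otimes> (t \<otimes> c)"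
      and c': "c \<in> carrier R" "r \<in> S" by (auto simp: loc_rel_iff)
    \<comment> \<open>The multiplier must contain the middle denominator \<open>t\<close> as well,
      because \<open>t\<close> may be a zero divisor and cannot be cancelled.\<close>
    have "(u \<otimes> v \<otimes> t) \<otimes> (r \<otimes> a) = (v \<otimes> r) \<otimes> (u \<otimes> (t \<otimes> a))"
      using c c' u(1) v(1) by (simp add: m_ac)
    also have "\<dots> = (u \<otimes> s) \<otimes> (v \<otimes> (r \<otimes> b))"
      unfolding u(2) using c c' u(1) v(1) by (simp add: m_ac)
    also have "\<dots> = (u \<otimes> v \<otimes> t) \<otimes> (s \<otimes> c)"
      unfolding v(2) using c c' u(1) v(1) by (simp add: m_ac)
    finally show "(x, z) \<in> loc_rel R S"
      using c c' u v by (auto simp: loc_rel_iff intro!: bexI[of _ "u \<otimes> v \<otimes> t"] mult_S)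
  qed
qed

lemma fr_eq_iff:
  assumes "a \<in> carrier R" "s \<in> S" "b \<in> carrier R" "t \<in> S"
  shows "fr a s = fr b t \<longleftrightarrow> (\<exists>u\<in>S. u \<otimes> (t \<otimes> a) = u \<otimes> (s \<otimes> b))"
  unfolding fraction_of_def
  using eq_equiv_class_iff[OF equiv_loc_rel, of "(a, s)" "(b, t)"] assms by (simp add: loc_rel_iff)

lemma mem_fr_iff:
  assumes "a \<in> carrier R" "s \<in> S"
  shows "(b, t) \<in> fr a s \<longleftrightarrow> b \<in> carrier R \<and> t \<in> S \<and> fr a s = fr b t"
  using assms fr_eq_iff[OF assms, of b t] unfolding fraction_of_def by (auto simp: loc_rel_iff)

lemma carrier_localization: "carrier (localization R S) = {fr a s | a s. a \<in> carrier R \<and> s \<in> S}"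
  by (auto simp: localization_def quotient_def fraction_of_def)

lemma fr_closed [simp]: "a \<in> carrier R \<Longrightarrow> s \<in> S \<Longrightarrow> fr a s \<in> carrier (localization R S)"
  by (auto simp: carrier_localization)

text \<open>The operations of \<open>localization\<close> are unions over all representatives. If
  the body does not depend on them, the union is one over equal sets and collapses.\<close>

lemma UN_fr:
  assumes "a \<in> carrier R" "s \<in> S" "b \<in> carrier R" "t \<in> S"
    and "\<And>a' s' b' t'. a' \<in> carrier R \<Longrightarrow> s' \<in> S \<Longrightarrow> b' \<in> carrier R \<Longrightarrow> t' \<in> S \<Longrightarrow>
      fr a s = fr a' s' \<Longrightarrow> fr b t = fr b' t' \<Longrightarrow> f a' s' b' t' = f a s b t"
  shows "(\<Union>(a, s)\<in>fr a s. \<Union>(b, t)\<in>fr b t. f a s b t) = f a s b t"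
proof -
  have mem: "(a, s) \<in> fr a s" "(b, t) \<in> fr b t" using assms(1-4) by (auto simp: mem_fr_iff)
  have *: "f a' s' b' t' = f a s b t" if "(a', s') \<in> fr a s" "(b', t') \<in> fr b t" for a' s' b' t'
    using that assms(1-4) by (intro assms(5)) (auto simp: mem_fr_iff)
  have "(\<Union>(b', t')\<in>fr b t. f a' s' b' t') = f a s b t" if "(a', s') \<in> fr a s" for a' s'
    using mem(2) * that by (intro SUP_eq_const) auto
  then show ?thesis using mem(1) by (intro SUP_eq_const) auto
qed

lemma fr_mult:
  assumes c: "a \<in> carrier R" "s \<in> S" "b \<in> carrier R" "t \<in> S"
  shows "fr a s \<otimes>\<^bsub>localization R S\<^esub> fr b t = fr (a \<otimes> b) (s \<otimes> t)"
  unfolding localization_def monoid.simps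
proof (rule UN_fr[OF c])
  fix a' s' b' t' assume c': "a' \<in> carrier R" "s' \<in> S" "b' \<in> carrier R" "t' \<in> S"
  assume "fr a s = fr a' s'" "fr b t = fr b' t'"
  then obtain u v where u: "u \<in> S" "u \<otimes> (s' \<otimes> a) = u \<otimes> (s \<otimes> a')"
    and v: "v \<in> S" "v \<otimes> (t' \<otimes> b) = v \<otimes> (t \<otimes> b')"
    using c c' by (auto simp: fr_eq_iff)
  have "(u \<otimes> v) \<otimes> ((s \<otimes> t) \<otimes> (a' \<otimes> b')) = (u \<otimes> (s \<otimes> a')) \<otimes> (v \<otimes> (t \<otimes> b'))"
    using c c' u(1) v(1) by (simp add: m_ac)
  also have "\<dots> = (u \<otimes> v) \<otimes> ((s' \<otimes> t') \<otimes> (a \<otimes> b))"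
    unfolding u(2)[symmetric] v(2)[symmetric] using c c' u(1) v(1) by (simp add: m_ac)
  finally show "fr (a' \<otimes> b') (s' \<otimes> t') = fr (a \<otimes> b) (s \<otimes> t)"
    using c c' u(1) v(1) by (subst fr_eq_iff) (auto intro!: mult_S)
qed

lemma fr_add:
  assumes c: "a \<in> carrier R" "s \<in> S" "b \<in> carrier R" "t \<in> S"
  shows "fr a s \<oplus>\<^bsub>localization R S\<^esub> fr b t = fr (t \<otimes> a \<oplus> s \<otimes> b) (s \<otimes> t)"
  unfolding localization_def ring.simps
proof (rule UN_fr[OF c])
  fix a' s' b' t' assume c': "a' \<in> carrier R" "s' \<in> S" "b' \<in> carrier R" "t' \<in> S"
  assume "fr a s = fr a' s'" "fr b t = fr b' t'"
  then obtain u v where u: "u \<in> S" "u \<otimes> (s' \<otimes> a) = u \<otimes> (s \<otimes> a')"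
    and v: "v \<in> S" "v \<otimes> (t' \<otimes> b) = v \<otimes> (t \<otimes> b')"
    using c c' by (auto simp: fr_eq_iff)
  have "(u \<otimes> v) \<otimes> ((s \<otimes> t) \<otimes> (t' \<otimes> a' \<oplus> s' \<otimes> b')) =
      (v \<otimes> t \<otimes> t') \<otimes> (u \<otimes> (s \<otimes> a')) \<oplus> (u \<otimes> s \<otimes> s') \<otimes> (v \<otimes> (t \<otimes> b'))"
    using c c' u(1) v(1) by (simp add: m_ac r_distr)
  also have "\<dots> = (u \<otimes> v) \<otimes> ((s' \<otimes> t') \<otimes> (t \<otimes> a \<oplus> s \<otimes> b))"
    unfolding u(2)[symmetric] v(2)[symmetric] using c c' u(1) v(1) by (simp add: m_ac r_distr)
  finally show "fr (t' \<otimes> a' \<oplus> s' \<otimes> b') (s' \<otimes> t') = fr (t \<otimes> a \<oplus> s \<otimes> b) (s \<otimes> t)"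
    using c c' u(1) v(1) by (subst fr_eq_iff) (auto intro!: mult_S)
qed

lemma fr_one: "\<one>\<^bsub>localization R S\<^esub> = fr \<one> \<one>" and fr_zero: "\<zero>\<^bsub>localization R S\<^esub> = fr \<zero> \<one>"
  by (simp_all add: localization_def)

lemma fr_eqI:
  assumes "a \<in> carrier R" "s \<in> S" "b \<in> carrier R" "t \<in> S" "t \<otimes> a = s \<otimes> b"
  shows "fr a s = fr b t"
  using assms one_S by (auto simp: fr_eq_iff)

lemma cring_localization: "cring (localization R S)"
proof (rule cringI)
  let ?L = "localization R S"
  note [simp] = fr_mult fr_add fr_one fr_zero one_S mult_S carrier_localization
  show "abelian_group ?L"
  proof (rule abelian_groupI)
    fix x y assume "x \<in> carrier ?L" "y \<in> carrier ?L"
    then show "x \<oplus>\<^bsub>?L\<^esub> y \<in> carrier ?L" by force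
    from \<open>x \<in> carrier ?L\<close> \<open>y \<in> carrier ?L\<close> show "x \<oplus>\<^bsub>?L\<^esub> y = y \<oplus>\<^bsub>?L\<^esub> x" 
      by (auto intro!: fr_eqI simp: m_ac r_distr a_ac)
    fix z assume "z \<in> carrier ?L"
    with \<open>x \<in> carrier ?L\<close> \<open>y \<in> carrier ?L\<close> show "x \<oplus>\<^bsub>?L\<^esub> y \<oplus>\<^bsub>?L\<^esub> z = x \<oplus>\<^bsub>?L\<^esub> (y \<oplus>\<^bsub>?L\<^esub> z)"
      by (auto intro!: fr_eqI simp: m_ac r_distr a_ac)
  next
    show "\<zero>\<^bsub>?L\<^esub> \<in> carrier ?L" by force
    fix x assume "x \<in> carrier ?L"
    then show "\<zero>\<^bsub>?L\<^esub> \<oplus>\<^bsub>?L\<^esub> x = x" by (auto intro!: fr_eqI)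
    from \<open>x \<in> carrier ?L\<close> obtain a s where x: "x = fr a s" "a \<in> carrier R" "s \<in> S" by auto
    then have "fr (\<ominus> a) s \<oplus>\<^bsub>?L\<^esub> x = \<zero>\<^bsub>?L\<^esub>"
      by (simp add: r_distr[symmetric] l_neg) (rule fr_eqI, auto)
    with x show "\<exists>y\<in>carrier ?L. y \<oplus>\<^bsub>?L\<^esub> x = \<zero>\<^bsub>?L\<^esub>" by (intro bexI[of _ "fr (\<ominus> a) s"]) auto
  qed
  show "Group.comm_monoid ?L"
  proof (rule comm_monoidI)
    show "\<one>\<^bsub>?L\<^esub> \<in> carrier ?L" by force
    fix x y assume "x \<in> carrier ?L" "y \<in> carrier ?L"
    then show "x \<otimes>\<^bsub>?L\<^esub> y \<in> carrier ?L" by force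
    from \<open>x \<in> carrier ?L\<close> \<open>y \<in> carrier ?L\<close> show "x \<otimes>\<^bsub>?L\<^esub> y = y \<otimes>\<^bsub>?L\<^esub> x" 
      by (auto intro!: fr_eqI simp: m_ac)
    fix z assume "z \<in> carrier ?L"
    with \<open>x \<in> carrier ?L\<close> \<open>y \<in> carrier ?L\<close> show "x \<otimes>\<^bsub>?L\<^esub> y \<otimes>\<^bsub>?L\<^esub> z = x \<otimes>\<^bsub>?L\<^esub> (y \<otimes>\<^bsub>?L\<^esub> z)"
      by (auto intro!: fr_eqI simp: m_ac)
  qed (auto intro!: fr_eqI)
  show "(x \<oplus>\<^bsub>?L\<^esub> y) \<otimes>\<^bsub>?L\<^esub> z = x \<otimes>\<^bsub>?L\<^esub> z \<oplus>\<^bsub>?L\<^esub> y \<otimes>\<^bsub>?L\<^esub> z"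
    if "x \<in> carrier ?L" "y \<in> carrier ?L" "z \<in> carrier ?L" for x y z
  proof -
    from that obtain a s b t c r where [simp]: "x = fr a s" "y = fr b t" "z = fr c r"
      "a \<in> carrier R" "s \<in> S" "b \<in> carrier R" "t \<in> S" "c \<in> carrier R" "r \<in> S" by auto
    show ?thesis by (simp, rule fr_eqI) (simp_all add: m_ac r_distr)
  qed
qed

lemma fr_mem_ring_hom: "(\<lambda>a. fr a \<one>) \<in> ring_hom R (localization R S)"
  by (rule ring_hom_memI) (auto simp: fr_mult fr_add fr_one one_S)

lemma fr_unit: "s \<in> S \<Longrightarrow> fr s \<one> \<in> Units (localization R S)"
  unfolding Units_def
  using fr_eqI[of s s \<one> \<one>] one_S by (simp add: fr_mult fr_one) (metis fr_closed fr_mult l_one one_closed r_one S_closed)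

lemma fr_factor: "a \<in> carrier R \<Longrightarrow> s \<in> S \<Longrightarrow> fr a s \<otimes>\<^bsub>localization R S\<^esub> fr s \<one> = fr a \<one>"
  by (simp add: fr_mult one_S) (rule fr_eqI, simp_all add: one_S m_comm)

lemma frac_hom_localization: "frac_hom R S (localization R S) (\<lambda>a. fr a \<one>)"
  unfolding frac_hom_def
proof (intro conjI)
  show "\<forall>x\<in>carrier (localization R S). \<exists>a\<in>carrier R. \<exists>s\<in>S. x \<otimes>\<^bsub>localization R S\<^esub> fr s \<one> = fr a \<one>"
    using fr_factor unfolding carrier_localization by blast
qed (auto simp: is_cring cring_localization fr_mem_ring_hom fr_unit one_S intro: mult_S)

lemma fr_eq_zero_iff: "a \<in> carrier R \<Longrightarrow> fr a \<one> = \<zero>\<^bsub>localization R S\<^esub> \<longleftrightarrow> (\<exists>u\<in>S. u \<otimes> a = \<zero>)"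
  by (simp add: fr_zero fr_eq_iff one_S)

end

lemma (in primeideal) mult_subset_complement: "mult_subset R (carrier R - I)"
  using I_prime I_notcarr one_imp_carrier by unfold_locales auto

text \<open>Localizing a ring of fractions of \<open>R\<close> gives a ring of fractions of
  \<open>R\<close> again: elements of \<open>T\<close> are fractions themselves, and their
  denominators, being units, lie outside \<open>Q\<close> and can be cleared. Together with the
  kernel in the second claim, this is the data which \<open>frac_hom_imp_ring_iso\<close>
  consumes.\<close>

lemma frac_hom_localization_at:
  assumes "frac_hom R S T \<phi>" "primeideal Q T"
  shows "frac_hom R {c \<in> carrier R. \<phi> c \<notin> Q} (localization_at T Q) (\<lambda>a. fraction_of T (carrier T - Q) (\<phi> a) \<one>\<^bsub>T\<^esub>)" (is "frac_hom R ?S ?L ?\<psi>")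
    and "a \<in> carrier R \<Longrightarrow> fraction_of T (carrier T - Q) (\<phi> a) \<one>\<^bsub>T\<^esub> = \<zero>\<^bsub>localization_at T Q\<^esub> \<longleftrightarrow>
      (\<exists>s\<in>carrier R. \<phi> s \<notin> Q \<and> \<phi> (s \<otimes>\<^bsub>R\<^esub> a) = \<zero>\<^bsub>T\<^esub>)"
proof -
  interpret frac R S T \<phi> by unfold_locales fact
  interpret Q: primeideal Q T by fact
  interpret L: mult_subset T "carrier T - Q" by (rule Q.mult_subset_complement)
  interpret f: frac T "carrier T - Q" ?L "\<lambda>a. fraction_of T (carrier T - Q) a \<one>\<^bsub>T\<^esub>"
    unfolding localization_at_def by unfold_locales (rule L.frac_hom_localization)
  have unitQ: "u \<notin> Q" if "u \<in> Units T" for u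
    using that Q.I_notcarr Q.one_imp_carrier Q.I_l_closed[of u "inv\<^bsub>T\<^esub> u"] by auto
  have mem: "\<phi> a \<notin> Q" if "x \<in> carrier T" "x \<notin> Q" "a \<in> carrier R" "s \<in> S" "x \<otimes>\<^bsub>T\<^esub> \<phi> s = \<phi> a" for x a s
    using Q.I_prime[of x "\<phi> s"] that unitQ[of "\<phi> s"] by auto
  show "frac_hom R ?S ?L ?\<psi>"
    unfolding frac_hom_def
  proof (intro conjI ballI)
    show "?\<psi> \<in> ring_hom R ?L"
      using ring_hom_trans[OF \<phi>.homh f.\<phi>.homh] by (simp add: comp_def)
    show "\<one>\<^bsub>R\<^esub> \<in> ?S" using unitQ[of "\<one>\<^bsub>T\<^esub>"] by simp
    fix s t assume "s \<in> ?S" "t \<in> ?S"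
    then show "s \<otimes>\<^bsub>R\<^esub> t \<in> ?S" using Q.I_prime[of "\<phi> s" "\<phi> t"] by auto
  next
    show "?\<psi> ` ?S \<subseteq> Units ?L" by (auto intro!: f.S_unit)
    fix x assume "x \<in> carrier ?L"
    then obtain y z where yz: "y \<in> carrier T" "z \<in> carrier T - Q" "x \<otimes>\<^bsub>?L\<^esub> fraction_of T (carrier T - Q) z \<one>\<^bsub>T\<^esub> =
      fraction_of T (carrier T - Q) y \<one>\<^bsub>T\<^esub>" by (rule f.fraction)
    obtain a s where a: "a \<in> carrier R" "s \<in> S" "y \<otimes>\<^bsub>T\<^esub> \<phi> s = \<phi> a" using fraction[OF yz(1)] .
    obtain b t where b: "b \<in> carrier R" "t \<in> S" "z \<otimes>\<^bsub>T\<^esub> \<phi> t = \<phi> b" using fraction[of z] yz(2) by blast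
    have bQ: "\<phi> b \<notin> Q" using mem[OF _ _ b] yz(2) by blast
    let ?i = "\<lambda>a. fraction_of T (carrier T - Q) a \<one>\<^bsub>T\<^esub>"
    have c: "?i y \<in> carrier ?L" "?i z \<in> carrier ?L" "?i (\<phi> s) \<in> carrier ?L" "?i (\<phi> t) \<in> carrier ?L"
      using yz a b by auto
    \<comment> \<open>From \<open>x = y/z\<close>, \<open>y = a/s\<close> and \<open>z = b/t\<close>
      one gets \<open>x = at/bs\<close>.\<close>
    have "x \<otimes>\<^bsub>?L\<^esub> ?\<psi> (b \<otimes>\<^bsub>R\<^esub> s) = (x \<otimes>\<^bsub>?L\<^esub> ?i z) \<otimes>\<^bsub>?L\<^esub> ?i (\<phi> s) \<otimes>\<^bsub>?L\<^esub> ?i (\<phi> t)"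
      using a(1,2) b(1,2) yz(1,2) \<open>x \<in> carrier ?L\<close> c by (simp add: b(3)[symmetric] f.T.m_ac)
    also have "\<dots> = ?\<psi> (a \<otimes>\<^bsub>R\<^esub> t)"
      using a(1,2) b(1,2) yz(1,2) c by (simp add: yz(3) a(3)[symmetric])
    finally have "x \<otimes>\<^bsub>?L\<^esub> ?\<psi> (b \<otimes>\<^bsub>R\<^esub> s) = ?\<psi> (a \<otimes>\<^bsub>R\<^esub> t)" .
    moreover have "b \<otimes>\<^bsub>R\<^esub> s \<in> ?S" using a(1,2) b(1,2) bQ Q.I_prime[of "\<phi> b" "\<phi> s"] unitQ[of "\<phi> s"] by auto
    ultimately show "\<exists>a\<in>carrier R. \<exists>s\<in>?S. x \<otimes>\<^bsub>?L\<^esub> ?\<psi> s = ?\<psi> a"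
      using R.m_closed[OF a(1) S_carrier[OF b(2)]] by blast
  qed (auto simp: R.is_cring f.T.is_cring)
  assume a: "a \<in> carrier R"
  have "?\<psi> a = \<zero>\<^bsub>?L\<^esub> \<longleftrightarrow> (\<exists>u\<in>carrier T - Q. u \<otimes>\<^bsub>T\<^esub> \<phi> a = \<zero>\<^bsub>T\<^esub>)"
    unfolding localization_at_def using a by (intro L.fr_eq_zero_iff) auto
  also have "\<dots> \<longleftrightarrow> (\<exists>s\<in>carrier R. \<phi> s \<notin> Q \<and> \<phi> (s \<otimes>\<^bsub>R\<^esub> a) = \<zero>\<^bsub>T\<^esub>)"
  proof safe
    fix u assume u: "u \<in> carrier T" "u \<notin> Q" "u \<otimes>\<^bsub>T\<^esub> \<phi> a = \<zero>\<^bsub>T\<^esub>"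
    obtain b t where b: "b \<in> carrier R" "t \<in> S" "u \<otimes>\<^bsub>T\<^esub> \<phi> t = \<phi> b" using fraction[OF u(1)] .
    have "\<phi> (b \<otimes>\<^bsub>R\<^esub> a) = (u \<otimes>\<^bsub>T\<^esub> \<phi> a) \<otimes>\<^bsub>T\<^esub> \<phi> t"
      using a b(1,2) u(1) by (simp add: b(3)[symmetric] T.m_ac)
    then show "\<exists>s\<in>carrier R. \<phi> s \<notin> Q \<and> \<phi> (s \<otimes>\<^bsub>R\<^esub> a) = \<zero>\<^bsub>T\<^esub>"
      using mem[OF u(1,2) b] b(1,2) u by (intro bexI[of _ b]) auto
  next
    fix s assume "s \<in> carrier R" "\<phi> s \<notin> Q" "\<phi> (s \<otimes>\<^bsub>R\<^esub> a) = \<zero>\<^bsub>T\<^esub>"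
    then show "\<exists>u\<in>carrier T - Q. u \<otimes>\<^bsub>T\<^esub> \<phi> a = \<zero>\<^bsub>T\<^esub>" using a by (intro bexI[of _ "\<phi> s"]) auto
  qed
  finally show "?\<psi> a = \<zero>\<^bsub>?L\<^esub> \<longleftrightarrow> (\<exists>s\<in>carrier R. \<phi> s \<notin> Q \<and> \<phi> (s \<otimes>\<^bsub>R\<^esub> a) = \<zero>\<^bsub>T\<^esub>)" .
qed

section \<open>Quotients, smaller base rings, noetherian and local rings\<close>

lemma frac_hom_surj:
  assumes "cring R" "cring T" "\<phi> \<in> ring_hom R T" "\<phi> ` carrier R = carrier T"
  shows "frac_hom R {\<one>\<^bsub>R\<^esub>} T \<phi>"
proof -
  interpret R: cring R by fact
  interpret T: cring T by fact
  interpret ring_hom_cring R T \<phi> by unfold_locales fact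
  have "\<exists>a\<in>carrier R. x \<otimes>\<^bsub>T\<^esub> \<phi> \<one>\<^bsub>R\<^esub> = \<phi> a" if "x \<in> carrier T" for x
    using that assms(4) by auto
  then show ?thesis using assms(3) unfolding frac_hom_def by (auto simp: R.is_cring T.is_cring)
qed

lemma frac_hom_quotient:
  assumes "frac_hom R S T \<phi>" "ideal I T"
  shows "frac_hom R S (T Quot I) (\<lambda>a. I +>\<^bsub>T\<^esub> \<phi> a)"
    and "a \<in> carrier R \<Longrightarrow> I +>\<^bsub>T\<^esub> \<phi> a = \<zero>\<^bsub>T Quot I\<^esub> \<longleftrightarrow> \<phi> a \<in> I"
proof -
  interpret frac R S T \<phi> by unfold_locales fact
  interpret I: ideal I T by fact
  interpret q: ring_hom_cring T "T Quot I" "(+>\<^bsub>T\<^esub>) I" by (rule I.rcos_ring_hom_cring) (rule T.is_cring)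
  show "frac_hom R S (T Quot I) (\<lambda>a. I +>\<^bsub>T\<^esub> \<phi> a)"
    unfolding frac_hom_def
  proof (intro conjI ballI)
    show "(\<lambda>a. I +>\<^bsub>T\<^esub> \<phi> a) \<in> ring_hom R (T Quot I)"
      using ring_hom_trans[OF \<phi>.homh q.homh] by (simp add: comp_def)
    show "(\<lambda>a. I +>\<^bsub>T\<^esub> \<phi> a) ` S \<subseteq> Units (T Quot I)"
    proof safe
      fix s assume s: "s \<in> S"
      have "(I +>\<^bsub>T\<^esub> inv\<^bsub>T\<^esub> (\<phi> s)) \<otimes>\<^bsub>T Quot I\<^esub> (I +>\<^bsub>T\<^esub> \<phi> s) = \<one>\<^bsub>T Quot I\<^esub>"
        "(I +>\<^bsub>T\<^esub> \<phi> s) \<otimes>\<^bsub>T Quot I\<^esub> (I +>\<^bsub>T\<^esub> inv\<^bsub>T\<^esub> (\<phi> s)) = \<one>\<^bsub>T Quot I\<^esub>"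
        using s by (simp_all flip: q.hom_mult)
      then show "I +>\<^bsub>T\<^esub> \<phi> s \<in> Units (T Quot I)"
        using s unfolding Units_def by (auto intro!: bexI[of _ "I +>\<^bsub>T\<^esub> inv\<^bsub>T\<^esub> (\<phi> s)"] q.hom_closed)
    qed
    fix y assume "y \<in> carrier (T Quot I)"
    then obtain x where x: "x \<in> carrier T" "y = I +>\<^bsub>T\<^esub> x" 
      unfolding FactRing_def A_RCOSETS_def' partial_object.simps by blast
    obtain a s where as: "a \<in> carrier R" "s \<in> S" "x \<otimes>\<^bsub>T\<^esub> \<phi> s = \<phi> a" using fraction[OF x(1)] .
    then have "y \<otimes>\<^bsub>T Quot I\<^esub> (I +>\<^bsub>T\<^esub> \<phi> s) = I +>\<^bsub>T\<^esub> \<phi> a"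
      unfolding as(3)[symmetric] x(2) using x(1) as(1,2) by (intro q.hom_mult[symmetric]) auto
    with as show "\<exists>a\<in>carrier R. \<exists>s\<in>S. y \<otimes>\<^bsub>T Quot I\<^esub> (I +>\<^bsub>T\<^esub> \<phi> s) = I +>\<^bsub>T\<^esub> \<phi> a" by blast
  qed (simp_all add: R.is_cring q.S.is_cring subsetI)
  have [simp]: "\<zero>\<^bsub>T Quot I\<^esub> = I" unfolding FactRing_def by simp
  show "I +>\<^bsub>T\<^esub> \<phi> a = \<zero>\<^bsub>T Quot I\<^esub> \<longleftrightarrow> \<phi> a \<in> I" if "a \<in> carrier R"
    unfolding \<open>\<zero>\<^bsub>T Quot I\<^esub> = I\<close> using I.a_rcos_const[of "\<phi> a"] I.a_rcos_self[OF \<phi>.hom_closed[OF that]] by metis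
qed

lemma ring_iso_imp_frac_hom:
  assumes "frac_hom R S T \<phi>" "h \<in> ring_iso T B" "cring B"
  shows "frac_hom R S B (\<lambda>a. h (\<phi> a))"
    and "a \<in> carrier R \<Longrightarrow> h (\<phi> a) = \<zero>\<^bsub>B\<^esub> \<longleftrightarrow> \<phi> a = \<zero>\<^bsub>T\<^esub>"
proof -
  interpret frac R S T \<phi> by unfold_locales fact
  interpret B: cring B by fact
  have h: "h \<in> ring_hom T B" "bij_betw h (carrier T) (carrier B)" using assms(2) by (auto simp: ring_iso_def)
  interpret h: ring_hom_cring T B h by unfold_locales (rule h)
  show "frac_hom R S B (\<lambda>a. h (\<phi> a))"
    unfolding frac_hom_def
  proof (intro conjI ballI)
    show "(\<lambda>a. h (\<phi> a)) \<in> ring_hom R B"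
      using ring_hom_trans[OF \<phi>.homh h.homh] by (simp add: comp_def)
    show "(\<lambda>a. h (\<phi> a)) ` S \<subseteq> Units B"
    proof safe
      fix s assume s: "s \<in> S"
      have "h (inv\<^bsub>T\<^esub> (\<phi> s)) \<otimes>\<^bsub>B\<^esub> h (\<phi> s) = \<one>\<^bsub>B\<^esub>" "h (\<phi> s) \<otimes>\<^bsub>B\<^esub> h (inv\<^bsub>T\<^esub> (\<phi> s)) = \<one>\<^bsub>B\<^esub>"
        using s by (simp_all flip: h.hom_mult)
      then show "h (\<phi> s) \<in> Units B"
        using s unfolding Units_def by (auto intro!: bexI[of _ "h (inv\<^bsub>T\<^esub> (\<phi> s))"] h.hom_closed)
    qed
    fix y assume "y \<in> carrier B"
    then obtain x where x: "x \<in> carrier T" "y = h x" using h(2) by (auto simp: bij_betw_def)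
    obtain a s where as: "a \<in> carrier R" "s \<in> S" "x \<otimes>\<^bsub>T\<^esub> \<phi> s = \<phi> a" using fraction[OF x(1)] .
    then have "y \<otimes>\<^bsub>B\<^esub> h (\<phi> s) = h (\<phi> a)"
      unfolding as(3)[symmetric] x(2) using x(1) as(1,2) by (intro h.hom_mult[symmetric]) auto
    with as show "\<exists>a\<in>carrier R. \<exists>s\<in>S. y \<otimes>\<^bsub>B\<^esub> h (\<phi> s) = h (\<phi> a)" by blast
  qed (auto simp: R.is_cring B.is_cring)
  show "h (\<phi> a) = \<zero>\<^bsub>B\<^esub> \<longleftrightarrow> \<phi> a = \<zero>\<^bsub>T\<^esub>" if "a \<in> carrier R"
    using that h(2) inj_onD[of h "carrier T" "\<phi> a" "\<zero>\<^bsub>T\<^esub>"] by (auto simp: bij_betw_def)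
qed

text \<open>The base ring may be shrunk to \<open>C\<close> as long as every element of
  \<open>R\<close> is moved into \<open>C\<close> by some denominator from \<open>C\<close>:
  expanding a fraction by such denominators brings its numerator and its denominator into
  \<open>C\<close>.\<close>

lemma frac_hom_restrict:
  assumes "frac_hom R S T \<phi>" "cring (R\<lparr>carrier := C\<rparr>)" "C \<subseteq> carrier R"
    and ex: "\<And>a. a \<in> carrier R \<Longrightarrow> \<exists>v\<in>S \<inter> C. v \<otimes>\<^bsub>R\<^esub> a \<in> C"
  shows "frac_hom (R\<lparr>carrier := C\<rparr>) (S \<inter> C) T \<phi>"
proof -
  interpret frac R S T \<phi> by unfold_locales fact
  interpret C: cring "R\<lparr>carrier := C\<rparr>" by fact
  have [simp]: "a \<otimes>\<^bsub>R\<^esub> b \<in> C" if "a \<in> C" "b \<in> C" for a b using C.m_closed that by simp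
  have [simp]: "a \<in> carrier R" if "a \<in> C" for a using that assms(3) by blast
  show ?thesis unfolding frac_hom_def
  proof (intro conjI ballI)
    show "\<phi> \<in> ring_hom (R\<lparr>carrier := C\<rparr>) T"
      using \<phi>.homh assms(3) by (intro ring_hom_memI) auto
    show "\<one>\<^bsub>R\<lparr>carrier := C\<rparr>\<^esub> \<in> S \<inter> C" using C.one_closed by simp
    fix x assume x: "x \<in> carrier T"
    obtain a s where as: "a \<in> carrier R" "s \<in> S" "x \<otimes>\<^bsub>T\<^esub> \<phi> s = \<phi> a" using fraction[OF x] .
    obtain v where v: "v \<in> S" "v \<in> C" "v \<otimes>\<^bsub>R\<^esub> a \<in> C" using ex[OF as(1)] by blast
    obtain u where u: "u \<in> S" "u \<in> C" "u \<otimes>\<^bsub>R\<^esub> s \<in> C" using ex[of s] as(2) S_carrier by blast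
    \<comment> \<open>The fraction \<open>a/s\<close> is expanded by \<open>uv\<close>; here
      \<open>v\<close> takes care of \<open>a\<close>, and \<open>u\<close> of
      \<open>s\<close>.\<close>
    have "x \<otimes>\<^bsub>T\<^esub> \<phi> (v \<otimes>\<^bsub>R\<^esub> (u \<otimes>\<^bsub>R\<^esub> s)) = \<phi> (u \<otimes>\<^bsub>R\<^esub> (v \<otimes>\<^bsub>R\<^esub> a))"
      using as(1,2) v(1) u(1) x by (simp add: as(3)[symmetric] T.m_ac)
    moreover have "v \<otimes>\<^bsub>R\<^esub> (u \<otimes>\<^bsub>R\<^esub> s) \<in> S \<inter> C" "u \<otimes>\<^bsub>R\<^esub> (v \<otimes>\<^bsub>R\<^esub> a) \<in> C"
      using as(1,2) v u by auto
    ultimately show "\<exists>a\<in>carrier (R\<lparr>carrier := C\<rparr>). \<exists>s\<in>S \<inter> C. x \<otimes>\<^bsub>T\<^esub> \<phi> s = \<phi> a"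
      by (metis partial_object.select_convs(1) partial_object.surjective partial_object.update_convs(1))
  qed (auto simp: C.is_cring T.is_cring)
qed

text \<open>Every ideal of \<open>T\<close> is extended from its contraction to \<open>R\<close>,
  since \<open>x\<close> differs from its numerator only by a unit. Generators of the contraction
  therefore generate \<open>I\<close>.\<close>

lemma frac_hom_noetherian:
  assumes "frac_hom R S T \<phi>" "noetherian_ring R"
  shows "noetherian_ring T"
proof -
  interpret frac R S T \<phi> by unfold_locales fact
  interpret N: noetherian_ring R by fact
  note vimage = ring_hom_ring.ideal_vimage[OF ring_hom_ringI2[OF R.ring_axioms T.ring_axioms \<phi>.homh]]
  show ?thesis
  proof (rule T.noetherian_ringI)
    fix I assume I: "ideal I T"
    interpret I: ideal I T by fact
    have "ideal {r \<in> carrier R. \<phi> r \<in> I} R" by (rule vimage[OF I])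
    then obtain F where F: "F \<subseteq> carrier R" "finite F" "{r \<in> carrier R. \<phi> r \<in> I} = Idl\<^bsub>R\<^esub> F"
      using N.finetely_gen by blast
    have F': "\<phi> ` F \<subseteq> carrier T" using F by auto
    interpret G: ideal "Idl\<^bsub>T\<^esub> (\<phi> ` F)" T by (rule T.genideal_ideal[OF F'])
    have "F \<subseteq> {r \<in> carrier R. \<phi> r \<in> Idl\<^bsub>T\<^esub> (\<phi> ` F)}" using F(1) T.genideal_self[OF F'] by auto
    then have sub: "Idl\<^bsub>R\<^esub> F \<subseteq> {r \<in> carrier R. \<phi> r \<in> Idl\<^bsub>T\<^esub> (\<phi> ` F)}"
      by (rule R.genideal_minimal[OF vimage[OF G.is_ideal]])
    have "I = Idl\<^bsub>T\<^esub> (\<phi> ` F)"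
    proof
      show "Idl\<^bsub>T\<^esub> (\<phi> ` F) \<subseteq> I"
        using F R.genideal_self[OF F(1)] by (intro T.genideal_minimal[OF I]) auto
      show "I \<subseteq> Idl\<^bsub>T\<^esub> (\<phi> ` F)"
      proof
        fix x assume x: "x \<in> I"
        then have xc: "x \<in> carrier T" by (rule I.Icarr)
        obtain a s where as: "a \<in> carrier R" "s \<in> S" "x \<otimes>\<^bsub>T\<^esub> \<phi> s = \<phi> a" using fraction[OF xc] .
        have "\<phi> a \<in> I" unfolding as(3)[symmetric] using x as(2) by (auto intro: I.I_r_closed)
        then have "\<phi> a \<in> Idl\<^bsub>T\<^esub> (\<phi> ` F)" using sub F(3) as(1) by blast
        then have "\<phi> a \<otimes>\<^bsub>T\<^esub> inv\<^bsub>T\<^esub> (\<phi> s) \<in> Idl\<^bsub>T\<^esub> (\<phi> ` F)" using as(2) by (intro G.I_r_closed) auto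
        moreover have "\<phi> a \<otimes>\<^bsub>T\<^esub> inv\<^bsub>T\<^esub> (\<phi> s) = x"
          unfolding as(3)[symmetric] using xc as(2) by (simp add: T.m_assoc)
        ultimately show "x \<in> Idl\<^bsub>T\<^esub> (\<phi> ` F)" by simp
      qed
    qed
    then show "\<exists>A\<subseteq>carrier T. finite A \<and> I = Idl\<^bsub>T\<^esub> A" using F' F(2) by blast
  qed
qed

text \<open>The non-units are the fractions with numerator in \<open>Q\<close>. If such an
  \<open>a/s\<close> had an inverse \<open>b/t\<close>, then \<open>ba - ts\<close> would lie in the
  kernel and so in \<open>Q\<close>; with \<open>a\<close> in \<open>Q\<close> this forces
  \<open>ts\<close> into \<open>Q\<close>, against primeness.\<close>

lemma frac_hom_local:
  assumes "frac_hom R (carrier R - Q) T \<phi>" "primeideal Q R"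
    and ker: "\<And>a. a \<in> carrier R \<Longrightarrow> \<phi> a = \<zero>\<^bsub>T\<^esub> \<Longrightarrow> a \<in> Q"
  shows "local_ring T" "maximalideal (carrier T - Units T) T"
    "\<And>a. a \<in> carrier R \<Longrightarrow> \<phi> a \<in> carrier T - Units T \<longleftrightarrow> a \<in> Q"
    "\<And>m. maximalideal m T \<Longrightarrow> m = carrier T - Units T"
proof -
  interpret frac R "carrier R - Q" T \<phi> by unfold_locales fact
  interpret Q: primeideal Q R by fact
  let ?m = "carrier T - Units T"
  have nonunit: "x \<notin> Units T" if x: "x \<in> carrier T" "a \<in> Q" "s \<in> carrier R - Q" "x \<otimes>\<^bsub>T\<^esub> \<phi> s = \<phi> a" for x a s
  proof
    assume "x \<in> Units T"
    then have xi: "inv\<^bsub>T\<^esub> x \<in> carrier T" "inv\<^bsub>T\<^esub> x \<otimes>\<^bsub>T\<^esub> x = \<one>\<^bsub>T\<^esub>" by auto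
    obtain b t where bt: "b \<in> carrier R" "t \<in> carrier R - Q" "inv\<^bsub>T\<^esub> x \<otimes>\<^bsub>T\<^esub> \<phi> t = \<phi> b"
      using fraction[OF xi(1)] .
    have a: "a \<in> carrier R" using x(2) by (rule Q.Icarr)
    have "\<phi> (b \<otimes>\<^bsub>R\<^esub> a) = (inv\<^bsub>T\<^esub> x \<otimes>\<^bsub>T\<^esub> x) \<otimes>\<^bsub>T\<^esub> (\<phi> t \<otimes>\<^bsub>T\<^esub> \<phi> s)"
      using a bt(1,2) x(1,3) xi(1) by (simp add: bt(3)[symmetric] x(4)[symmetric] T.m_ac)
    then have "\<phi> (b \<otimes>\<^bsub>R\<^esub> a \<ominus>\<^bsub>R\<^esub> t \<otimes>\<^bsub>R\<^esub> s) = \<zero>\<^bsub>T\<^esub>"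
      using a bt(1,2) x(3) by (simp add: xi(2) R.minus_eq T.r_neg)
    then have "b \<otimes>\<^bsub>R\<^esub> a \<ominus>\<^bsub>R\<^esub> t \<otimes>\<^bsub>R\<^esub> s \<in> Q" using a bt(1,2) x(3) by (intro ker) auto
    moreover have "b \<otimes>\<^bsub>R\<^esub> a \<in> Q" using x(2) bt(1) by (rule Q.I_l_closed)
    ultimately have "b \<otimes>\<^bsub>R\<^esub> a \<ominus>\<^bsub>R\<^esub> (b \<otimes>\<^bsub>R\<^esub> a \<ominus>\<^bsub>R\<^esub> t \<otimes>\<^bsub>R\<^esub> s) \<in> Q"
      unfolding R.minus_eq[of "b \<otimes>\<^bsub>R\<^esub> a" "b \<otimes>\<^bsub>R\<^esub> a \<ominus>\<^bsub>R\<^esub> t \<otimes>\<^bsub>R\<^esub> s"] by (intro Q.a_closed Q.a_inv_closed)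
    moreover have "b \<otimes>\<^bsub>R\<^esub> a \<ominus>\<^bsub>R\<^esub> (b \<otimes>\<^bsub>R\<^esub> a \<ominus>\<^bsub>R\<^esub> t \<otimes>\<^bsub>R\<^esub> s) = t \<otimes>\<^bsub>R\<^esub> s"
      using a bt(1,2) x(3) by (simp, algebra)
    ultimately show False using Q.I_prime[of t s] bt(2) x(3) by auto
  qed
  have unit: "x \<in> Units T" if x: "x \<in> carrier T" "a \<in> carrier R - Q" "s \<in> carrier R - Q" "x \<otimes>\<^bsub>T\<^esub> \<phi> s = \<phi> a" for x a s
  proof -
    have "x = \<phi> a \<otimes>\<^bsub>T\<^esub> inv\<^bsub>T\<^esub> (\<phi> s)" unfolding x(4)[symmetric] using x(1,3) by (simp add: T.m_assoc)
    then show ?thesis using x(2,3) by (simp add: T.Units_m_closed)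
  qed
  have frac_m: "\<exists>a\<in>Q. \<exists>s\<in>carrier R - Q. x \<otimes>\<^bsub>T\<^esub> \<phi> s = \<phi> a" if "x \<in> ?m" for x
  proof -
    have "x \<in> carrier T" using that by blast
    then obtain a s where as: "a \<in> carrier R" "s \<in> carrier R - Q" "x \<otimes>\<^bsub>T\<^esub> \<phi> s = \<phi> a"
      by (rule fraction)
    then have "a \<in> Q" using unit[of x a s] that by blast
    then show ?thesis using as by blast
  qed
  show memQ: "\<phi> a \<in> ?m \<longleftrightarrow> a \<in> Q" if "a \<in> carrier R" for a
  proof -
    have "\<one>\<^bsub>R\<^esub> \<in> carrier R - Q" by (rule S_one)
    then have "\<phi> a \<notin> Units T" if "a \<in> Q"
      using nonunit[of "\<phi> a" a "\<one>\<^bsub>R\<^esub>"] that \<open>a \<in> carrier R\<close> by simp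
    moreover have "\<phi> a \<in> Units T" if "a \<notin> Q" using that \<open>a \<in> carrier R\<close> by (intro S_unit) simp
    ultimately show ?thesis using \<phi>.hom_closed[OF that] by blast
  qed
  have ideal: "ideal ?m T"
  proof (rule idealI)
    show "ring T" by (rule T.ring_axioms)
    show "subgroup ?m (add_monoid T)"
    proof (rule T.add.subgroupI)
      show "?m \<noteq> {}" using memQ[of "\<zero>\<^bsub>R\<^esub>"] by auto
      fix x assume x: "x \<in> ?m"
      then obtain a s where a: "a \<in> Q" "s \<in> carrier R - Q" "x \<otimes>\<^bsub>T\<^esub> \<phi> s = \<phi> a" using frac_m by blast
      have "(\<ominus>\<^bsub>T\<^esub> x) \<otimes>\<^bsub>T\<^esub> \<phi> s = \<phi> (\<ominus>\<^bsub>R\<^esub> a)" using x a(1,2) Q.Icarr[OF a(1)] by (simp add: a(3) T.l_minus)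
      then show "\<ominus>\<^bsub>T\<^esub> x \<in> ?m" using nonunit[of "\<ominus>\<^bsub>T\<^esub> x" "\<ominus>\<^bsub>R\<^esub> a" s] x a(1,2) by auto
      fix y assume y: "y \<in> ?m"
      then obtain b t where b: "b \<in> Q" "t \<in> carrier R - Q" "y \<otimes>\<^bsub>T\<^esub> \<phi> t = \<phi> b" using frac_m by blast
      have eq: "(x \<oplus>\<^bsub>T\<^esub> y) \<otimes>\<^bsub>T\<^esub> \<phi> (s \<otimes>\<^bsub>R\<^esub> t) = \<phi> (a \<otimes>\<^bsub>R\<^esub> t \<oplus>\<^bsub>R\<^esub> b \<otimes>\<^bsub>R\<^esub> s)"
        using fraction_add[OF Q.Icarr[OF a(1)] Q.Icarr[OF b(1)] a(2) b(2) _ _ a(3) b(3)] x y by blast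
      have "a \<otimes>\<^bsub>R\<^esub> t \<oplus>\<^bsub>R\<^esub> b \<otimes>\<^bsub>R\<^esub> s \<in> Q"
        using a(1,2) b(1,2) by (intro Q.a_closed Q.I_r_closed) auto
      then show "x \<oplus>\<^bsub>T\<^esub> y \<in> ?m"
        using nonunit[OF _ _ S_mult[OF a(2) b(2)] eq] x y by simp
    qed auto
    fix x y assume x: "x \<in> ?m" and y: "y \<in> carrier T"
    then show "y \<otimes>\<^bsub>T\<^esub> x \<in> ?m" 
      using T.unit_factor[of x y] by (auto simp: T.m_comm)
    with x y show "x \<otimes>\<^bsub>T\<^esub> y \<in> ?m" by (simp add: T.m_comm)
  qed
  interpret m: ideal ?m T by fact
  have proper: "J = carrier T \<or> J \<subseteq> ?m" if J: "ideal J T" for J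
  proof -
    interpret J: ideal J T by fact
    have "J = carrier T" if "u \<in> J" "u \<in> Units T" for u
      using J.I_l_closed[OF that(1) T.Units_inv_closed[OF that(2)]] J.one_imp_carrier
      unfolding T.Units_l_inv[OF that(2)] by blast
    then show ?thesis using J.Icarr by blast
  qed
  show max: "maximalideal ?m T"
  proof (rule maximalidealI[OF ideal])
    show "carrier T \<noteq> ?m" using T.Units_one_closed by blast
    show "J = ?m \<or> J = carrier T" if "ideal J T" "?m \<subseteq> J" for J
      using proper[OF that(1)] that(2) by blast
  qed
  show uniq: "m = ?m" if m: "maximalideal m T" for m
  proof -
    interpret M: maximalideal m T by fact
    show ?thesis using proper[OF M.is_ideal] M.I_maximal[OF ideal] M.I_notcarr T.Units_one_closed by blast
  qed
  show "local_ring T" unfolding local_ring_def using max uniq T.is_cring by blast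
qed

section \<open>Copies of rings in the universe type\<close>

lemma ring_iso_copy:
  assumes "cring R" "carrier R \<lesssim> (UNIV :: 'u set)"
  obtains B :: "'u ring" and h where "cring B" "h \<in> ring_iso R B"
proof -
  interpret cring R by fact
  obtain f :: "_ \<Rightarrow> 'u" where f: "inj_on f (carrier R)" using assms(2) by (auto simp: lepoll_def)
  have iso: "f \<in> ring_iso R (image_ring f R)" by (rule inj_imp_image_ring_iso[OF f])
  have "cring (image_ring f R)"
    using ring_iso_imp_img_cring[OF iso] by (simp add: image_ring_def image_group_def monoid.defs)
  then show ?thesis using that iso by blast
qed

lemma times_infinite_lepoll:
  assumes "A \<lesssim> (UNIV :: 'u set)" "B \<lesssim> (UNIV :: 'u set)" "infinite (UNIV :: 'u set)"
  shows "A \<times> B \<lesssim> (UNIV :: 'u set)"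
proof -
  have "A \<times> B \<lesssim> (UNIV :: 'u set) \<times> (UNIV :: 'u set)" using assms by (intro times_lepoll_mono)
  also have "\<dots> \<approx> (UNIV :: 'u set)"
    using card_of_Times_same_infinite[OF assms(3)] by (simp add: eqpoll_iff_card_of_ordIso)
  finally show ?thesis .
qed

text \<open>An element of \<open>T\<close> is given by a pair of elements of \<open>R\<close>, and
  an infinite type absorbs its square.\<close>

lemma frac_hom_lepoll:
  assumes "frac_hom R S T \<phi>" "carrier R \<lesssim> (UNIV :: 'u set)" "infinite (UNIV :: 'u set)"
  shows "carrier T \<lesssim> (UNIV :: 'u set)"
proof -
  interpret frac R S T \<phi> by unfold_locales fact
  have "carrier T \<subseteq> (\<lambda>(a, s). \<phi> a \<otimes>\<^bsub>T\<^esub> inv\<^bsub>T\<^esub> (\<phi> s)) ` (carrier R \<times> carrier R)"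
  proof
    fix x assume x: "x \<in> carrier T"
    obtain a s where as: "a \<in> carrier R" "s \<in> S" "x \<otimes>\<^bsub>T\<^esub> \<phi> s = \<phi> a" using fraction[OF x] .
    have "x = \<phi> a \<otimes>\<^bsub>T\<^esub> inv\<^bsub>T\<^esub> (\<phi> s)" unfolding as(3)[symmetric] using x as(2) by (simp add: T.m_assoc)
    then show "x \<in> (\<lambda>(a, s). \<phi> a \<otimes>\<^bsub>T\<^esub> inv\<^bsub>T\<^esub> (\<phi> s)) ` (carrier R \<times> carrier R)"
      using as by (auto intro!: image_eqI[of _ _ "(a, s)"])
  qed
  then have "carrier T \<lesssim> carrier R \<times> carrier R" by (rule subset_image_lepoll)
  also have "\<dots> \<lesssim> (UNIV :: 'u set)" by (rule times_infinite_lepoll) fact+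
  finally show ?thesis .
qed

lemma has_property_iso:
  assumes "has_property P R" "R \<simeq> T"
  shows "has_property P T"
  using assms ring_iso_trans unfolding has_property_def by blast

lemma has_property_iso_iff:
  assumes "R \<simeq> T" "ring R"
  shows "has_property P R \<longleftrightarrow> has_property P T"
  using has_property_iso[OF _ assms(1)] has_property_iso[OF _ ring_iso_sym[OF assms(2,1)]] by blast

section \<open>Extension of an ideal to the polynomial ring\<close>

lemma (in ideal) finsum_mem:
  assumes "finite A" "f ` A \<subseteq> I"
  shows "finsum R f A \<in> I"
  using assms
proof (induction A)
  case (insert x F)
  then have "f \<in> F \<rightarrow> carrier R" "f x \<in> carrier R" using Icarr by auto
  then show ?case using insert by simp
qed auto

lemma coeff_UP: "p \<in> carrier (UP A) \<Longrightarrow> up_ring.coeff (UP A) p n = p n"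
  by (simp add: UP_def)

text \<open>The coefficientwise condition is stable under convolution, hence defines an ideal;
  conversely \<open>p\<close> is the sum of its coefficients, each in \<open>m\<close>, times powers
  of the variable. This form permits the comparison with \<open>coeffs_in\<close> later.\<close>

lemma extend_to_UP_eq:
  assumes "cring A" "ideal m A"
  shows "extend_to_UP A m = {p \<in> carrier (UP A). \<forall>n. p n \<in> m}" (is "_ = ?M")
    and "ideal (extend_to_UP A m) (UP A)"
proof -
  interpret m: ideal m A by fact
  interpret UP_cring A "UP A" by (rule UP_cring.intro) fact
  note coeff = coeff_UP[of _ A]
  have sub: "(\<lambda>a. up_ring.monom (UP A) a 0) ` m \<subseteq> carrier (UP A)" by (auto intro: m.Icarr)
  interpret I: ideal "extend_to_UP A m" "UP A"
    unfolding extend_to_UP_def by (rule genideal_ideal[OF sub])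
  show "ideal (extend_to_UP A m) (UP A)" by (rule I.is_ideal)
  have ring_ops: "(p \<oplus>\<^bsub>UP A\<^esub> q) n = p n \<oplus>\<^bsub>A\<^esub> q n" "(\<ominus>\<^bsub>UP A\<^esub> p) n = \<ominus>\<^bsub>A\<^esub> p n"
    "(p \<otimes>\<^bsub>UP A\<^esub> q) n = (\<Oplus>\<^bsub>A\<^esub>i \<in> {..n}. p i \<otimes>\<^bsub>A\<^esub> q (n - i))" "\<zero>\<^bsub>UP A\<^esub> n = \<zero>\<^bsub>A\<^esub>"
    if "p \<in> carrier (UP A)" "q \<in> carrier (UP A)" for p q n
    using coeff_add[of p q n] coeff_a_inv[of p n] coeff_mult[of p q n] coeff_zero[of n] coeff[OF UP_zero_closed, of n] that by (simp_all add: coeff)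
  have "ideal ?M (UP A)"
  proof (rule idealI)
    show "ring (UP A)" by (rule UP_ring)
    show "subgroup ?M (add_monoid (UP A))"
    proof (rule add.subgroupI)
      show "?M \<noteq> {}" using ring_ops(4)[OF UP_zero_closed UP_zero_closed] m.zero_closed by (auto intro!: exI[of _ "\<zero>\<^bsub>UP A\<^esub>"])
      fix p assume p: "p \<in> ?M"
      then show "\<ominus>\<^bsub>UP A\<^esub> p \<in> ?M" by (auto simp: ring_ops)
      fix q assume q: "q \<in> ?M"
      with p show "p \<oplus>\<^bsub>UP A\<^esub> q \<in> ?M" by (auto simp: ring_ops intro: m.a_closed)
    qed auto
    fix p q assume p: "p \<in> ?M" and q: "q \<in> carrier (UP A)"
    have "(q \<otimes>\<^bsub>UP A\<^esub> p) n \<in> m" for n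
    proof -
      have "(q \<otimes>\<^bsub>UP A\<^esub> p) n = (\<Oplus>\<^bsub>A\<^esub>i \<in> {..n}. q i \<otimes>\<^bsub>A\<^esub> p (n - i))"
        using p q by (simp add: ring_ops)
      also have "\<dots> \<in> m"
        using p coeff_closed[OF q] by (intro m.finsum_mem) (auto simp: coeff[OF q] intro!: m.I_l_closed)
      finally show ?thesis .
    qed
    then show "q \<otimes>\<^bsub>UP A\<^esub> p \<in> ?M" using p q by auto
    then show "p \<otimes>\<^bsub>UP A\<^esub> q \<in> ?M" using p q by (simp add: P.m_comm)
  qed
  then have "extend_to_UP A m \<subseteq> ?M"
    unfolding extend_to_UP_def
  proof (rule genideal_minimal)
    show "(\<lambda>a. up_ring.monom (UP A) a 0) ` m \<subseteq> ?M" 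
      using coeff_monom[OF m.Icarr, of _ 0] m.zero_closed by (auto simp: m.Icarr coeff)
  qed
  moreover have "?M \<subseteq> extend_to_UP A m"
  proof
    fix p assume p: "p \<in> ?M"
    have "p = (\<Oplus>\<^bsub>UP A\<^esub>i \<in> {..deg A p}. up_ring.monom (UP A) (up_ring.coeff (UP A) p i) i)" using p up_repr by simp
    also have "\<dots> \<in> extend_to_UP A m"
    proof (rule I.finsum_mem, safe)
      fix i
      have pi: "p i \<in> m" "p i \<in> carrier A" using p m.Icarr by auto
      then have "up_ring.monom (UP A) (p i) 0 \<in> extend_to_UP A m"
        unfolding extend_to_UP_def using genideal_self[OF sub] by blast
      then have "up_ring.monom (UP A) (p i) 0 \<otimes>\<^bsub>UP A\<^esub> up_ring.monom (UP A) \<one>\<^bsub>A\<^esub> i \<in> extend_to_UP A m" by (intro I.I_r_closed) auto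
      then show "up_ring.monom (UP A) (up_ring.coeff (UP A) p i) i \<in> extend_to_UP A m"
        using p pi monom_mult[of "p i" "\<one>\<^bsub>A\<^esub>" 0 i] by (simp add: coeff)
    qed
    finally show "p \<in> extend_to_UP A m" .
  qed
  ultimately show "extend_to_UP A m = ?M" by blast
qed

section \<open>Monomials\<close>

abbreviation lookup where "lookup \<equiv> Poly_Mapping.lookup"
abbreviation keys where "keys \<equiv> Poly_Mapping.keys"
abbreviation single where "single \<equiv> Poly_Mapping.single"

text \<open>Induction on the coordinates. A finite set \<open>A0\<close> that suffices for the
  coordinates in \<open>V\<close> also suffices for all \<open>a\<close> whose value at
  \<open>v\<close> is at least the bound \<open>N\<close> of the values on \<open>A0\<close>. Below
  \<open>N\<close> there are finitely many slices, on which the value at \<open>v\<close> is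
  constant. The map \<delta> allows objects other than exponent vectors to be compared.\<close>

lemma dickson_aux:
  fixes \<delta> :: "'a \<Rightarrow> 'x \<Rightarrow> nat"
  assumes "finite V"
  shows "\<exists>A0\<subseteq>A. finite A0 \<and> (\<forall>a\<in>A. \<exists>a0\<in>A0. \<forall>i\<in>V. \<delta> a0 i \<le> \<delta> a i)"
  using assms
proof (induction V arbitrary: A)
  case empty
  show ?case
  proof (cases "A = {}")
    case False
    then obtain a where "a \<in> A" by blast
    then show ?thesis by (intro exI[of _ "{a}"]) auto
  qed auto
next
  case (insert v V)
  obtain A0 where A0: "A0 \<subseteq> A" "finite A0" "\<forall>a\<in>A. \<exists>a0\<in>A0. \<forall>i\<in>V. \<delta> a0 i \<le> \<delta> a i"
    using insert.IH[of A] by blast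
  define N where "N = Max (insert 0 ((\<lambda>a. \<delta> a v) ` A0))"
  have N: "\<delta> a v \<le> N" if "a \<in> A0" for a
    unfolding N_def using A0(2) that by (intro Max_ge) auto
  have "\<exists>B. B \<subseteq> {a \<in> A. \<delta> a v = k} \<and> finite B \<and> (\<forall>a\<in>{a \<in> A. \<delta> a v = k}. \<exists>a0\<in>B. \<forall>i\<in>V. \<delta> a0 i \<le> \<delta> a i)" for k
    using insert.IH[of "{a \<in> A. \<delta> a v = k}"] by blast
  then have "\<exists>B. \<forall>k. B k \<subseteq> {a \<in> A. \<delta> a v = k} \<and> finite (B k) \<and>
      (\<forall>a\<in>{a \<in> A. \<delta> a v = k}. \<exists>a0\<in>B k. \<forall>i\<in>V. \<delta> a0 i \<le> \<delta> a i)"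
    by (intro choice allI)
  then obtain B where *: "\<forall>k. B k \<subseteq> {a \<in> A. \<delta> a v = k} \<and> finite (B k) \<and>
      (\<forall>a\<in>{a \<in> A. \<delta> a v = k}. \<exists>a0\<in>B k. \<forall>i\<in>V. \<delta> a0 i \<le> \<delta> a i)" by blast
  then have B: "\<And>k. B k \<subseteq> {a \<in> A. \<delta> a v = k}" "\<And>k. finite (B k)"
    "\<And>k a. a \<in> A \<Longrightarrow> \<delta> a v = k \<Longrightarrow> \<exists>a0\<in>B k. \<forall>i\<in>V. \<delta> a0 i \<le> \<delta> a i" by simp_all
  show ?case
  proof (intro exI[of _ "A0 \<union> (\<Union>k<N. B k)"] conjI ballI)
    show "A0 \<union> (\<Union>k<N. B k) \<subseteq> A" using A0(1) B(1) by blast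
    show "finite (A0 \<union> (\<Union>k<N. B k))" using A0(2) B(2) by blast
    fix a assume a: "a \<in> A"
    show "\<exists>a0\<in>A0 \<union> (\<Union>k<N. B k). \<forall>i\<in>insert v V. \<delta> a0 i \<le> \<delta> a i"
    proof (cases "\<delta> a v < N")
      case True
      obtain a0 where a0: "a0 \<in> B (\<delta> a v)" "\<forall>i\<in>V. \<delta> a0 i \<le> \<delta> a i" using B(3)[OF a refl] by blast
      then have "\<delta> a0 v = \<delta> a v" using B(1) by blast
      then show ?thesis using a0 True by (intro bexI[of _ a0]) auto
    next
      case False
      obtain a0 where "a0 \<in> A0" "\<forall>i\<in>V. \<delta> a0 i \<le> \<delta> a i" using A0(3) a by blast
      then show ?thesis using N[of a0] False by (intro bexI[of _ a0]) auto
    qed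
  qed
qed

lemma dickson:
  fixes \<delta> :: "'a \<Rightarrow> 'x::finite \<Rightarrow> nat"
  obtains A0 where "A0 \<subseteq> A" "finite A0" "\<And>a. a \<in> A \<Longrightarrow> \<exists>a0\<in>A0. \<delta> a0 \<le> \<delta> a"
proof -
  obtain A0 where A0: "A0 \<subseteq> A" "finite A0" "\<forall>a\<in>A. \<exists>a0\<in>A0. \<forall>i\<in>UNIV. \<delta> a0 i \<le> \<delta> a i"
    using dickson_aux[OF finite_UNIV, of A \<delta>] by blast
  show ?thesis using A0 by (intro that[of A0]) (auto simp: le_fun_def)
qed

section \<open>Monomial orders and monomial preorders\<close>

locale monomial_total_order =
  fixes lx :: "'n::finite monomial \<Rightarrow> 'n monomial \<Rightarrow> bool"
  assumes irrefl: "\<not> lx a a"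
    and trans: "lx a b \<Longrightarrow> lx b c \<Longrightarrow> lx a c"
    and total: "a \<noteq> b \<Longrightarrow> lx a b \<or> lx b a"
    and add_right: "lx a b \<Longrightarrow> lx (a + c) (b + c)"

text \<open>The index type carries no order, so an injection \<open>e\<close> into the natural
  numbers ranks the variables.\<close>

definition lex_monomial :: "('n \<Rightarrow> nat) \<Rightarrow> 'n monomial \<Rightarrow> 'n monomial \<Rightarrow> bool" where
  "lex_monomial e a b \<longleftrightarrow> (\<exists>i. lookup a i < lookup b i \<and> (\<forall>j. e j < e i \<longrightarrow> lookup a j = lookup b j))"

lemma lex_monomial_total_order:
  fixes e :: "'n::finite \<Rightarrow> nat"
  assumes "inj e"
  shows "monomial_total_order (lex_monomial e)"
proof
  fix a b c :: "'n monomial"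
  show "\<not> lex_monomial e a a" by (simp add: lex_monomial_def)
  show "lex_monomial e (a + c) (b + c)" if "lex_monomial e a b"
    using that by (simp add: lex_monomial_def lookup_add)
  show "lex_monomial e a c" if "lex_monomial e a b" "lex_monomial e b c"
  proof -
    from that obtain i j where
      i: "lookup a i < lookup b i" "\<And>k. e k < e i \<Longrightarrow> lookup a k = lookup b k" and
      j: "lookup b j < lookup c j" "\<And>k. e k < e j \<Longrightarrow> lookup b k = lookup c k"
      unfolding lex_monomial_def by blast
    consider "e i < e j" | "e j < e i" | "i = j" using injD[OF assms, of i j] by linarith
    then show ?thesis unfolding lex_monomial_def
    proof cases
      case 1 then show "\<exists>i. lookup a i < lookup c i \<and> (\<forall>j. e j < e i \<longrightarrow> lookup a j = lookup c j)"
        using i j by (intro exI[of _ i]) auto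
    next
      case 2 then show "\<exists>i. lookup a i < lookup c i \<and> (\<forall>j. e j < e i \<longrightarrow> lookup a j = lookup c j)"
        using i j by (intro exI[of _ j]) auto
    next
      case 3 then show "\<exists>i. lookup a i < lookup c i \<and> (\<forall>j. e j < e i \<longrightarrow> lookup a j = lookup c j)"
        using i j by (intro exI[of _ i]) auto
    qed
  qed
  show "lex_monomial e a b \<or> lex_monomial e b a" if "a \<noteq> b"
  proof -
    obtain i0 where "lookup a i0 \<noteq> lookup b i0" using \<open>a \<noteq> b\<close> poly_mapping_eqI[of a b] by blast
    then obtain i where i: "lookup a i \<noteq> lookup b i" "\<And>j. e j < e i \<Longrightarrow> lookup a j = lookup b j"
      using ex_has_least_nat[of "\<lambda>i. lookup a i \<noteq> lookup b i" i0 e] by (metis linorder_not_less)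
    then show ?thesis unfolding lex_monomial_def by (metis linorder_neqE_nat)
  qed
qed

lemma ex_monomial_total_order: "\<exists>lx :: 'n::finite monomial \<Rightarrow> _. monomial_total_order lx"
proof -
  obtain e :: "'n \<Rightarrow> nat" where "inj e" using finite_imp_inj_to_nat_seg[OF finite_UNIV] by blast
  then show ?thesis using lex_monomial_total_order by blast
qed

locale mon_preorder =
  fixes lt :: "'n::finite monomial \<Rightarrow> 'n monomial \<Rightarrow> bool"
  assumes monomial_preorder: "monomial_preorder lt"
begin

lemma lt_irrefl [simp]: "\<not> lt a a"
  using monomial_preorder by (auto simp: monomial_preorder_def weak_order_def irreflp_def)

lemma lt_trans: "lt a b \<Longrightarrow> lt b c \<Longrightarrow> lt a c"
  using monomial_preorder by (auto simp: monomial_preorder_def weak_order_def dest: transpD)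

lemma lt_asym: "lt a b \<Longrightarrow> \<not> lt b a"
  using lt_trans lt_irrefl by blast

lemma tie_trans: "\<not> lt a b \<Longrightarrow> \<not> lt b a \<Longrightarrow> \<not> lt b c \<Longrightarrow> \<not> lt c b \<Longrightarrow> \<not> lt a c"
proof -
  have "transp (\<lambda>a b. \<not> lt a b \<and> \<not> lt b a)"
    using monomial_preorder equivp_imp_transp unfolding monomial_preorder_def weak_order_def by blast
  then show "\<not> lt a b \<Longrightarrow> \<not> lt b a \<Longrightarrow> \<not> lt b c \<Longrightarrow> \<not> lt c b \<Longrightarrow> \<not> lt a c"
    unfolding transp_def by blast
qed

text \<open>The form in which the weak order axiom is used: read as "\<open>b\<close> is at most
  \<open>a\<close>", the relation \<open>\<not> lt a b\<close> is a total preorder.\<close>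

lemma not_lt_trans: "\<not> lt a b \<Longrightarrow> \<not> lt b c \<Longrightarrow> \<not> lt a c"
  using tie_trans lt_trans by blast

lemma lt_add_iff [simp]: "lt (a + c) (b + c) \<longleftrightarrow> lt a b" "lt (c + a) (c + b) \<longleftrightarrow> lt a b"
  using monomial_preorder by (simp_all add: monomial_preorder_def add.commute[of c])

lemma ex_maximal:
  assumes "finite K" "K \<noteq> {}"
  shows "\<exists>m\<in>K. \<forall>k\<in>K. \<not> lt m k"
  using assms
proof (induction K rule: finite_ne_induct)
  case (insert x F)
  then obtain m where m: "m \<in> F" "\<forall>k\<in>F. \<not> lt m k" by blast
  show ?case
  proof (cases "lt m x")
    case True
    then have "\<forall>k\<in>insert x F. \<not> lt x k" using m lt_trans by auto
    then show ?thesis by blast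
  qed (use m in blast)
qed auto

lemma lookup_leading_part:
  "lookup (leading_part lt f) k = (if \<forall>b\<in>keys f. \<not> lt k b then lookup f k else 0)"
proof -
  have "lookup (leading_part lt f) k = (\<Sum>a \<in> {a \<in> keys f. \<forall>b \<in> keys f. \<not> lt a b}. if a = k then lookup f k else 0)"
    unfolding leading_part_def lookup_sum by (intro sum.cong) (auto simp: lookup_single when_def)
  also have "\<dots> = (if k \<in> {a \<in> keys f. \<forall>b \<in> keys f. \<not> lt a b} then lookup f k else 0)"
    by (subst sum.delta) auto
  finally show ?thesis by (auto simp: in_keys_iff)
qed

end

text \<open>Breaking ties gives each nonzero polynomial a single greatest monomial, which still
  belongs to its leading part for the preorder.\<close>

lemma mon_preorder_total_refinement:
  assumes "mon_preorder lt" "monomial_total_order lx"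
  shows "monomial_total_order (\<lambda>a b. lt a b \<or> \<not> lt b a \<and> lx a b)"
proof -
  interpret mon_preorder lt by fact
  interpret monomial_total_order lx by fact
  show ?thesis
  proof
    let ?l = "\<lambda>a b. lt a b \<or> \<not> lt b a \<and> lx a b"
    fix a b c
    show "\<not> ?l a a" using irrefl by simp
    show "?l a b \<or> ?l b a" if "a \<noteq> b" using total[OF that] by blast
    show "?l (a + c) (b + c)" if "?l a b" using that add_right by auto
    show "?l a c" if "?l a b" "?l b c"
    proof (cases "lt a c")
      case False
      \<comment> \<open>A strict step followed or preceded by a tie would already give
        \<open>lt a c\<close>. What remains are two ties, decided by \<open>lx\<close>.\<close>
      then have "\<not> lt a b \<and> \<not> lt b c \<or> lt a b \<and> \<not> lt b c \<or> \<not> lt a b \<and> lt b c"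
        using lt_trans by blast
      then show ?thesis using that False not_lt_trans[of a c b] not_lt_trans[of b a c] not_lt_trans[of c b a] trans
        by (metis lt_asym)
    qed simp
  qed
qed

lemma lookup_single_times:
  fixes p :: "'a::cancel_comm_monoid_add \<Rightarrow>\<^sub>0 'b::comm_semiring_1"
  shows "lookup (single a c * p) (a + m) = c * lookup p m"
    and "(\<And>m. k \<noteq> a + m) \<Longrightarrow> lookup (single a c * p) k = 0"
proof -
  have eq: "lookup (single a c * p) k = c * (\<Sum>q. lookup p q when k = a + q)" for k
    by (simp add: lookup_mult lookup_single when_mult)
  show "lookup (single a c * p) (a + m) = c * lookup p m"
    by (simp add: eq)
  show "(\<And>m. k \<noteq> a + m) \<Longrightarrow> lookup (single a c * p) k = 0"
    by (simp add: eq)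
qed

lemma lookup_const_times [simp]:
  fixes p :: "'a::cancel_comm_monoid_add \<Rightarrow>\<^sub>0 'b::comm_semiring_1"
  shows "lookup (single 0 c * p) m = c * lookup p m"
  using lookup_single_times(1)[of 0 c p m] by simp

lemma keys_single_times:
  fixes p :: "'a::cancel_comm_monoid_add \<Rightarrow>\<^sub>0 'b::comm_semiring_1"
  shows "keys (single a 1 * p) = (+) a ` keys p"
proof (rule Set.set_eqI)
  fix k
  show "k \<in> keys (single a 1 * p) \<longleftrightarrow> k \<in> (+) a ` keys p"
  proof (cases "\<exists>m. k = a + m")
    case True
    then show ?thesis using lookup_single_times(1)[of a 1 p] by (auto simp: in_keys_iff)
  next
    case False
    then show ?thesis using lookup_single_times(2)[of k a 1 p] by (auto simp: in_keys_iff)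
  qed
qed

lemma (in mon_preorder) leading_part_single_times:
  fixes p :: "('n, 'k::field) mpoly"
  shows "leading_part lt (single a 1 * p) = single a 1 * leading_part lt p"
proof (rule poly_mapping_eqI)
  fix k
  show "lookup (leading_part lt (single a 1 * p)) k = lookup (single a 1 * leading_part lt p) k"
  proof (cases "\<exists>m. k = a + m")
    case True
    then obtain m where "k = a + m" by blast
    then show ?thesis by (simp add: lookup_leading_part keys_single_times lookup_single_times(1))
  next
    case False
    then have "lookup (single a 1 * q) k = 0" for q :: "('n, 'k) mpoly"
      by (intro lookup_single_times(2)) blast
    then show ?thesis by (simp add: lookup_leading_part)
  qed
qed

section \<open>Ideals of rings given by a type class\<close>

lemma type_ring_simps [simp]:
  "carrier (ring_of_type_algebra :: 'a::comm_ring_1 ring) = UNIV"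
  "monoid.mult (ring_of_type_algebra :: 'a ring) = (*)"
  "monoid.one (ring_of_type_algebra :: 'a ring) = 1"
  "ring.zero (ring_of_type_algebra :: 'a ring) = 0"
  "ring.add (ring_of_type_algebra :: 'a ring) = (+)"
  by (auto simp: ring_of_type_algebra_def fun_eq_iff)

lemma type_ring_cring: "cring (ring_of_type_algebra :: 'a::comm_ring_1 ring)"
  by (rule cring_from_type_algebra)

lemma type_ring_uminus [simp]: "a_inv ring_of_type_algebra (a :: 'a::comm_ring_1) = - a"
proof -
  interpret cring "ring_of_type_algebra :: 'a ring" by (rule type_ring_cring)
  show ?thesis using minus_equality[of "- a" a] by simp
qed

lemma ideal_type_ring_iff:
  fixes J :: "'a::comm_ring_1 set"
  shows "ideal J ring_of_type_algebra \<longleftrightarrow> 0 \<in> J \<and> (\<forall>a\<in>J. \<forall>b\<in>J. a + b \<in> J) \<and> (\<forall>a\<in>J. \<forall>r. r * a \<in> J)"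
proof
  assume "ideal J ring_of_type_algebra"
  then interpret ideal J ring_of_type_algebra .
  have is_additive_subgroup: "additive_subgroup J ring_of_type_algebra" ..
  note closed = additive_subgroup.a_closed[OF is_additive_subgroup, unfolded type_ring_simps]
      additive_subgroup.zero_closed[OF is_additive_subgroup, unfolded type_ring_simps]
      I_l_closed[unfolded type_ring_simps, OF _ UNIV_I]
  show "0 \<in> J \<and> (\<forall>a\<in>J. \<forall>b\<in>J. a + b \<in> J) \<and> (\<forall>a\<in>J. \<forall>r. r * a \<in> J)"
    by (intro conjI ballI allI closed)
next
  assume J: "0 \<in> J \<and> (\<forall>a\<in>J. \<forall>b\<in>J. a + b \<in> J) \<and> (\<forall>a\<in>J. \<forall>r. r * a \<in> J)"
  interpret cring "ring_of_type_algebra :: 'a ring" by (rule type_ring_cring)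
  have "- a \<in> J" if "a \<in> J" for a
    using J that by (metis mult_minus1)
  then have "subgroup J (add_monoid ring_of_type_algebra)"
    using J by (intro add.subgroupI) (auto simp flip: a_inv_def)
  then show "ideal J ring_of_type_algebra"
    using J by (intro idealI) (auto simp: ring_axioms mult.commute)
qed

lemma ideal_type_ring_closed:
  fixes J :: "'a::comm_ring_1 set"
  assumes "ideal J ring_of_type_algebra"
  shows "0 \<in> J" "a \<in> J \<Longrightarrow> b \<in> J \<Longrightarrow> a + b \<in> J" "a \<in> J \<Longrightarrow> r * a \<in> J" "a \<in> J \<Longrightarrow> - a \<in> J"
    "a \<in> J \<Longrightarrow> b \<in> J \<Longrightarrow> a - b \<in> J" "(\<And>x. x \<in> Y \<Longrightarrow> h x \<in> J) \<Longrightarrow> sum h Y \<in> J"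
proof -
  have J: "0 \<in> J \<and> (\<forall>a\<in>J. \<forall>b\<in>J. a + b \<in> J) \<and> (\<forall>a\<in>J. \<forall>r. r * a \<in> J)"
    using assms by (simp add: ideal_type_ring_iff)
  then show *: "0 \<in> J" "\<And>a b. a \<in> J \<Longrightarrow> b \<in> J \<Longrightarrow> a + b \<in> J" "a \<in> J \<Longrightarrow> r * a \<in> J" by auto
  show **: "- a \<in> J" if "a \<in> J" for a
    using J that by (metis mult_minus1)
  show "a \<in> J \<Longrightarrow> b \<in> J \<Longrightarrow> a - b \<in> J"
    using *(2)[of a "- b"] ** by simp
  show "(\<And>x. x \<in> Y \<Longrightarrow> h x \<in> J) \<Longrightarrow> sum h Y \<in> J"
    by (induction Y rule: infinite_finite_induct) (auto intro: *)
qed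

section \<open>Standard bases with respect to the total degree\<close>

definition is_lm :: "('n monomial \<Rightarrow> 'n monomial \<Rightarrow> bool) \<Rightarrow> ('n, 'k::field) mpoly \<Rightarrow> 'n monomial \<Rightarrow> bool" where
  "is_lm lx f m \<longleftrightarrow> m \<in> keys f \<and> (\<forall>k\<in>keys f. k = m \<or> lx k m)"

definition total_deg :: "'n::finite monomial \<Rightarrow> nat" where
  "total_deg m = (\<Sum>i\<in>UNIV. lookup m i)"

lemma total_deg_add: "total_deg (a + b) = total_deg a + total_deg b"
  by (simp add: total_deg_def lookup_add sum.distrib)

lemma lookup_le_total_deg: "lookup m i \<le> total_deg m"
  unfolding total_deg_def by (rule member_le_sum) auto

lemma finite_total_deg: "finite {m :: 'n::finite monomial. total_deg m \<le> d}"
proof (rule finite_imageD)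
  have "lookup ` {m :: 'n monomial. total_deg m \<le> d} \<subseteq> (UNIV \<rightarrow>\<^sub>E {..d})"
    using order_trans[OF lookup_le_total_deg] by auto
  then show "finite (lookup ` {m :: 'n monomial. total_deg m \<le> d})"
    by (rule finite_subset) (intro finite_PiE; simp)
  show "inj_on lookup {m :: 'n monomial. total_deg m \<le> d}"
    by (rule inj_onI) (rule lookup_inject[THEN iffD1])
qed

lemma monomial_diff:
  fixes a b :: "'n monomial"
  assumes "lookup a \<le> lookup b"
  shows "b = (b - a) + a"
  using assms by (intro poly_mapping_eqI) (simp add: lookup_add lookup_minus le_fun_def)

lemma monomial_split:
  fixes a :: "'n::finite monomial"
  assumes "a \<noteq> 0"
  obtains b i where "a = b + var_monomial i"
proof -
  obtain i where "lookup a i \<noteq> 0" using assms by (metis poly_mapping_eqI lookup_zero)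
  then have "a = (a - var_monomial i) + var_monomial i"
    by (intro monomial_diff) (auto simp: le_fun_def var_monomial_def lookup_single when_def)
  then show ?thesis by (rule that)
qed

lemma monomial_induct [case_names zero add]:
  fixes a :: "'n::finite monomial"
  assumes "P 0" "\<And>a i. P a \<Longrightarrow> P (a + var_monomial i)"
  shows "P a"
proof (induction "total_deg a" arbitrary: a rule: less_induct)
  case less
  show ?case
  proof (cases "a = 0")
    case False
    then obtain b i where a: "a = b + var_monomial i" by (rule monomial_split)
    have "total_deg (var_monomial i :: 'n monomial) > 0"
      using lookup_le_total_deg[of "var_monomial i" i] by (simp add: var_monomial_def)
    then show ?thesis using less assms(2) by (simp add: a total_deg_add)
  qed (simp add: assms(1))
qed

text \<open>Indexing the summands by their own leading monomials builds in that these are pairwise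
  distinct. The scalars are separated so that \<open>b m\<close> is a pure monomial multiple of an
  element of \<open>G\<close>, for which leading parts are known.\<close>

definition standard_rep ::
  "('n monomial \<Rightarrow> 'n monomial \<Rightarrow> bool) \<Rightarrow> ('n, 'k::field) mpoly set \<Rightarrow> ('n, 'k) mpoly \<Rightarrow>
    'n monomial set \<Rightarrow> ('n monomial \<Rightarrow> 'k) \<Rightarrow> ('n monomial \<Rightarrow> ('n, 'k) mpoly) \<Rightarrow> bool" where
  "standard_rep lx G f A c b \<longleftrightarrow> finite A \<and> f = (\<Sum>m\<in>A. single 0 (c m) * b m) \<and>
     (\<forall>m\<in>A. c m \<noteq> 0 \<and> is_lm lx (b m) m \<and> (\<exists>g\<in>G. \<exists>a. b m = single a 1 * g))"

context monomial_total_order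
begin

lemma ex_greatest:
  assumes "finite K" "K \<noteq> {}"
  shows "\<exists>m\<in>K. \<forall>k\<in>K. k = m \<or> lx k m"
  using assms
proof (induction K)
  case (insert x F)
  show ?case
  proof (cases "F = {}")
    case False
    then obtain m where m: "m \<in> F" "\<forall>k\<in>F. k = m \<or> lx k m" using insert by blast
    show ?thesis
    proof (cases "lx m x")
      case True
      then have "\<forall>k\<in>insert x F. k = x \<or> lx k x" using m(2) trans[OF _ True] True by auto
      then show ?thesis by blast
    next
      case False
      then have "\<forall>k\<in>insert x F. k = m \<or> lx k m" using m(2) total[of x m] False by auto
      then show ?thesis using m(1) by blast
    qed
  qed auto
qed auto

lemma ex_is_lm: "f \<noteq> 0 \<Longrightarrow> \<exists>m. is_lm lx f m"
  unfolding is_lm_def using ex_greatest[OF finite_keys] by (metis keys_eq_empty)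

lemma is_lm_unique: "is_lm lx f m \<Longrightarrow> is_lm lx f m' \<Longrightarrow> m = m'"
  unfolding is_lm_def using trans irrefl by metis

lemma add_left: "lx a b \<Longrightarrow> lx (c + a) (c + b)"
  using add_right[of a b c] by (simp add: add.commute)

lemma is_lm_single_times: "is_lm lx f m \<Longrightarrow> is_lm lx (single a 1 * f) (a + m)"
  using add_left by (auto simp: is_lm_def keys_single_times)

end

text \<open>The order \<open>lx\<close> need not be a well-order. Instead, a bound \<open>d\<close> for the total degree is carried
  along, and its excess over the degree of the leading monomial plays the role of the exponent of a
  homogenizing variable in Dickson's lemma. Division then stays within the finitely many monomials
  of degree at most \<open>d\<close>, so that no unit has to be inverted.\<close>

lemma (in monomial_total_order) ex_standard_basis:
  fixes J :: "('n, 'k::field) mpoly set"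
  assumes "ideal J ring_of_type_algebra"
  obtains G where "finite G" "G \<subseteq> J" "\<And>f. f \<in> J \<Longrightarrow> \<exists>A c b. standard_rep lx G f A c b"
proof -
  note J = ideal_type_ring_closed[OF assms]
  define LM :: "('n, 'k) mpoly \<Rightarrow> 'n monomial" where "LM f = (THE m. is_lm lx f m)" for f
  have LM: "is_lm lx f (LM f)" if "f \<noteq> 0" for f :: "('n, 'k) mpoly"
    using ex_is_lm[OF that] is_lm_unique[of f] unfolding LM_def by (intro theI'[of "is_lm lx f"]) blast
  define bounded :: "('n, 'k) mpoly \<Rightarrow> nat \<Rightarrow> bool" where "bounded f d \<longleftrightarrow> (\<forall>k\<in>keys f. total_deg k \<le> d)" for f d
  define Y where "Y = {(f, d). f \<in> J \<and> f \<noteq> 0 \<and> bounded f d}"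
  define \<delta> :: "('n, 'k) mpoly \<times> nat \<Rightarrow> 'n option \<Rightarrow> nat"
    where "\<delta> = (\<lambda>(f, d) i. case i of None \<Rightarrow> d - total_deg (LM f) | Some i \<Rightarrow> lookup (LM f) i)"
  obtain Y0 where Y0: "Y0 \<subseteq> Y" "finite Y0" "\<And>x. x \<in> Y \<Longrightarrow> \<exists>x0\<in>Y0. \<delta> x0 \<le> \<delta> x"
    using dickson[of Y \<delta>] by blast
  define G where "G = fst ` Y0"
  have rep: "\<exists>A c b. standard_rep lx G f A c b \<and> (\<forall>m\<in>A. \<exists>k\<in>keys f. m = k \<or> lx m k)"
    if "f \<in> J" "bounded f d" for f d
    using that
  \<comment> \<open>For fixed \<open>d\<close> the set of monomials of degree at most
    \<open>d\<close> that lie weakly below a monomial of \<open>f\<close> is finite. Subtracting a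
    multiple of \<open>b\<close> removes the leading monomial from it, so it shrinks.\<close>
  proof (induction "card {m. total_deg m \<le> d \<and> (\<exists>k\<in>keys f. m = k \<or> lx m k)}" arbitrary: f rule: less_induct)
    case less
    show ?case
    proof (cases "f = 0")
      case True
      then show ?thesis by (intro exI[of _ "{}"]) (simp add: standard_rep_def)
    next
      case False
      define m where "m = LM f"
      have m: "is_lm lx f m" unfolding m_def by (rule LM[OF False])
      have "(f, d) \<in> Y" using less False by (simp add: Y_def)
      then obtain g d' where g: "(g, d') \<in> Y0" "\<delta> (g, d') \<le> \<delta> (f, d)" using Y0(3) by fast
      then have gX: "g \<in> J" "g \<noteq> 0" "bounded g d'" using Y0(1) by (auto simp: Y_def)
      have lmg: "is_lm lx g (LM g)" by (rule LM[OF gX(2)])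
      have "lookup (LM g) i \<le> lookup m i" for i
        using g(2)[unfolded le_fun_def, rule_format, of "Some i"] by (simp add: \<delta>_def m_def)
      then have le: "m = (m - LM g) + LM g" by (intro monomial_diff) (simp add: le_fun_def)
      have d_le: "d' - total_deg (LM g) \<le> d - total_deg m"
        using g(2)[unfolded le_fun_def, rule_format, of None] by (simp add: \<delta>_def m_def)
      define b where "b = single (m - LM g) 1 * g"
      have bm: "is_lm lx b m" using is_lm_single_times[OF lmg, of "m - LM g"] le by (simp add: b_def)
      have bJ: "b \<in> J" unfolding b_def using gX(1) by (rule J)
      have degm: "total_deg m \<le> d" using m less.prems(2) by (auto simp: is_lm_def bounded_def)
      have degg: "total_deg (LM g) \<le> d'" using lmg gX(3) by (auto simp: is_lm_def bounded_def)
      \<comment> \<open>The shift raises degrees by \<open>total_deg m - total_deg (LM g)\<close>.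
        By the coordinate \<open>None\<close> of \<delta>, the excess of \<open>d'\<close> over the
        leading degree of \<open>g\<close> is at most that of \<open>d\<close> over
        \<open>total_deg m\<close>, so \<open>b\<close> respects the bound \<open>d\<close>.\<close>
      have "total_deg (m - LM g) + total_deg (LM g) = total_deg m"
        using le by (metis total_deg_add)
      then have bb: "bounded b d"
        using gX(3) d_le degm degg unfolding bounded_def b_def keys_single_times
        by (fastforce simp: total_deg_add)
      define c where "c = lookup f m / lookup b m"
      have bm0: "lookup b m \<noteq> 0" using bm by (simp add: is_lm_def in_keys_iff)
      have c0: "c \<noteq> 0" using bm0 m by (simp add: c_def is_lm_def in_keys_iff)
      define f' where "f' = f - single 0 c * b"
      have lookup_f': "lookup f' k = lookup f k - c * lookup b k" for k
        by (simp add: f'_def lookup_minus)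
      have keys_f': "lx k m" if "k \<in> keys f'" for k
      proof -
        have "k \<noteq> m" using that bm0 by (auto simp: in_keys_iff lookup_f' c_def)
        moreover have "k \<in> keys f \<or> k \<in> keys b" using that by (auto simp: in_keys_iff lookup_f')
        ultimately show ?thesis using m bm by (auto simp: is_lm_def)
      qed
      have f'J: "f' \<in> J" unfolding f'_def using less.prems(1) bJ by (intro J)
      have f'b: "bounded f' d"
        unfolding bounded_def
      proof
        fix k assume "k \<in> keys f'"
        then have "k \<in> keys f \<or> k \<in> keys b" by (auto simp: in_keys_iff lookup_f')
        then show "total_deg k \<le> d" using less.prems(2) bb by (auto simp: bounded_def)
      qed
      have "card {m. total_deg m \<le> d \<and> (\<exists>k\<in>keys f'. m = k \<or> lx m k)} < card {m. total_deg m \<le> d \<and> (\<exists>k\<in>keys f. m = k \<or> lx m k)}"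
      proof (rule psubset_card_mono)
        show "finite {m. total_deg m \<le> d \<and> (\<exists>k\<in>keys f. m = k \<or> lx m k)}"
          using finite_total_deg by (rule finite_subset[rotated]) auto
        have "m \<notin> {m. total_deg m \<le> d \<and> (\<exists>k\<in>keys f'. m = k \<or> lx m k)}"
          using keys_f' irrefl trans by blast
        moreover have "m \<in> {m. total_deg m \<le> d \<and> (\<exists>k\<in>keys f. m = k \<or> lx m k)}"
          using degm m by (auto simp: is_lm_def)
        moreover have "{m. total_deg m \<le> d \<and> (\<exists>k\<in>keys f'. m = k \<or> lx m k)} \<subseteq> {m. total_deg m \<le> d \<and> (\<exists>k\<in>keys f. m = k \<or> lx m k)}"
          using keys_f' trans m unfolding is_lm_def by blast
        ultimately show "{m. total_deg m \<le> d \<and> (\<exists>k\<in>keys f'. m = k \<or> lx m k)} \<subset> {m. total_deg m \<le> d \<and> (\<exists>k\<in>keys f. m = k \<or> lx m k)}"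
          by blast
      qed
      from less.hyps[OF this f'J f'b] obtain A c' b' where
        rep': "standard_rep lx G f' A c' b'" and A: "\<forall>k\<in>A. \<exists>l\<in>keys f'. k = l \<or> lx k l" by blast
      have lxA: "lx k m" if "k \<in> A" for k using A keys_f' trans that by blast
      then have mA: "m \<notin> A" using irrefl by blast
      have "f = single 0 c * b + f'" by (simp add: f'_def)
      also have "f' = (\<Sum>k\<in>A. single 0 (c' k) * b' k)" using rep' by (simp add: standard_rep_def)
      also have "\<dots> = (\<Sum>k\<in>A. single 0 ((c'(m := c)) k) * (b'(m := b)) k)"
        using mA by (intro sum.cong) auto
      finally have "f = (\<Sum>k\<in>insert m A. single 0 ((c'(m := c)) k) * (b'(m := b)) k)"
        using rep' mA by (simp add: standard_rep_def)
      moreover have "\<exists>g\<in>G. \<exists>a. b = single a 1 * g"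
        using g(1) unfolding b_def G_def by force
      ultimately have "standard_rep lx G f (insert m A) (c'(m := c)) (b'(m := b))"
        using rep' c0 bm mA unfolding standard_rep_def by auto
      moreover have "\<forall>k\<in>insert m A. \<exists>l\<in>keys f. k = l \<or> lx k l"
        using lxA m unfolding is_lm_def by blast
      ultimately show ?thesis by blast
    qed
  qed
  show ?thesis
  proof (rule that[of G])
    show "finite G" "G \<subseteq> J" using Y0 by (auto simp: G_def Y_def)
    fix f assume f: "f \<in> J"
    have "bounded f (Max (insert 0 (total_deg ` keys f)))"
      unfolding bounded_def by (intro ballI Max_ge) auto
    then show "\<exists>A c b. standard_rep lx G f A c b" using rep[OF f] by blast
  qed
qed

text \<open>The leading monomials of the \<open>b m\<close> are the pairwise distinct \<open>m\<close>, so that the top parts of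
  the summands cannot cancel, with respect to any preorder which agrees with \<open>lt0\<close> on \<open>G\<close>.\<close>

lemma leading_part_standard_rep:
  fixes f :: "('n::finite, 'k::field) mpoly"
  assumes "mon_preorder lt0" "mon_preorder lt" "monomial_total_order lx"
    and refines: "\<And>a b. lt0 a b \<Longrightarrow> lx a b"
    and agree: "\<And>g. g \<in> G \<Longrightarrow> leading_part lt g = leading_part lt0 g"
    and rep: "standard_rep lx G f A c b"
  shows "leading_part lt f =
    (\<Sum>m\<in>{m\<in>A. \<forall>m'\<in>A. \<not> lt m m'}. single 0 (c m) * leading_part lt0 (b m))"
    and "m \<in> A \<Longrightarrow> leading_part lt (b m) = leading_part lt0 (b m)"
proof -
  interpret l0: mon_preorder lt0 by fact
  interpret l: mon_preorder lt by fact
  interpret lx: monomial_total_order lx by fact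
  have A: "finite A" "f = (\<Sum>m\<in>A. single 0 (c m) * b m)"
    and c: "\<And>m. m \<in> A \<Longrightarrow> c m \<noteq> 0" and lm: "\<And>m. m \<in> A \<Longrightarrow> is_lm lx (b m) m"
    and bG: "\<And>m. m \<in> A \<Longrightarrow> \<exists>g\<in>G. \<exists>a. b m = single a 1 * g"
    using rep by (auto simp: standard_rep_def)
  show lp_b: "leading_part lt (b m) = leading_part lt0 (b m)" if m: "m \<in> A" for m
    using bG[OF m] agree l.leading_part_single_times l0.leading_part_single_times by metis
  have m_max0: "\<forall>k\<in>keys (b m). \<not> lt0 m k" if m: "m \<in> A" for m
    using lm[OF m] refines lx.irrefl lx.trans unfolding is_lm_def by metis
  have bm: "lookup (b m) m \<noteq> 0" if m: "m \<in> A" for m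
    using lm[OF m] by (simp add: is_lm_def in_keys_iff)
  have lp_m: "lookup (leading_part lt0 (b m)) m = lookup (b m) m" if m: "m \<in> A" for m
    using m_max0[OF m] by (simp add: l0.lookup_leading_part)
  \<comment> \<open>The order \<open>lx\<close> refines \<open>lt0\<close> and says nothing about
    \<open>lt\<close> directly. But \<open>m\<close> occurs in the leading part of
    \<open>b m\<close> for \<open>lt0\<close>, which is also the one for \<open>lt\<close>.\<close>
  have m_max: "\<not> lt m k" if m: "m \<in> A" and k: "k \<in> keys (b m)" for m k
  proof
    assume "lt m k"
    then have "lookup (leading_part lt (b m)) m = 0" using k by (auto simp: l.lookup_leading_part)
    then show False using lp_b[OF m] lp_m[OF m] bm[OF m] by simp
  qed
  define A' where "A' = {m\<in>A. \<forall>m'\<in>A. \<not> lt m m'}"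
  define T where "T = (\<Sum>m\<in>A'. single 0 (c m) * leading_part lt0 (b m))"
  have finA': "finite A'" using A(1) by (simp add: A'_def)
  have lookup_f: "lookup f k = (\<Sum>m\<in>A. c m * lookup (b m) k)" for k
    by (subst A(2)) (simp add: lookup_sum)
  have lookup_T: "lookup T k = (\<Sum>m\<in>A'. c m * lookup (leading_part lt0 (b m)) k)" for k
    by (simp add: T_def lookup_sum)
  have keys_f: "\<exists>m\<in>A. k \<in> keys (b m)" if "k \<in> keys f" for k
  proof (rule ccontr)
    assume "\<not> (\<exists>m\<in>A. k \<in> keys (b m))"
    then have "lookup f k = 0" unfolding lookup_f by (intro sum.neutral) (auto simp: in_keys_iff)
    then show False using that by (simp add: in_keys_iff)
  qed
  have "leading_part lt f = T"
  proof (cases "A = {}")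
    case True
    then show ?thesis using A(2) by (simp add: T_def A'_def leading_part_def)
  next
    case False
    then have "A' \<noteq> {}" using l.ex_maximal[OF A(1)] by (auto simp: A'_def)
    have tie: "\<not> lt m m' \<and> \<not> lt m' m" if "m \<in> A'" "m' \<in> A'" for m m'
      using that by (auto simp: A'_def)
    have below: "\<not> lt m m'" if "m \<in> A'" "m' \<in> A" for m m'
      using that by (auto simp: A'_def)
    have above: "lt m m'" if m: "m \<in> A" "m \<notin> A'" and m': "m' \<in> A'" for m m'
    proof -
      obtain m'' where m'': "m'' \<in> A" "lt m m''" using m by (auto simp: A'_def)
      have "\<not> lt m' m''" by (rule below[OF m' m''(1)])
      then show ?thesis using m''(2) l.not_lt_trans[of m m' m''] by blast
    qed
    have keys_le: "\<not> lt m k" if k: "k \<in> keys f" and m: "m \<in> A'" for k m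
    proof -
      obtain m1 where m1: "m1 \<in> A" "k \<in> keys (b m1)" using keys_f[OF k] by blast
      show ?thesis using l.not_lt_trans[OF below[OF m m1(1)] m_max[OF m1]] .
    qed
    \<comment> \<open>At a monomial tied with the top class \<open>A'\<close>, summands outside
      \<open>A'\<close> contribute nothing, and those in \<open>A'\<close> contribute only through
      their leading parts.\<close>
    have top: "lookup T k = lookup f k" if "m \<in> A'" "\<not> lt k m" "\<not> lt m k" for k m
    proof -
      have "c m' * lookup (b m') k = 0" if m': "m' \<in> A - A'" for m'
      proof -
        have "lt m' m" using above[of m' m] m' \<open>m \<in> A'\<close> by blast
        then have "lt m' k" using l.not_lt_trans[of m' k m] \<open>\<not> lt k m\<close> by blast
        then have "k \<notin> keys (b m')" using m_max[of m' k] m' by blast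
        then show ?thesis by (simp add: in_keys_iff)
      qed
      then have "lookup f k = (\<Sum>m\<in>A'. c m * lookup (b m) k)"
        unfolding lookup_f using A(1) by (intro sum.mono_neutral_right) (auto simp: A'_def)
      also have "\<dots> = (\<Sum>m\<in>A'. c m * lookup (leading_part lt0 (b m)) k)"
      proof (rule sum.cong[OF refl])
        fix m' assume m': "m' \<in> A'"
        then have m'A: "m' \<in> A" by (simp add: A'_def)
        have km': "\<not> lt k m'"
          using l.not_lt_trans[of k m m'] tie[OF that(1) m'] that by blast
        have "\<forall>b\<in>keys (b m'). \<not> lt k b"
          using l.not_lt_trans[OF km'] m_max[OF m'A] by blast
        then have "lookup (leading_part lt (b m')) k = lookup (b m') k"
          by (simp add: l.lookup_leading_part)
        then show "c m' * lookup (b m') k = c m' * lookup (leading_part lt0 (b m')) k"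
          using lp_b[OF m'A] by simp
      qed
      finally show ?thesis by (simp add: lookup_T)
    qed
    have T_keys: "\<not> lt k m \<and> \<not> lt m k" if k: "lookup T k \<noteq> 0" and m: "m \<in> A'" for k m
    proof -
      obtain m1 where m1: "m1 \<in> A'" "lookup (leading_part lt0 (b m1)) k \<noteq> 0"
        using k unfolding lookup_T by (metis (no_types, lifting) mult_zero_right sum.neutral)
      then have m1A: "m1 \<in> A" by (simp add: A'_def)
      have "lookup (leading_part lt (b m1)) k \<noteq> 0" using m1(2) lp_b[OF m1A] by simp
      then have kk: "k \<in> keys (b m1)" "\<forall>l\<in>keys (b m1). \<not> lt k l"
        by (auto simp: l.lookup_leading_part in_keys_iff split: if_splits)
      have "\<not> lt k m1" using kk(2) lm[OF m1A] by (auto simp: is_lm_def)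
      moreover have "\<not> lt m1 k" by (rule m_max[OF m1A kk(1)])
      ultimately show ?thesis
        using tie[OF m1(1) m] l.not_lt_trans[of k m1 m] l.not_lt_trans[of m m1 k] by blast
    qed
    \<comment> \<open>It must be excluded that the top class cancels altogether. The
      \<open>lx\<close>-greatest index \<open>m1\<close> of \<open>A'\<close> occurs in no other
      \<open>b m\<close> with \<open>m\<close> in \<open>A'\<close>, so its coefficient in
      \<open>T\<close> survives.\<close>
    obtain m1 where m1: "m1 \<in> A'" "\<forall>m\<in>A'. m = m1 \<or> lx m m1"
      using lx.ex_greatest[OF finA' \<open>A' \<noteq> {}\<close>] by blast
    have m1A: "m1 \<in> A" using m1(1) by (simp add: A'_def)
    have "lookup (leading_part lt0 (b m)) m1 = 0" if "m \<in> A' - {m1}" for m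
    proof -
      have m: "lx m m1" "m \<in> A" using that m1(2) by (auto simp: A'_def)
      have "m1 \<notin> keys (b m)"
        using lm[OF m(2)] m(1) lx.irrefl lx.trans unfolding is_lm_def by metis
      then show ?thesis by (simp add: l0.lookup_leading_part in_keys_iff)
    qed
    then have "lookup T m1 = c m1 * lookup (leading_part lt0 (b m1)) m1"
      unfolding lookup_T using finA' m1(1) by (subst sum.remove[of _ m1]) (auto intro!: sum.neutral)
    then have Tm1: "lookup T m1 \<noteq> 0" using c[OF m1A] lp_m[OF m1A] bm[OF m1A] by simp
    have fm1: "m1 \<in> keys f" using Tm1 top[OF m1(1), of m1] by (simp add: in_keys_iff)
    show ?thesis
    proof (rule poly_mapping_eqI)
      fix k
      show "lookup (leading_part lt f) k = lookup T k"
      proof (cases "lt k m1 \<or> lt m1 k")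
        case True
        then have "lookup T k = 0" using T_keys[of k m1] m1(1) by blast
        moreover have "lookup (leading_part lt f) k = 0"
          using True fm1 keys_le[of k m1] m1(1) by (auto simp: l.lookup_leading_part in_keys_iff)
        ultimately show ?thesis by simp
      next
        case False
        then have "\<forall>b\<in>keys f. \<not> lt k b"
          using keys_le[OF _ m1(1)] l.not_lt_trans[of k m1] by blast
        then show ?thesis using top[OF m1(1), of k] False by (simp add: l.lookup_leading_part)
      qed
    qed
  qed
  then show "leading_part lt f =
    (\<Sum>m\<in>{m\<in>A. \<forall>m'\<in>A. \<not> lt m m'}. single 0 (c m) * leading_part lt0 (b m))"
    by (simp add: T_def A'_def)
qed

section \<open>Integral weights\<close>

lemma ex_strictly_between_finite:
  fixes L U :: "'a::{dense_linorder, no_top, no_bot} set"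
  assumes "finite L" "finite U" "\<And>l u. l \<in> L \<Longrightarrow> u \<in> U \<Longrightarrow> l < u"
  shows "\<exists>x. (\<forall>l\<in>L. l < x) \<and> (\<forall>u\<in>U. x < u)"
proof (cases "L = {} \<or> U = {}")
  case True
  then show ?thesis
  proof
    assume "U = {}"
    \<comment> \<open>The element \<open>undefined\<close> merely keeps the set nonempty when
      \<open>L\<close> is empty too.\<close>
    obtain x where "Max (insert undefined L) < x" using gt_ex by blast
    then show ?thesis using \<open>U = {}\<close> assms(1) by (intro exI[of _ x]) simp
  next
    assume "L = {}"
    obtain x where "x < Min (insert undefined U)" using lt_ex by blast
    then show ?thesis using \<open>L = {}\<close> assms(2) by (intro exI[of _ x]) simp
  qed
next
  case False
  then have "Max L < Min U" using assms by simp
  then obtain x where "Max L < x" "x < Min U" using dense by blast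
  then show ?thesis using assms(1,2) False by (intro exI[of _ x]) auto
qed

text \<open>Fourier--Motzkin elimination: the inequalities which it derives are again between values of
  \<open>pos\<close> vectors, hence never contradictory.\<close>

lemma ex_rational_weight:
  fixes pos null :: "('n \<Rightarrow> int) \<Rightarrow> bool"
  assumes pos_add: "\<And>x y. pos x \<Longrightarrow> pos y \<Longrightarrow> pos (\<lambda>i. x i + y i)"
    and pos_scale: "\<And>x k. pos x \<Longrightarrow> k > 0 \<Longrightarrow> pos (\<lambda>i. k * x i)"
    and null_add: "\<And>x y. null x \<Longrightarrow> null y \<Longrightarrow> null (\<lambda>i. x i + y i)"
    and null_scale: "\<And>x k. null x \<Longrightarrow> null (\<lambda>i. k * x i)"
    and pos_null: "\<And>x y. pos x \<Longrightarrow> null y \<Longrightarrow> pos (\<lambda>i. x i + y i)"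
    and not_pos_0: "\<not> pos (\<lambda>_. 0)"
    and "finite V" "finite D" "finite E"
    and D: "\<And>d. d \<in> D \<Longrightarrow> pos d \<and> (\<forall>i. i \<notin> V \<longrightarrow> d i = 0)"
    and E: "\<And>e. e \<in> E \<Longrightarrow> null e \<and> (\<forall>i. i \<notin> V \<longrightarrow> e i = 0)"
  shows "\<exists>w :: 'n \<Rightarrow> rat. (\<forall>d\<in>D. (\<Sum>i\<in>V. w i * of_int (d i)) > 0) \<and> (\<forall>e\<in>E. (\<Sum>i\<in>V. w i * of_int (e i)) = 0)"
  using assms(7-11)
proof (induction V arbitrary: D E)
  case empty
  have "d \<notin> D" for d
  proof
    assume "d \<in> D"
    then have "pos d" "d = (\<lambda>_. 0)" using empty.prems(3) by auto
    then show False using not_pos_0 by simp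
  qed
  then show ?case by auto
next
  case (insert v V)
  show ?case
  proof (cases "\<exists>e0\<in>E. e0 v \<noteq> 0")
    case True
    then obtain e0 where e0: "e0 \<in> E" "e0 v \<noteq> 0" by blast
    \<comment> \<open>Adding a multiple of the null vector \<open>e0\<close> eliminates the
      coordinate \<open>v\<close>. The factor of \<open>x\<close> is \<open>\<bar>e0 v\<bar>\<close>
      and not \<open>e0 v\<close>, so that \<open>pos\<close> is preserved.\<close>
    define r where "r x = (\<lambda>i. \<bar>e0 v\<bar> * x i + (- sgn (e0 v) * x v) * e0 i)" for x :: "'n \<Rightarrow> int"
    have r_v: "r x v = 0" for x
      by (simp add: r_def abs_sgn)
    have r_supp: "r x i = 0" if "i \<notin> V" "\<forall>i. i \<notin> insert v V \<longrightarrow> x i = 0" for x i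
      using that r_v[of x] insert.prems(4)[OF e0(1)] by (cases "i = v") (auto simp: r_def)
    obtain w :: "'n \<Rightarrow> rat" where w: "\<forall>d\<in>r ` D. (\<Sum>i\<in>V. w i * of_int (d i)) > 0"
      "\<forall>e\<in>r ` E. (\<Sum>i\<in>V. w i * of_int (e i)) = 0"
    proof -
      have "\<exists>w :: 'n \<Rightarrow> rat. (\<forall>d\<in>r ` D. (\<Sum>i\<in>V. w i * of_int (d i)) > 0) \<and> (\<forall>e\<in>r ` E. (\<Sum>i\<in>V. w i * of_int (e i)) = 0)"
      proof (rule insert.IH)
        fix d assume "d \<in> r ` D"
        then obtain x where x: "x \<in> D" "d = r x" by blast
        have "pos (r x)" unfolding r_def
          using insert.prems(3)[OF x(1)] insert.prems(4)[OF e0(1)] e0(2)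
          by (intro pos_null pos_scale null_scale) auto
        then show "pos d \<and> (\<forall>i. i \<notin> V \<longrightarrow> d i = 0)" using x r_supp insert.prems(3)[OF x(1)] by simp
      next
        fix d assume "d \<in> r ` E"
        then obtain x where x: "x \<in> E" "d = r x" by blast
        have "null (r x)" unfolding r_def
          using insert.prems(4)[OF x(1)] insert.prems(4)[OF e0(1)] by (intro null_add null_scale) auto
        then show "null d \<and> (\<forall>i. i \<notin> V \<longrightarrow> d i = 0)" using x r_supp insert.prems(4)[OF x(1)] by simp
      qed (use insert.prems in auto)
      then show ?thesis using that by blast
    qed
    \<comment> \<open>The value at \<open>v\<close> is forced by the condition that
      \<open>e0\<close> has weight 0.\<close>
    define w' where "w' = w(v := - (\<Sum>i\<in>V. w i * of_int (e0 i)) / of_int (e0 v))"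
    have w'_sum: "(\<Sum>i\<in>insert v V. w' i * of_int (x i)) =
        (\<Sum>i\<in>V. w i * of_int (x i)) - (\<Sum>i\<in>V. w i * of_int (e0 i)) / of_int (e0 v) * of_int (x v)" for x
    proof -
      have "(\<Sum>i\<in>V. w' i * of_int (x i)) = (\<Sum>i\<in>V. w i * of_int (x i))"
        using insert.hyps(2) by (intro sum.cong) (auto simp: w'_def)
      then show ?thesis using insert.hyps by (simp add: w'_def)
    qed
    have key: "of_int \<bar>e0 v\<bar> * (\<Sum>i\<in>insert v V. w' i * of_int (x i)) = (\<Sum>i\<in>V. w i * of_int (r x i))" for x
    proof -
      have "(\<Sum>i\<in>V. w i * of_int (r x i)) =
          of_int \<bar>e0 v\<bar> * (\<Sum>i\<in>V. w i * of_int (x i)) - of_int (sgn (e0 v) * x v) * (\<Sum>i\<in>V. w i * of_int (e0 i))"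
        by (simp add: r_def algebra_simps sum.distrib sum_subtractf sum_distrib_left sum_negf)
      also have "of_int (sgn (e0 v) * x v) = of_int \<bar>e0 v\<bar> / of_int (e0 v) * (of_int (x v) :: rat)"
        using e0(2) by (cases "e0 v > 0") auto
      finally show ?thesis unfolding w'_sum by (simp add: algebra_simps)
    qed
    have pos_e0: "(of_int \<bar>e0 v\<bar> :: rat) > 0" using e0(2) by simp
    show ?thesis
    proof (intro exI[of _ w'] conjI ballI)
      fix d assume "d \<in> D"
      then show "(\<Sum>i\<in>insert v V. w' i * of_int (d i)) > 0"
        using w(1)[rule_format, OF imageI] unfolding key[symmetric] using pos_e0 zero_less_mult_pos by blast
    next
      fix e assume "e \<in> E"
      then have "of_int \<bar>e0 v\<bar> * (\<Sum>i\<in>insert v V. w' i * of_int (e i)) = 0"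
        using w(2) key[of e] by simp
      then show "(\<Sum>i\<in>insert v V. w' i * of_int (e i)) = 0" using pos_e0 by simp
    qed
  next
    case False
    define P N where "P = {d\<in>D. d v > 0}" and "N = {d\<in>D. d v < 0}"
    \<comment> \<open>No vector of \<open>E\<close> involves \<open>v\<close> now. A vector with
      positive entry at \<open>v\<close> bounds the weight of \<open>v\<close> from below, one with
      negative entry from above; \<open>comb\<close> cancels the entries with positive
      factors.\<close>
    define comb where "comb = (\<lambda>(p, q) i. (- q v) * p i + p v * q i :: int)"
    define D' where "D' = {d\<in>D. d v = 0} \<union> comb ` (P \<times> N)"
    obtain w :: "'n \<Rightarrow> rat" where w: "\<forall>d\<in>D'. (\<Sum>i\<in>V. w i * of_int (d i)) > 0"
      "\<forall>e\<in>E. (\<Sum>i\<in>V. w i * of_int (e i)) = 0"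
    proof -
      have "\<exists>w :: 'n \<Rightarrow> rat. (\<forall>d\<in>D'. (\<Sum>i\<in>V. w i * of_int (d i)) > 0) \<and> (\<forall>e\<in>E. (\<Sum>i\<in>V. w i * of_int (e i)) = 0)"
      proof (rule insert.IH)
        show "finite D'" using insert.prems(1) by (auto simp: D'_def P_def N_def)
        fix d assume "d \<in> D'"
        then consider "d \<in> D" "d v = 0" | p q where "p \<in> P" "q \<in> N" "d = comb (p, q)"
          by (auto simp: D'_def)
        then show "pos d \<and> (\<forall>i. i \<notin> V \<longrightarrow> d i = 0)"
        proof cases
          case 1
          then show ?thesis using insert.prems(3)[of d] by (metis insert_iff)
        next
          case 2
          then have pq: "p \<in> D" "q \<in> D" "p v > 0" "q v < 0" by (auto simp: P_def N_def)
          have "pos d" unfolding 2(3) comb_def prod.case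
            using pq insert.prems(3) by (intro pos_add pos_scale) auto
          moreover have "d i = 0" if "i \<notin> V" for i
            using that insert.prems(3)[OF pq(1)] insert.prems(3)[OF pq(2)]
            by (cases "i = v") (auto simp: 2(3) comb_def)
          ultimately show ?thesis by blast
        qed
      next
        fix e assume "e \<in> E"
        then show "null e \<and> (\<forall>i. i \<notin> V \<longrightarrow> e i = 0)" using insert.prems(4)[of e] False by (metis insert_iff)
      qed (use insert.prems in auto)
      then show ?thesis using that by blast
    qed
    define s where "s x = (\<Sum>i\<in>V. w i * of_int (x i))" for x :: "'n \<Rightarrow> int"
    \<comment> \<open>Positivity of \<open>comb (p, q)\<close> says exactly that the lower bound
      from \<open>p\<close> is less than the upper bound from \<open>q\<close>; so an admissible
      weight for \<open>v\<close> exists.\<close>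
    have "\<exists>x. (\<forall>l\<in>(\<lambda>p. - s p / of_int (p v)) ` P. l < x) \<and> (\<forall>u\<in>(\<lambda>q. - s q / of_int (q v)) ` N. x < u)"
    proof (rule ex_strictly_between_finite)
      show "finite ((\<lambda>p. - s p / of_int (p v)) ` P)" "finite ((\<lambda>q. - s q / of_int (q v)) ` N)"
        using insert.prems(1) by (auto simp: P_def N_def)
      fix l u assume "l \<in> (\<lambda>p. - s p / of_int (p v)) ` P" "u \<in> (\<lambda>q. - s q / of_int (q v)) ` N"
      then obtain p q where pq: "p \<in> P" "q \<in> N" and l: "l = - s p / of_int (p v)" and u: "u = - s q / of_int (q v)" by blast
      then have pv: "(of_int (p v) :: rat) > 0" and qv: "(of_int (q v) :: rat) < 0" by (auto simp: P_def N_def)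
      have "comb (p, q) \<in> D'" using pq by (auto simp: D'_def)
      then have "0 < s (comb (p, q))" using w(1) by (auto simp: s_def)
      also have "s (comb (p, q)) = - of_int (q v) * s p + of_int (p v) * s q"
        by (simp add: s_def comb_def algebra_simps sum.distrib sum_subtractf sum_distrib_left sum_negf)
      finally have *: "0 < - of_int (q v) * s p + of_int (p v) * s q" .
      show "l < u" unfolding l u using pv qv * by (simp add: field_simps)
    qed
    then obtain x where x: "\<forall>p\<in>P. - s p / of_int (p v) < x" "\<forall>q\<in>N. x < - s q / of_int (q v)" by blast
    have sum': "(\<Sum>i\<in>insert v V. (w(v := x)) i * of_int (d i)) = x * of_int (d v) + s d" for d
    proof -
      have "(\<Sum>i\<in>V. (w(v := x)) i * of_int (d i)) = s d"
        unfolding s_def using insert.hyps(2) by (intro sum.cong) auto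
      then show ?thesis using insert.hyps by simp
    qed
    show ?thesis
    proof (intro exI[of _ "w(v := x)"] conjI ballI; unfold sum')
      fix d assume d: "d \<in> D"
      consider "d v = 0" | "d \<in> P" | "d \<in> N" using d linorder_less_linear[of "d v" 0] unfolding P_def N_def by blast
      then show "x * of_int (d v) + s d > 0"
      proof cases
        case 1
        then show ?thesis using w(1) d by (auto simp: D'_def s_def)
      next
        case 2
        then have "(of_int (d v) :: rat) > 0" "- s d / of_int (d v) < x" using x by (auto simp: P_def)
        then show ?thesis by (simp add: field_simps)
      next
        case 3
        then have "(of_int (d v) :: rat) < 0" "x < - s d / of_int (d v)" using x by (auto simp: N_def)
        then show ?thesis by (simp add: field_simps)
      qed
    next
      fix e assume e: "e \<in> E"
      then show "x * of_int (e v) + s e = 0" using w(2) False by (auto simp: s_def)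
    qed
  qed
qed

lemma ex_common_denominator:
  fixes w :: "'n \<Rightarrow> rat"
  assumes "finite V"
  shows "\<exists>N>0::int. \<forall>i\<in>V. \<exists>z::int. of_int N * w i = of_int z"
  using assms
proof (induction V)
  case (insert v V)
  then obtain N :: int where N: "N > 0" "\<forall>i\<in>V. \<exists>z::int. of_int N * w i = of_int z" by blast
  obtain a b :: int where ab: "w v = of_int a / of_int b" "b > 0"
    by (cases "w v") (auto simp: Fract_of_int_quotient)
  have "\<exists>z::int. of_int (N * b) * w i = of_int z" if i: "i \<in> V" for i
  proof -
    obtain z :: int where "of_int N * w i = of_int z" using N(2) i by blast
    then have "of_int (N * b) * w i = of_int (b * z)" by (simp add: algebra_simps)
    then show ?thesis by blast
  qed
  moreover have "of_int (N * b) * w v = of_int (N * a)" using ab by simp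
  ultimately show ?case using N(1) ab(2) by (intro exI[of _ "N * b"]) (auto intro: exI[of _ "N * a"])
qed (auto intro: exI[of _ 1])

section \<open>Weights that imitate a preorder on finitely many monomials\<close>

definition weight :: "('n::finite \<Rightarrow> int) \<Rightarrow> 'n monomial \<Rightarrow> int" where
  "weight w a = (\<Sum>i\<in>UNIV. w i * int (lookup a i))"

lemma weight_add: "weight w (a + b) = weight w a + weight w b"
  by (simp add: weight_def lookup_add algebra_simps sum.distrib)

lemma weight_zero [simp]: "weight w 0 = 0"
  by (simp add: weight_def)

lemma weight_var_monomial: "weight w (var_monomial i) = w i"
proof -
  have "weight w (var_monomial i) = (\<Sum>j\<in>UNIV. if j = i then w i else 0)"
    unfolding weight_def by (intro sum.cong) (auto simp: var_monomial_def lookup_single when_def)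
  then show ?thesis by simp
qed

definition weight_less :: "('n::finite \<Rightarrow> int) \<Rightarrow> 'n monomial \<Rightarrow> 'n monomial \<Rightarrow> bool" where
  "weight_less w a b \<longleftrightarrow> weight w a < weight w b"

lemma mon_preorder_weight_less: "mon_preorder (weight_less w)"
proof
  have "equivp (\<lambda>a b. \<not> weight_less w a b \<and> \<not> weight_less w b a)"
    unfolding weight_less_def by (intro equivpI reflpI sympI transpI) auto
  then show "monomial_preorder (weight_less w)"
    unfolding monomial_preorder_def weak_order_def
    by (auto simp: weight_less_def weight_add intro!: irreflpI transpI)
qed

lemma (in mon_preorder) add_mono_lt: "lt a b \<Longrightarrow> lt c d \<Longrightarrow> lt (a + c) (b + d)"
  using lt_trans[of "a + c" "b + c" "b + d"] by simp

text \<open>The sum of \<open>n\<close> copies of \<open>a\<close> is the exponent vector of the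
  \<open>n\<close>-th power.\<close>

lemma (in mon_preorder) scale_mono_lt:
  assumes "lt a b" "n > 0"
  shows "lt (\<Sum>i<n::nat. a) (\<Sum>i<n. b)"
  using assms(2)
proof (induction n)
  case (Suc n)
  then show ?case using assms(1) add_mono_lt by (cases "n = 0") auto
qed auto

lemma (in mon_preorder) add_mono_not_lt: "\<not> lt a b \<Longrightarrow> \<not> lt c d \<Longrightarrow> \<not> lt (a + c) (b + d)"
  using not_lt_trans[of "a + c" "b + c" "b + d"] by simp

lemma (in mon_preorder) scale_mono_not_lt:
  assumes "\<not> lt a b"
  shows "\<not> lt (\<Sum>i<n::nat. a) (\<Sum>i<n. b)"
proof (induction n)
  case (Suc n)
  then show ?case using assms add_mono_not_lt by auto
qed auto

text \<open>By translation invariance, comparisons turn into conditions on difference vectors: those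
  of strict pairs are closed under sums and positive multiples and never vanish, those of ties form
  a group. This is the situation of \<open>ex_rational_weight\<close>; clearing denominators makes
  the weight integral.\<close>

lemma ex_weight_on_finite:
  fixes lt :: "'n::finite monomial \<Rightarrow> 'n monomial \<Rightarrow> bool"
  assumes "mon_preorder lt" "finite K"
  shows "\<exists>w. \<forall>a\<in>K. \<forall>b\<in>K. weight_less w a b \<longleftrightarrow> lt a b"
proof -
  interpret mon_preorder lt by fact
  define diff :: "'n monomial \<times> 'n monomial \<Rightarrow> 'n \<Rightarrow> int" where
    "diff = (\<lambda>(a, b) i. int (lookup b i) - int (lookup a i))"
  define pos where "pos x \<longleftrightarrow> (\<exists>a b. lt a b \<and> x = diff (a, b))" for x
  define null where "null x \<longleftrightarrow> (\<exists>a b. \<not> lt a b \<and> \<not> lt b a \<and> x = diff (a, b))" for x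
  define D E where "D = diff ` {(a, b) \<in> K \<times> K. lt a b}" and "E = diff ` {(a, b) \<in> K \<times> K. \<not> lt a b \<and> \<not> lt b a}"
  have diff_add: "(\<lambda>i. diff (a, b) i + diff (a', b') i) = diff (a + a', b + b')" for a b a' b'
    by (auto simp: diff_def lookup_add fun_eq_iff)
  have diff_scale: "(\<lambda>i. int n * diff (a, b) i) = diff ((\<Sum>i<n. a), (\<Sum>i<n. b))" for n a b
    by (auto simp: diff_def lookup_sum fun_eq_iff algebra_simps)
  have diff_neg: "(\<lambda>i. - diff (a, b) i) = diff (b, a)" for a b
    by (auto simp: diff_def fun_eq_iff)
  have "\<exists>w :: 'n \<Rightarrow> rat. (\<forall>d\<in>D. (\<Sum>i\<in>UNIV. w i * of_int (d i)) > 0) \<and> (\<forall>e\<in>E. (\<Sum>i\<in>UNIV. w i * of_int (e i)) = 0)"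
  proof (rule ex_rational_weight[of pos null])
    fix x y assume x: "pos x"
    show "pos (\<lambda>i. x i + y i)" if y: "pos y"
    proof -
      obtain a b c d where "lt a b" "x = diff (a, b)" "lt c d" "y = diff (c, d)"
        using x y unfolding pos_def by blast
      then show ?thesis unfolding pos_def using add_mono_lt[of a b c d] diff_add[of a b c d] by blast
    qed
    show "pos (\<lambda>i. k * x i)" if "k > 0" for k :: int
    proof -
      obtain a b where "lt a b" "x = diff (a, b)" using x unfolding pos_def by blast
      then show ?thesis unfolding pos_def using scale_mono_lt[of a b "nat k"] diff_scale[of "nat k" a b] \<open>k > 0\<close> by auto
    qed
    show "pos (\<lambda>i. x i + y i)" if y: "null y"
    proof -
      obtain a b where ab: "lt a b" "x = diff (a, b)" using x unfolding pos_def by blast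
      obtain c d where cd: "\<not> lt c d" "\<not> lt d c" "y = diff (c, d)" using y unfolding null_def by blast
      have "\<not> lt (b + d) (b + c)" using cd by simp
      then have "lt (a + c) (b + d)" using ab(1) not_lt_trans[of "a + c" "b + d" "b + c"] by auto
      then show ?thesis unfolding pos_def ab(2) cd(3) diff_add by blast
    qed
  next
    fix x y assume x: "null x"
    show "null (\<lambda>i. x i + y i)" if y: "null y"
    proof -
      obtain a b c d where "\<not> lt a b" "\<not> lt b a" "x = diff (a, b)" "\<not> lt c d" "\<not> lt d c" "y = diff (c, d)"
        using x y unfolding null_def by blast
      then show ?thesis unfolding null_def
        using add_mono_not_lt[of a b c d] add_mono_not_lt[of b a d c] diff_add[of a b c d] by blast
    qed
    fix k :: int
    obtain a b where ab: "\<not> lt a b" "\<not> lt b a" "x = diff (a, b)" using x unfolding null_def by blast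
    show "null (\<lambda>i. k * x i)"
    proof (cases "k \<ge> 0")
      case True
      then show ?thesis unfolding null_def ab(3)
        using scale_mono_not_lt[OF ab(1), of "nat k"] scale_mono_not_lt[OF ab(2), of "nat k"] diff_scale[of "nat k" a b] by auto
    next
      case False
      \<comment> \<open>A negative multiple of a tie is a positive multiple of the tie with its
        sides exchanged.\<close>
      have "(\<lambda>i. k * x i) = (\<lambda>i. int (nat (- k)) * diff (b, a) i)"
        using False by (auto simp: ab(3) fun_eq_iff diff_def algebra_simps)
      then show ?thesis unfolding null_def
        using scale_mono_not_lt[OF ab(1), of "nat (- k)"] scale_mono_not_lt[OF ab(2), of "nat (- k)"] diff_scale[of "nat (- k)" b a] by auto
    qed
  next
    have "a = b" if "(\<lambda>_. 0) = diff (a, b)" for a b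
      using that by (intro poly_mapping_eqI) (simp add: diff_def fun_eq_iff)
    then show "\<not> pos (\<lambda>_. 0)" unfolding pos_def using lt_irrefl by metis
    show "finite D" "finite E" using assms(2) by (auto simp: D_def E_def intro!: finite_imageI intro: finite_subset[of _ "K \<times> K"])
  qed (auto simp: D_def E_def pos_def null_def)
  then obtain w :: "'n \<Rightarrow> rat" where w: "\<forall>d\<in>D. (\<Sum>i\<in>UNIV. w i * of_int (d i)) > 0"
    "\<forall>e\<in>E. (\<Sum>i\<in>UNIV. w i * of_int (e i)) = 0" by blast
  obtain N :: int where N: "N > 0" "\<forall>i\<in>UNIV. \<exists>z::int. of_int N * w i = of_int z"
    using ex_common_denominator[of UNIV w] by auto
  from N(2) obtain w' :: "'n \<Rightarrow> int" where w': "\<And>i. of_int N * w i = of_int (w' i)" by (metis UNIV_I)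
  have weight_diff: "of_int (weight w' b - weight w' a) = of_int N * (\<Sum>i\<in>UNIV. w i * of_int (diff (a, b) i))" for a b
  proof -
    have "weight w' b - weight w' a = (\<Sum>i\<in>UNIV. w' i * diff (a, b) i)"
      by (simp add: weight_def diff_def algebra_simps sum_subtractf)
    then show ?thesis by (simp add: sum_distrib_left w'[symmetric] mult.assoc)
  qed
  have less: "weight w' a < weight w' b" if "lt a b" "a \<in> K" "b \<in> K" for a b
  proof -
    have "diff (a, b) \<in> D" using that by (auto simp: D_def)
    then have "(0 :: rat) < of_int (weight w' b - weight w' a)"
      unfolding weight_diff using w(1) N(1) by simp
    then show ?thesis by linarith
  qed
  have eq: "weight w' a = weight w' b" if "\<not> lt a b" "\<not> lt b a" "a \<in> K" "b \<in> K" for a b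
  proof -
    have "diff (a, b) \<in> E" using that by (auto simp: E_def)
    then have "(0 :: rat) = of_int (weight w' b - weight w' a)"
      unfolding weight_diff using w(2) by simp
    then show ?thesis by simp
  qed
  show ?thesis
  proof (intro exI[of _ w'] ballI)
    fix a b assume ab: "a \<in> K" "b \<in> K"
    show "weight_less w' a b \<longleftrightarrow> lt a b"
      unfolding weight_less_def using less[of a b] less[of b a] eq[of a b] ab by fastforce
  qed
qed

lemma leading_part_cong:
  "(\<And>a b. a \<in> keys f \<Longrightarrow> b \<in> keys f \<Longrightarrow> lt a b \<longleftrightarrow> lt' a b) \<Longrightarrow> leading_part lt f = leading_part lt' f"
  unfolding leading_part_def by (intro sum.cong) auto

text \<open>Agreement of the weight with \<open>lt\<close> on the monomials of the standard bases
  suffices. The two leading parts of a given \<open>f\<close> may still differ, since different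
  indices can be maximal, but both are combinations of leading parts of the \<open>b m\<close>,
  which lie in \<open>J\<close> and for which the two orders agree.\<close>

lemma ex_weight_leading_ideal:
  fixes lt :: "'n::finite monomial \<Rightarrow> 'n monomial \<Rightarrow> bool" and \<J> :: "('n, 'k::field) mpoly set set"
  assumes "mon_preorder lt" "finite \<J>" "\<And>J. J \<in> \<J> \<Longrightarrow> ideal J ring_of_type_algebra"
  obtains w where
    "\<And>J f. J \<in> \<J> \<Longrightarrow> f \<in> J \<Longrightarrow> leading_part (weight_less w) f \<in> Idl\<^bsub>ring_of_type_algebra\<^esub> (leading_part lt ` J)"
    "\<And>J f. J \<in> \<J> \<Longrightarrow> f \<in> J \<Longrightarrow> leading_part lt f \<in> Idl\<^bsub>ring_of_type_algebra\<^esub> (leading_part (weight_less w) ` J)"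
proof -
  interpret mon_preorder lt by fact
  interpret R: cring "ring_of_type_algebra :: ('n, 'k) mpoly ring" by (rule type_ring_cring)
  obtain lx0 :: "'n monomial \<Rightarrow> _" where "monomial_total_order lx0" using ex_monomial_total_order by blast
  define lx where "lx a b \<longleftrightarrow> lt a b \<or> \<not> lt b a \<and> lx0 a b" for a b
  have lx_order: "monomial_total_order lx"
    unfolding lx_def by (rule mon_preorder_total_refinement) fact+
  have refines: "lt a b \<Longrightarrow> lx a b" for a b by (simp add: lx_def)
  have "\<forall>J\<in>\<J>. \<exists>G. finite G \<and> G \<subseteq> J \<and> (\<forall>f\<in>J. \<exists>A c b. standard_rep lx G f A c b)"
    using monomial_total_order.ex_standard_basis[OF lx_order assms(3)] by metis
  then obtain G where G: "\<And>J. J \<in> \<J> \<Longrightarrow> finite (G J)" "\<And>J. J \<in> \<J> \<Longrightarrow> G J \<subseteq> J"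
    "\<And>J f. J \<in> \<J> \<Longrightarrow> f \<in> J \<Longrightarrow> \<exists>A c b. standard_rep lx (G J) f A c b" by metis
  define K where "K = (\<Union>J\<in>\<J>. \<Union>g\<in>G J. keys g)"
  have "finite K" unfolding K_def using assms(2) G(1) by auto
  then obtain w where w: "\<forall>a\<in>K. \<forall>b\<in>K. weight_less w a b \<longleftrightarrow> lt a b"
    using ex_weight_on_finite[OF assms(1)] by blast
  have agree: "leading_part (weight_less w) g = leading_part lt g" if "J \<in> \<J>" "g \<in> G J" for J g
    using w that by (intro leading_part_cong) (auto simp: K_def)
  have b_mem: "b m \<in> J" if J: "J \<in> \<J>" and rep: "standard_rep lx (G J) f A c b" and m: "m \<in> A" for J f A c b m
  proof -
    obtain g a where "g \<in> G J" "b m = single a 1 * g"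
      using rep m unfolding standard_rep_def by blast
    then show ?thesis using ideal_type_ring_closed(3)[OF assms(3)[OF J]] G(2)[OF J] by auto
  qed
  have Idl: "ideal (Idl\<^bsub>ring_of_type_algebra\<^esub> Y) ring_of_type_algebra" "x \<in> Y \<Longrightarrow> x \<in> Idl\<^bsub>ring_of_type_algebra\<^esub> Y"
    for x and Y :: "('n, 'k) mpoly set"
    using R.genideal_ideal[of Y] R.genideal_self[of Y] by auto
  show ?thesis
  proof (rule that[of w])
    fix J f assume J: "J \<in> \<J>" and f: "f \<in> J"
    obtain A c b where rep: "standard_rep lx (G J) f A c b" using G(3)[OF J f] by blast
    have lp: "leading_part (weight_less w) f =
        (\<Sum>m\<in>{m\<in>A. \<forall>m'\<in>A. \<not> weight_less w m m'}. single 0 (c m) * leading_part lt (b m))"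
      and lp_b: "m \<in> A \<Longrightarrow> leading_part (weight_less w) (b m) = leading_part lt (b m)" for m
      using leading_part_standard_rep[OF assms(1) mon_preorder_weight_less lx_order _ _ rep] refines agree[OF J] by auto
    have lp0: "leading_part lt f =
        (\<Sum>m\<in>{m\<in>A. \<forall>m'\<in>A. \<not> lt m m'}. single 0 (c m) * leading_part lt (b m))"
      using leading_part_standard_rep(1)[OF assms(1) assms(1) lx_order _ _ rep] refines by auto
    show "leading_part (weight_less w) f \<in> Idl\<^bsub>ring_of_type_algebra\<^esub> (leading_part lt ` J)"
      unfolding lp using b_mem[OF J rep]
      by (intro ideal_type_ring_closed[OF Idl(1)] Idl(2)) auto
    show "leading_part lt f \<in> Idl\<^bsub>ring_of_type_algebra\<^esub> (leading_part (weight_less w) ` J)"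
      unfolding lp0 using b_mem[OF J rep]
      by (intro ideal_type_ring_closed[OF Idl(1)] Idl(2)) (auto simp flip: lp_b)
  qed
qed

text \<open>Hilbert's basis theorem comes for free: a standard representation expresses
  \<open>f\<close> through the finite set \<open>G\<close>.\<close>

lemma mpoly_noetherian: "noetherian_ring (ring_of_type_algebra :: ('n::finite, 'k::field) mpoly ring)"
proof -
  interpret R: cring "ring_of_type_algebra :: ('n, 'k) mpoly ring" by (rule type_ring_cring)
  obtain lx :: "'n monomial \<Rightarrow> _" where lx: "monomial_total_order lx" using ex_monomial_total_order by blast
  show ?thesis
  proof (rule R.noetherian_ringI)
    fix J :: "('n, 'k) mpoly set" assume J: "ideal J ring_of_type_algebra"
    obtain G where G: "finite G" "G \<subseteq> J" "\<And>f. f \<in> J \<Longrightarrow> \<exists>A c b. standard_rep lx G f A c b"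
      using monomial_total_order.ex_standard_basis[OF lx J] by blast
    have I: "ideal (Idl\<^bsub>ring_of_type_algebra\<^esub> G) ring_of_type_algebra" by (rule R.genideal_ideal) simp
    have "J \<subseteq> Idl\<^bsub>ring_of_type_algebra\<^esub> G"
    proof
      fix f assume "f \<in> J"
      then obtain A c b where rep: "standard_rep lx G f A c b" using G(3) by blast
      have "b m \<in> Idl\<^bsub>ring_of_type_algebra\<^esub> G" if m: "m \<in> A" for m
      proof -
        obtain g a where g: "g \<in> G" "b m = single a 1 * g"
          using rep m unfolding standard_rep_def by blast
        have "g \<in> Idl\<^bsub>ring_of_type_algebra\<^esub> G" using R.genideal_self[of G] g(1) by auto
        then show ?thesis unfolding g(2) by (rule ideal_type_ring_closed(3)[OF I])
      qed
      moreover have "f = (\<Sum>m\<in>A. single 0 (c m) * b m)" using rep by (simp add: standard_rep_def)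
      ultimately show "f \<in> Idl\<^bsub>ring_of_type_algebra\<^esub> G" by (auto intro!: ideal_type_ring_closed[OF I])
    qed
    moreover have "Idl\<^bsub>ring_of_type_algebra\<^esub> G \<subseteq> J" by (rule R.genideal_minimal[OF J G(2)])
    ultimately have "J = Idl\<^bsub>ring_of_type_algebra\<^esub> G" by blast
    then show "\<exists>A\<subseteq>carrier ring_of_type_algebra. finite A \<and> J = Idl\<^bsub>ring_of_type_algebra\<^esub> A"
      using G(1) by auto
  qed
qed

section \<open>Subrings of rings given by a type class\<close>

text \<open>Only the carrier is replaced, so that sums and products remain those of the type and
  computations take place there.\<close>

abbreviation subring_of :: "'a::comm_ring_1 set \<Rightarrow> 'a ring" where
  "subring_of C \<equiv> ring_of_type_algebra\<lparr>carrier := C\<rparr>"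

lemma subring_of_cring:
  fixes C :: "'a::comm_ring_1 set"
  assumes "1 \<in> C" "\<And>a b. a \<in> C \<Longrightarrow> b \<in> C \<Longrightarrow> a - b \<in> C" "\<And>a b. a \<in> C \<Longrightarrow> b \<in> C \<Longrightarrow> a * b \<in> C"
  shows "cring (subring_of C)"
proof (rule cringI)
  have 0: "0 \<in> C" using assms(1) assms(2)[of 1 1] by simp
  have uminus: "- a \<in> C" if "a \<in> C" for a using assms(2)[OF 0 that] by simp
  have plus: "a + b \<in> C" if "a \<in> C" "b \<in> C" for a b using assms(2)[OF that(1) uminus[OF that(2)]] by simp
  show "abelian_group (subring_of C)"
    using 0 uminus plus by (intro abelian_groupI) (auto simp: add_ac intro!: bexI[of _ "- _"])
  show "Group.comm_monoid (subring_of C)"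
    using assms(1,3) by (intro comm_monoidI) (auto simp: mult_ac)
qed (auto simp: algebra_simps)

lemma ideal_subring_of:
  fixes C :: "'a::comm_ring_1 set"
  assumes "cring (subring_of C)" "J \<subseteq> C" "0 \<in> J" "\<And>a b. a \<in> J \<Longrightarrow> b \<in> J \<Longrightarrow> a + b \<in> J"
    "\<And>r a. r \<in> C \<Longrightarrow> a \<in> J \<Longrightarrow> r * a \<in> J"
  shows "ideal J (subring_of C)"
proof -
  interpret cring "subring_of C" by fact
  have minus1: "- 1 \<in> C"
  proof -
    have "a_inv (subring_of C) 1 \<in> C" "a_inv (subring_of C) 1 + 1 = 0"
      using a_inv_closed[OF one_closed] l_neg[OF one_closed] by simp_all
    then show ?thesis by (metis eq_neg_iff_add_eq_0)
  qed
  have uminus: "\<ominus>\<^bsub>subring_of C\<^esub> a = - a" if "a \<in> C" for a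
  proof -
    have "- a \<in> C" using m_closed[of "-1" a] minus1 that by simp
    then show ?thesis using minus_equality[of "- a" a] that by simp
  qed
  have "subgroup J (add_monoid (subring_of C))"
  proof (rule add.subgroupI)
    fix a assume a: "a \<in> J"
    then have "- a \<in> J" using assms(5)[OF minus1 a] by simp
    then show "\<ominus>\<^bsub>subring_of C\<^esub> a \<in> J" using a assms(2) uminus by auto
  qed (use assms in auto)
  moreover have "a * r \<in> J" if "a \<in> J" "r \<in> C" for a r
    using assms(5)[OF that(2,1)] by (simp add: mult.commute)
  ultimately show ?thesis
    using assms(5) by (intro idealI) (auto simp: ring_axioms)
qed

lemma primeideal_subring_of:
  fixes C :: "'a::comm_ring_1 set"
  assumes "cring (subring_of C)" "ideal J (subring_of C)" "1 \<notin> J"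
    "\<And>a b. a \<in> C \<Longrightarrow> b \<in> C \<Longrightarrow> a * b \<in> J \<Longrightarrow> a \<in> J \<or> b \<in> J"
  shows "primeideal J (subring_of C)"
proof (rule primeidealI)
  interpret cring "subring_of C" by fact
  show "carrier (subring_of C) \<noteq> J" using one_closed assms(3) by auto
qed (use assms in auto)

section \<open>Laurent polynomials over a polynomial ring\<close>

type_synonym ('n, 'k) laurent = "int \<Rightarrow>\<^sub>0 ('n, 'k) mpoly"

definition laurent_monomial :: "'k \<Rightarrow> 'n monomial \<Rightarrow> int \<Rightarrow> ('n, 'k::field) laurent" where
  "laurent_monomial c a e = single e (single a c)"

definition laurent_var :: "('n, 'k::field) laurent" where
  "laurent_var = single 1 1"

lemma laurent_monomial_mult:
  "laurent_monomial c a e * laurent_monomial d b f = laurent_monomial (c * d) (a + b) (e + f)"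
  by (simp add: laurent_monomial_def mult_single)

lemma poly_mapping_eq_sum_single:
  fixes p :: "'a \<Rightarrow>\<^sub>0 'b::comm_monoid_add"
  shows "p = (\<Sum>k\<in>keys p. single k (lookup p k))"
proof (rule poly_mapping_eqI)
  fix k
  have "lookup (\<Sum>k\<in>keys p. single k (lookup p k)) k = (\<Sum>l\<in>keys p. if l = k then lookup p k else 0)"
    unfolding lookup_sum by (intro sum.cong) (auto simp: lookup_single when_def)
  also have "\<dots> = lookup p k" by (subst sum.delta) (auto simp: in_keys_iff)
  finally show "lookup p k = lookup (\<Sum>k\<in>keys p. single k (lookup p k)) k" ..
qed

text \<open>The case \<open>single\<close> is restricted to terms that occur in \<open>p\<close>, so
  that bounds on the exponents of \<open>p\<close> are available in it.\<close>

lemma poly_mapping_sum_induct [case_names zero add single]: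
  fixes p :: "'a \<Rightarrow>\<^sub>0 'b::comm_monoid_add"
  assumes "P 0" "\<And>p q. P p \<Longrightarrow> P q \<Longrightarrow> P (p + q)"
    "\<And>k. k \<in> keys p \<Longrightarrow> P (single k (lookup p k))"
  shows "P p"
proof -
  have "P (\<Sum>k\<in>A. single k (lookup p k))" if "A \<subseteq> keys p" for A
    using finite_subset[OF that finite_keys] that by (induction A) (auto intro: assms)
  then show ?thesis using poly_mapping_eq_sum_single[of p] by (metis order_refl)
qed

lemma lookup_mult_group:
  fixes p q :: "'a::ab_group_add \<Rightarrow>\<^sub>0 'b::comm_semiring_1"
  shows "lookup (p * q) e = (\<Sum>i\<in>keys p. lookup p i * lookup q (e - i))"
proof -
  have "lookup (p * q) e = (\<Sum>l. lookup p l * lookup q (e - l))"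
  proof -
    have "(\<Sum>m. lookup q m when e = l + m) = lookup q (e - l)" for l
    proof -
      have "(\<Sum>m. lookup q m when e = l + m) = (\<Sum>m. lookup q m when e - l = m)"
        by (intro arg_cong[of _ _ Sum_any]) (auto simp: fun_eq_iff when_def algebra_simps)
      then show ?thesis by simp
    qed
    then show ?thesis by (simp add: lookup_mult)
  qed
  also have "\<dots> = (\<Sum>i\<in>keys p. lookup p i * lookup q (e - i))"
    by (rule Sum_any.expand_superset) (auto simp: in_keys_iff)
  finally show ?thesis .
qed

text \<open>A sum of exponent vectors is 0 only if both are 0, so the constant term is a ring
  homomorphism, namely evaluation at the origin. Primeness of \<open>vars_ideal\<close> and of
  \<open>M_rees\<close> rests on this.\<close>

lemma lookup_mult_zero:
  fixes f g :: "('n, 'k::field) mpoly"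
  shows "lookup (f * g) 0 = lookup f 0 * lookup g 0"
proof -
  have zero: "a + b = 0 \<longleftrightarrow> a = 0 \<and> b = 0" for a b :: "'n monomial"
    by (auto simp: poly_mapping_eq_iff lookup_add fun_eq_iff)
  have 1: "lookup (single a c * g) 0 = lookup (single a c) 0 * lookup g 0" for a c
  proof (induction g rule: poly_mapping_sum_induct)
    case (single b)
    then show ?case using zero[of a b] by (auto simp: mult_single lookup_single when_def)
  qed (simp_all add: lookup_add algebra_simps)
  show ?thesis
  proof (induction f rule: poly_mapping_sum_induct)
    case (single a)
    show ?case by (rule 1)
  qed (simp_all add: lookup_add algebra_simps)
qed

text \<open>The extension \<open>J[t, 1/t]\<close> of an ideal \<open>J\<close>.\<close>

definition coeffs_in :: "('n, 'k::field) mpoly set \<Rightarrow> ('n, 'k) laurent set" where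
  "coeffs_in J = {p. \<forall>e. lookup p e \<in> J}"

lemma ideal_coeffs_in:
  assumes "ideal J ring_of_type_algebra"
  shows "ideal (coeffs_in J) ring_of_type_algebra"
  using ideal_type_ring_closed[OF assms]
  by (auto simp: ideal_type_ring_iff coeffs_in_def lookup_add lookup_mult_group intro!: ideal_type_ring_closed(6)[OF assms])

text \<open>As in Gauss's lemma: if \<open>i\<close> and \<open>j\<close> are the lowest exponents
  at which \<open>p\<close> and \<open>q\<close> have coefficients outside \<open>J\<close>, then
  modulo \<open>J\<close> the coefficient of the product at \<open>i + j\<close> is the product of
  these two.\<close>

lemma coeffs_in_prime:
  assumes J: "ideal J ring_of_type_algebra"
    and prime: "\<And>a b. a * b \<in> J \<Longrightarrow> a \<in> J \<or> b \<in> J"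
    and "p * q \<in> coeffs_in J"
  shows "p \<in> coeffs_in J \<or> q \<in> coeffs_in J"
proof (rule ccontr)
  assume no: "\<not> (p \<in> coeffs_in J \<or> q \<in> coeffs_in J)"
  have fin: "finite {i. lookup r i \<notin> J}" for r :: "('a, 'b) laurent"
    using ideal_type_ring_closed(1)[OF J] by (intro finite_subset[OF _ finite_keys[of r]]) (auto simp: in_keys_iff)
  define i where "i = Min {i. lookup p i \<notin> J}"
  define j where "j = Min {i. lookup q i \<notin> J}"
  have i: "lookup p i \<notin> J" using Min_in[OF fin[of p]] no by (auto simp: i_def coeffs_in_def)
  have j: "lookup q j \<notin> J" using Min_in[OF fin[of q]] no by (auto simp: j_def coeffs_in_def)
  have less_i: "lookup p l \<in> J" if "l < i" for l
    using that Min_le[OF fin[of p], of l] by (force simp: i_def)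
  have less_j: "lookup q l \<in> J" if "l < j" for l
    using that Min_le[OF fin[of q], of l] by (force simp: j_def)
  have ip: "i \<in> keys p" using i ideal_type_ring_closed(1)[OF J] by (auto simp: in_keys_iff)
  have rest: "lookup p l * lookup q (i + j - l) \<in> J" if "l \<noteq> i" for l
  proof (cases "l < i")
    case True
    then show ?thesis using less_i ideal_type_ring_closed(3)[OF J] by (metis mult.commute)
  next
    case False
    then show ?thesis using that less_j[of "i + j - l"] ideal_type_ring_closed(3)[OF J] by auto
  qed
  have "lookup (p * q) (i + j) = lookup p i * lookup q j + (\<Sum>l\<in>keys p - {i}. lookup p l * lookup q (i + j - l))"
    unfolding lookup_mult_group using ip by (subst sum.remove[of _ i]) auto
  then have eq: "lookup p i * lookup q j = lookup (p * q) (i + j) - (\<Sum>l\<in>keys p - {i}. lookup p l * lookup q (i + j - l))"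
    by simp
  have "(\<Sum>l\<in>keys p - {i}. lookup p l * lookup q (i + j - l)) \<in> J"
    using rest by (intro ideal_type_ring_closed(6)[OF J]) auto
  then have "lookup p i * lookup q j \<in> J"
    unfolding eq using assms(3) by (intro ideal_type_ring_closed(5)[OF J]) (simp_all add: coeffs_in_def)
  then show False using prime i j by blast
qed

section \<open>The extended Rees ring of a weight\<close>

definition rees :: "('n::finite \<Rightarrow> int) \<Rightarrow> ('n, 'k::field) laurent set" where
  "rees w = {p. \<forall>e. \<forall>a\<in>keys (lookup p e). weight w a \<le> e}"

lemma rees_add: "p \<in> rees w \<Longrightarrow> q \<in> rees w \<Longrightarrow> p + q \<in> rees w"
  unfolding rees_def using keys_add by (fastforce simp: lookup_add)

lemma rees_zero [simp]: "0 \<in> rees w"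
  by (simp add: rees_def)

lemma rees_monomial: "weight w a \<le> e \<Longrightarrow> laurent_monomial c a e \<in> rees w"
  by (auto simp: rees_def laurent_monomial_def lookup_single when_def)

lemma rees_induct [consumes 1, case_names zero add monomial]:
  assumes "p \<in> rees w" "P 0" "\<And>p q. P p \<Longrightarrow> P q \<Longrightarrow> P (p + q)"
    "\<And>c a e. weight w a \<le> e \<Longrightarrow> P (laurent_monomial c a e)"
  shows "P p"
proof (induction p rule: poly_mapping_sum_induct)
  case (single e)
  define f where "f = lookup p e"
  have "P (single e f)"
  proof (induction f rule: poly_mapping_sum_induct)
    case (single a)
    then have "weight w a \<le> e" using assms(1) by (auto simp: rees_def f_def)
    then show ?case using assms(4) by (simp add: laurent_monomial_def)
  qed (simp_all add: assms(2,3) single_add)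
  then show ?case by (simp add: f_def)
qed (fact assms)+

lemma rees_mult: "p \<in> rees w \<Longrightarrow> q \<in> rees w \<Longrightarrow> p * q \<in> rees w"
proof (induction p rule: rees_induct)
  case (monomial c a e)
  from monomial(2) show ?case
  proof (induction q rule: rees_induct)
    case (monomial d b f)
    then show ?case
      using \<open>weight w a \<le> e\<close> by (auto simp: laurent_monomial_mult weight_add intro!: rees_monomial)
  qed (auto simp: algebra_simps intro: rees_add)
qed (auto simp: algebra_simps intro: rees_add)

lemma rees_uminus: "p \<in> rees w \<Longrightarrow> - p \<in> rees w"
  by (auto simp: rees_def in_keys_iff)

lemma rees_one [simp]: "1 \<in> rees w"
  using rees_monomial[of w 0 0 1] by (simp add: laurent_monomial_def)

lemma rees_cring: "cring (subring_of (rees w))"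
  using rees_add[OF _ rees_uminus] by (intro subring_of_cring rees_mult) auto

lemma laurent_var_rees [simp]: "laurent_var \<in> rees w"
  using rees_monomial[of w 0 1 1] by (simp add: laurent_monomial_def laurent_var_def)

text \<open>This is the reduction of the Rees ring modulo \<open>t\<close>: the terms with
  \<open>weight w a = e\<close> are kept, with \<open>X^a t^(w a)\<close> identified with
  \<open>X^a\<close>, and all others are multiples of \<open>t\<close> in the Rees ring.\<close>

definition initial :: "('n::finite \<Rightarrow> int) \<Rightarrow> ('n, 'k::field) laurent \<Rightarrow> ('n, 'k) mpoly" where
  "initial w p = (\<Sum>e\<in>keys p. \<Sum>a\<in>{a\<in>keys (lookup p e). weight w a = e}. single a (lookup (lookup p e) a))"

lemma lookup_initial: "lookup (initial w p) a = lookup (lookup p (weight w a)) a"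
proof -
  have "lookup (\<Sum>b\<in>{b\<in>keys (lookup p e). weight w b = e}. single b (lookup (lookup p e) b)) a
      = (if e = weight w a then lookup (lookup p e) a else 0)" for e
  proof -
    have "lookup (\<Sum>b\<in>{b\<in>keys (lookup p e). weight w b = e}. single b (lookup (lookup p e) b)) a
      = (\<Sum>b\<in>{b\<in>keys (lookup p e). weight w b = e}. if b = a then lookup (lookup p e) a else 0)"
      unfolding lookup_sum by (intro sum.cong) (auto simp: lookup_single when_def)
    also have "\<dots> = (if e = weight w a then lookup (lookup p e) a else 0)"
      by (subst sum.delta) (auto simp: in_keys_iff)
    finally show ?thesis .
  qed
  then have "lookup (initial w p) a = (\<Sum>e\<in>keys p. if e = weight w a then lookup (lookup p e) a else 0)"
    unfolding initial_def lookup_sum by simp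
  also have "\<dots> = lookup (lookup p (weight w a)) a"
    by (subst sum.delta) (auto simp: in_keys_iff)
  finally show ?thesis .
qed

lemma initial_add: "initial w (p + q) = initial w p + initial w q"
  by (rule poly_mapping_eqI) (simp add: lookup_initial lookup_add)

lemma initial_zero [simp]: "initial w 0 = 0"
  by (simp add: initial_def)

lemma initial_diff: "initial w (p - q) = initial w p - initial w q"
  by (rule poly_mapping_eqI) (simp add: lookup_initial lookup_minus)

lemma initial_monomial: "initial w (laurent_monomial c a e) = (if weight w a = e then single a c else 0)"
  by (rule poly_mapping_eqI) (auto simp: lookup_initial laurent_monomial_def lookup_single when_def)

text \<open>For members of the Rees ring, a product of two terms attains the weight bound only if
  both terms do.\<close>

lemma initial_mult: "p \<in> rees w \<Longrightarrow> q \<in> rees w \<Longrightarrow> initial w (p * q) = initial w p * initial w q"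
proof (induction p rule: rees_induct)
  case (monomial c a e)
  from monomial(2) show ?case
  proof (induction q rule: rees_induct)
    case (monomial d b f)
    then show ?case
      using \<open>weight w a \<le> e\<close> by (auto simp: laurent_monomial_mult weight_add initial_monomial mult_single)
  qed (auto simp: algebra_simps initial_add)
qed (auto simp: algebra_simps initial_add)

lemma initial_hom: "initial w \<in> ring_hom (subring_of (rees w)) ring_of_type_algebra"
proof -
  have "initial w 1 = 1"
    using initial_monomial[of w 1 0 0] by (simp add: laurent_monomial_def)
  then show ?thesis by (intro ring_hom_memI) (auto simp: initial_add initial_mult)
qed

lemma initial_surj: "\<exists>p\<in>rees w. initial w p = f"
proof (induction f rule: poly_mapping_sum_induct)
  case zero
  then show ?case by (intro bexI[of _ 0]) auto
next
  case (add f g)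
  then show ?case using rees_add initial_add by metis
next
  case (single a)
  then show ?case
    by (intro bexI[of _ "laurent_monomial (lookup f a) a (weight w a)"]) (auto simp: initial_monomial intro: rees_monomial)
qed

lemma initial_laurent_var_mult:
  fixes p :: "('n::finite, 'k::field) laurent"
  assumes "p \<in> rees w"
  shows "initial w (laurent_var * p) = 0"
proof -
  have "initial w (laurent_var :: ('n, 'k) laurent) = 0"
    using initial_monomial[of w 1 0 1] by (simp add: laurent_monomial_def laurent_var_def)
  then show ?thesis using assms by (simp add: initial_mult)
qed

text \<open>If no term attains the bound, then, weights being integers, all exponents of
  \<open>t\<close> can be lowered by 1 without leaving the Rees ring.\<close>

lemma initial_eq_zero_imp:
  assumes "p \<in> rees w" "initial w p = 0"
  shows "\<exists>q\<in>rees w. p = laurent_var * q"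
proof
  let ?q = "single (-1) 1 * p"
  show "p = laurent_var * ?q"
    by (simp add: laurent_var_def mult.assoc[symmetric] mult_single)
  have "lookup ?q e = lookup p (e + 1)" for e
    using lookup_single_times(1)[of "-1" 1 p "e + 1"] by simp
  moreover have "weight w a \<le> e" if "a \<in> keys (lookup p (e + 1))" for a e
  proof -
    have "weight w a \<noteq> e + 1"
      using that arg_cong[OF assms(2), of "\<lambda>f. lookup f a"] by (auto simp: lookup_initial in_keys_iff)
    moreover have "weight w a \<le> e + 1" using assms(1) that by (auto simp: rees_def)
    ultimately show ?thesis by simp
  qed
  ultimately show "?q \<in> rees w" by (simp add: rees_def)
qed

lemma laurent_var_power: "laurent_var ^ n = single (int n) 1"
  by (induction n) (auto simp: laurent_var_def mult_single)

lemma lookup_laurent_var_power_mult: "lookup (laurent_var ^ n * p) (int n + e) = lookup p e"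
  unfolding laurent_var_power using lookup_single_times(1)[of "int n" 1 p e] by simp

text \<open>A power of \<open>t\<close> only shifts the coefficients. This yields both the
  regularity of \<open>t\<close> modulo \<open>J[t, 1/t] \<inter> C\<close> and the harmlessness of
  clearing powers of \<open>t\<close>.\<close>

lemma laurent_var_mult_coeffs_in_iff: "laurent_var ^ n * p \<in> coeffs_in J \<longleftrightarrow> p \<in> coeffs_in J"
proof -
  have "lookup (laurent_var ^ n * p) e = lookup p (e - int n)" for e
    using lookup_laurent_var_power_mult[of n p "e - int n"] by simp
  then show ?thesis unfolding coeffs_in_def mem_Collect_eq by (metis add_diff_cancel_right')
qed

text \<open>The coefficient of \<open>t^e\<close> contributes its whole leading part if some of its
  monomials has weight \<open>e\<close>, and otherwise nothing.\<close>

lemma initial_mem: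
  assumes "ideal L ring_of_type_algebra" "leading_part (weight_less w) ` J \<subseteq> L" "p \<in> rees w" "p \<in> coeffs_in J"
  shows "initial w p \<in> L"
proof -
  interpret mon_preorder "weight_less w" by (rule mon_preorder_weight_less)
  have "(\<Sum>a\<in>{a\<in>keys (lookup p e). weight w a = e}. single a (lookup (lookup p e) a)) \<in> L" for e
  proof (cases "{a\<in>keys (lookup p e). weight w a = e} = {}")
    case True
    show ?thesis unfolding True using ideal_type_ring_closed(1)[OF assms(1)] by simp
  next
    case False
    have "(\<Sum>a\<in>{a\<in>keys (lookup p e). weight w a = e}. single a (lookup (lookup p e) a)) = leading_part (weight_less w) (lookup p e)"
      unfolding leading_part_def
    proof (rule sum.cong)
      have le: "weight w a \<le> e" if "a \<in> keys (lookup p e)" for a using assms(3) that by (auto simp: rees_def)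
      obtain a0 where "a0 \<in> keys (lookup p e)" "weight w a0 = e" using False by blast
      then have "weight w a = e \<longleftrightarrow> (\<forall>b\<in>keys (lookup p e). \<not> weight_less w a b)" if "a \<in> keys (lookup p e)" for a
        using le[OF that] le unfolding weight_less_def by (metis linorder_not_less order_antisym)
      then show "{a\<in>keys (lookup p e). weight w a = e} = {a \<in> keys (lookup p e). \<forall>b\<in>keys (lookup p e). \<not> weight_less w a b}"
        by blast
    qed auto
    then show ?thesis using assms(2,4) by (auto simp: coeffs_in_def)
  qed
  then show ?thesis unfolding initial_def by (rule ideal_type_ring_closed(6)[OF assms(1)])
qed

text \<open>The preimage is \<open>f t^d\<close>, where \<open>d\<close> is the greatest weight in
  \<open>f\<close>: the least power of \<open>t\<close> that moves a nonzero \<open>f\<close> into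
  the Rees ring.\<close>

lemma leading_part_eq_initial:
  assumes "ideal J ring_of_type_algebra" "f \<in> J"
  shows "\<exists>p\<in>rees w \<inter> coeffs_in J. initial w p = leading_part (weight_less w) f"
proof (cases "f = 0")
  case True
  then show ?thesis using ideal_type_ring_closed(1)[OF assms(1)]
    by (intro bexI[of _ 0]) (auto simp: leading_part_def coeffs_in_def)
next
  case False
  interpret mon_preorder "weight_less w" by (rule mon_preorder_weight_less)
  define d where "d = Max (weight w ` keys f)"
  have le: "weight w a \<le> d" if "a \<in> keys f" for a unfolding d_def using that by (intro Max_ge) auto
  have "d \<in> weight w ` keys f" unfolding d_def using False by (intro Max_in) auto
  then obtain a0 where a0: "a0 \<in> keys f" "weight w a0 = d" by auto
  show ?thesis
  proof (intro bexI[of _ "single d f"] IntI)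
    show "initial w (single d f) = leading_part (weight_less w) f"
    proof (rule poly_mapping_eqI)
      fix a
      show "lookup (initial w (single d f)) a = lookup (leading_part (weight_less w) f) a"
      proof (cases "a \<in> keys f")
        case True
        then have "weight w a = d \<longleftrightarrow> (\<forall>b\<in>keys f. \<not> weight_less w a b)"
          using le[OF True] le a0 unfolding weight_less_def by (metis linorder_not_less order_antisym)
        then show ?thesis by (auto simp: lookup_initial lookup_leading_part lookup_single when_def)
      next
        case False
        then have "lookup f a = 0" by (simp add: in_keys_iff)
        then show ?thesis by (simp add: lookup_initial lookup_leading_part lookup_single when_def)
      qed
    qed
    show "single d f \<in> rees w" using le by (auto simp: rees_def lookup_single when_def)
    show "single d f \<in> coeffs_in J"
      using assms ideal_type_ring_closed(1) by (auto simp: coeffs_in_def lookup_single when_def)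
  qed
qed

lemma initial_image_ideal:
  assumes "ideal J ring_of_type_algebra"
  shows "ideal (initial w ` (rees w \<inter> coeffs_in J)) ring_of_type_algebra"
proof -
  note J = ideal_type_ring_closed[OF ideal_coeffs_in[OF assms]]
  show ?thesis
    unfolding ideal_type_ring_iff
  proof (intro conjI ballI allI)
    show "0 \<in> initial w ` (rees w \<inter> coeffs_in J)" using J(1) by (intro image_eqI[of _ _ 0]) auto
    fix a assume "a \<in> initial w ` (rees w \<inter> coeffs_in J)"
    then obtain p where p: "a = initial w p" "p \<in> rees w" "p \<in> coeffs_in J" by auto
    show "a + b \<in> initial w ` (rees w \<inter> coeffs_in J)" if "b \<in> initial w ` (rees w \<inter> coeffs_in J)" for b
      using that p by (auto simp: initial_add[symmetric] intro!: imageI rees_add J)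
    fix r :: "('a, 'b) mpoly"
    obtain q where "q \<in> rees w" "initial w q = r" using initial_surj by metis
    then show "r * a \<in> initial w ` (rees w \<inter> coeffs_in J)"
      using p by (auto simp: initial_mult[symmetric] intro!: imageI rees_mult J)
  qed
qed

section \<open>Finite generation of the Rees ring\<close>

lemma ex_option_monomial:
  fixes a :: "'n::finite monomial"
  shows "\<exists>b :: 'n option monomial. Poly_Mapping.map_key Some b = a \<and> lookup b None = m"
proof
  let ?b = "Poly_Mapping.Abs_poly_mapping (case_option m (lookup a))"
  have b: "lookup ?b = case_option m (lookup a)" by (rule lookup_Abs_poly_mapping) simp
  show "Poly_Mapping.map_key Some ?b = a \<and> lookup ?b None = m"
    by (auto intro!: poly_mapping_eqI simp: map_key.rep_eq b)
qed

text \<open>The Rees ring is the image of a polynomial ring with one more variable: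
  \<open>Some i\<close> goes to \<open>x_i t^(w i)\<close> and \<open>None\<close> to
  \<open>t\<close>, because \<open>X^a t^e\<close> is the product of the
  \<open>(x_i t^(w i))^(a_i)\<close> and of \<open>t^(e - w(a))\<close>.\<close>

lemma rees_noetherian: "noetherian_ring (subring_of (rees w :: ('n::finite, 'k::field) laurent set))"
proof -
  define \<mu> :: "'n option monomial \<Rightarrow> int" where "\<mu> b = int (lookup b None) + weight w (Poly_Mapping.map_key Some b)" for b
  define \<phi> :: "('n option, 'k) mpoly \<Rightarrow> ('n, 'k) laurent" where
    "\<phi> F = (\<Sum>b\<in>keys F. laurent_monomial (lookup F b) (Poly_Mapping.map_key Some b) (\<mu> b))" for F
  have \<mu>_add: "\<mu> (a + b) = \<mu> a + \<mu> b" for a b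
    by (simp add: \<mu>_def lookup_add map_key_plus weight_add)
  have \<phi>_add: "\<phi> (F + G) = \<phi> F + \<phi> G" for F G
    unfolding \<phi>_def by (intro setsum_keys_plus_distrib) (auto simp: laurent_monomial_def single_add)
  have \<phi>_single: "\<phi> (single b c) = laurent_monomial c (Poly_Mapping.map_key Some b) (\<mu> b)" for b c
    by (auto simp: \<phi>_def laurent_monomial_def)
  have \<phi>_zero: "\<phi> 0 = 0" by (simp add: \<phi>_def)
  have \<phi>_one: "\<phi> 1 = 1"
    using \<phi>_single[of 0 1] by (simp add: laurent_monomial_def \<mu>_def)
  have 1: "\<phi> (single b c * G) = \<phi> (single b c) * \<phi> G" for b c G
    by (induction G rule: poly_mapping_sum_induct)
      (auto simp: \<phi>_zero \<phi>_add algebra_simps mult_single \<phi>_single laurent_monomial_mult map_key_plus \<mu>_add)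
  have \<phi>_mult: "\<phi> (F * G) = \<phi> F * \<phi> G" for F G
  proof (induction F rule: poly_mapping_sum_induct)
    case (single a)
    show ?case by (rule 1)
  qed (simp_all add: \<phi>_zero \<phi>_add algebra_simps)
  have \<phi>_rees: "\<phi> F \<in> rees w" for F
    by (induction F rule: poly_mapping_sum_induct)
      (auto simp: \<phi>_zero \<phi>_add \<phi>_single \<mu>_def intro!: rees_add rees_monomial)
  have surj: "p \<in> range \<phi>" if "p \<in> rees w" for p
    using that
  proof (induction p rule: rees_induct)
    case (monomial c a e)
    obtain b where "Poly_Mapping.map_key Some b = a \<and> lookup b None = nat (e - weight w a)"
      using ex_option_monomial by metis
    then have "\<phi> (single b c) = laurent_monomial c a e"
      using monomial by (simp add: \<phi>_single \<mu>_def)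
    then show ?case by (metis rangeI)
  next
    case zero
    then show ?case using \<phi>_zero by (metis rangeI)
  next
    case (add p q)
    then obtain F G where "p = \<phi> F" "q = \<phi> G" by blast
    then have "p + q = \<phi> (F + G)" by (simp add: \<phi>_add)
    then show ?case by blast
  qed
  have "frac_hom ring_of_type_algebra {\<one>\<^bsub>ring_of_type_algebra\<^esub>} (subring_of (rees w)) \<phi>"
  proof (rule frac_hom_surj)
    show "\<phi> \<in> ring_hom ring_of_type_algebra (subring_of (rees w))"
      by (intro ring_hom_memI) (auto simp: \<phi>_rees \<phi>_add \<phi>_mult \<phi>_one)
    show "\<phi> ` carrier ring_of_type_algebra = carrier (subring_of (rees w))" using surj \<phi>_rees by auto
  qed (auto intro: rees_cring type_ring_cring)
  then show ?thesis by (rule frac_hom_noetherian) (rule mpoly_noetherian)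
qed

text \<open>The same factorization of \<open>X^a t^e\<close> as for noetherianity. The set
  \<open>W\<close> will be the preimage of a generated subring.\<close>

lemma rees_generators:
  assumes p: "p \<in> rees w" and W: "\<And>p q. p \<in> W \<Longrightarrow> q \<in> W \<Longrightarrow> p + q \<in> W" "\<And>p q. p \<in> W \<Longrightarrow> q \<in> W \<Longrightarrow> p * q \<in> W"
    and const: "\<And>c. laurent_monomial c 0 0 \<in> W" and var: "laurent_var \<in> W"
    and vars: "\<And>i. laurent_monomial 1 (var_monomial i) (w i) \<in> W"
  shows "p \<in> W"
  using p
proof (induction p rule: rees_induct)
  case zero
  show ?case using const[of 0] by (simp add: laurent_monomial_def)
next
  case (add p q)
  then show ?case by (rule W)
next
  case (monomial c a e)
  have mono: "laurent_monomial 1 a (weight w a) \<in> W" for a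
  proof (induction a rule: monomial_induct)
    case zero
    show ?case using const[of 1] by simp
  next
    case (add a i)
    then have "laurent_monomial 1 a (weight w a) * laurent_monomial 1 (var_monomial i) (w i) \<in> W"
      by (intro W(2) vars)
    then show ?case by (simp add: laurent_monomial_mult weight_add weight_var_monomial)
  qed
  have pow: "laurent_monomial 1 0 (int n) \<in> W" for n
  proof (induction n)
    case (Suc n)
    have "laurent_monomial 1 0 (int n) * laurent_var \<in> W" using Suc var by (rule W(2))
    then show ?case by (simp add: laurent_monomial_def laurent_var_def mult_single add.commute)
  qed (use const[of 1] in auto)
  have "laurent_monomial c 0 0 * laurent_monomial 1 0 (int (nat (e - weight w a))) * laurent_monomial 1 a (weight w a) \<in> W"
    by (intro W(2) const pow mono)
  then show ?case using monomial by (simp add: laurent_monomial_mult)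
qed

lemma vars_ideal_eq: "vars_ideal = {f :: ('n::finite, 'k::field) mpoly. lookup f 0 = 0}"
proof
  interpret R: cring "ring_of_type_algebra :: ('n, 'k) mpoly ring" by (rule type_ring_cring)
  have I: "ideal (vars_ideal :: ('n, 'k) mpoly set) ring_of_type_algebra"
    unfolding vars_ideal_def mpoly_ring_def by (rule R.genideal_ideal) simp
  have "ideal {f :: ('n, 'k) mpoly. lookup f 0 = 0} ring_of_type_algebra"
    by (auto simp: ideal_type_ring_iff lookup_add lookup_mult_zero)
  then show "vars_ideal \<subseteq> {f :: ('n, 'k) mpoly. lookup f 0 = 0}"
    unfolding vars_ideal_def mpoly_ring_def
    by (rule R.genideal_minimal) (auto simp: var_def var_monomial_def lookup_single when_def poly_mapping_eq_iff fun_eq_iff)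
  show "{f :: ('n, 'k) mpoly. lookup f 0 = 0} \<subseteq> vars_ideal"
  proof safe
    fix f :: "('n, 'k) mpoly" assume f: "lookup f 0 = 0"
    have "single a (lookup f a) \<in> vars_ideal" if "a \<in> keys f" for a
    proof -
      have "a \<noteq> 0" using f that by (auto simp: in_keys_iff)
      then obtain b i where a: "a = b + var_monomial i" by (rule monomial_split)
      have "var i \<in> (vars_ideal :: ('n, 'k) mpoly set)"
        unfolding vars_ideal_def mpoly_ring_def using R.genideal_self[of "range var"] by auto
      then have "single b (lookup f a) * var i \<in> vars_ideal"
        by (rule ideal_type_ring_closed(3)[OF I])
      then show ?thesis by (simp add: a var_def mult_single)
    qed
    then show "f \<in> vars_ideal"
      using poly_mapping_eq_sum_single[of f] ideal_type_ring_closed(6)[OF I] by metis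
  qed
qed

section \<open>Cardinalities\<close>

text \<open>For lists of one length, iterating an injective pairing is injective; adding the length
  to the code separates lists of different lengths.\<close>

lemma lists_infinite_lepoll:
  assumes "infinite (UNIV :: 'u set)"
  shows "(UNIV :: 'u list set) \<lesssim> (UNIV :: 'u set)"
proof -
  obtain g :: "'u \<times> 'u \<Rightarrow> 'u" where g: "inj g"
    using times_infinite_lepoll[OF lepoll_refl lepoll_refl assms] by (auto simp: lepoll_def)
  obtain z :: "nat \<Rightarrow> 'u" where z: "inj z" using assms by (auto simp: infinite_le_lepoll lepoll_def)
  define enc where "enc xs = foldr (\<lambda>x y. g (x, y)) xs undefined" for xs :: "'u list"
  have enc: "xs = ys" if "length xs = length ys" "enc xs = enc ys" for xs ys
    using that by (induction xs ys rule: list_induct2) (auto simp: enc_def dest: injD[OF g])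
  have "inj (\<lambda>xs. g (z (length xs), enc xs))"
  proof (rule injI)
    fix xs ys assume "g (z (length xs), enc xs) = g (z (length ys), enc ys)"
    then have "z (length xs) = z (length ys)" "enc xs = enc ys" using injD[OF g] by auto
    then show "xs = ys" using enc injD[OF z] by blast
  qed
  then show ?thesis unfolding lepoll_def by blast
qed

text \<open>A finitely supported function is coded by a list enumerating the part of its graph over
  its support; the choice concerns only this enumeration.\<close>

lemma poly_mapping_lepoll:
  assumes "(UNIV :: 'a set) \<lesssim> (UNIV :: 'u set)" "(UNIV :: 'b::zero set) \<lesssim> (UNIV :: 'u set)" "infinite (UNIV :: 'u set)"
  shows "(UNIV :: ('a \<Rightarrow>\<^sub>0 'b) set) \<lesssim> (UNIV :: 'u set)"
proof -
  define f :: "('a \<Rightarrow>\<^sub>0 'b) \<Rightarrow> ('a \<times> 'b) list" where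
    "f p = (SOME xs. set xs = (\<lambda>k. (k, lookup p k)) ` keys p)" for p
  have f: "set (f p) = (\<lambda>k. (k, lookup p k)) ` keys p" for p
    unfolding f_def by (rule someI_ex) (simp add: finite_list)
  have "inj f"
  proof (rule injI, rule poly_mapping_eqI)
    fix p q k assume "f p = f q"
    then have "(\<lambda>k. (k, lookup p k)) ` keys p = (\<lambda>k. (k, lookup q k)) ` keys q" using f by metis
    then have "(k, v) \<in> (\<lambda>k. (k, lookup p k)) ` keys p \<longleftrightarrow> (k, v) \<in> (\<lambda>k. (k, lookup q k)) ` keys q" for v by simp
    then have "k \<in> keys p \<and> v = lookup p k \<longleftrightarrow> k \<in> keys q \<and> v = lookup q k" for v by auto
    then show "lookup p k = lookup q k" by (metis in_keys_iff)
  qed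
  then have "(UNIV :: ('a \<Rightarrow>\<^sub>0 'b) set) \<lesssim> (UNIV :: ('a \<times> 'b) list set)" unfolding lepoll_def by blast
  also have "\<dots> \<lesssim> (UNIV :: 'u list set)"
    using lists_lepoll_mono[OF times_infinite_lepoll[OF assms]] by simp
  also have "\<dots> \<lesssim> (UNIV :: 'u set)" by (rule lists_infinite_lepoll[OF assms(3)])
  finally show ?thesis .
qed

lemma countable_lepoll_infinite:
  assumes "countable A" "infinite (UNIV :: 'u set)"
  shows "A \<lesssim> (UNIV :: 'u set)"
proof -
  have "A \<lesssim> (UNIV :: nat set)" using assms(1) unfolding countable_def lepoll_def by auto
  also have "\<dots> \<lesssim> (UNIV :: 'u set)" using assms(2) by (simp add: infinite_le_lepoll)
  finally show ?thesis .
qed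

lemma mpoly_lepoll:
  assumes "(UNIV :: 'k::field set) \<lesssim> (UNIV :: 'u set)" "infinite (UNIV :: 'u set)"
  shows "(UNIV :: ('n::finite, 'k) mpoly set) \<lesssim> (UNIV :: 'u set)"
proof (rule poly_mapping_lepoll)
  show "(UNIV :: 'n monomial set) \<lesssim> (UNIV :: 'u set)"
    using assms(2) by (intro poly_mapping_lepoll countable_lepoll_infinite) (simp_all add: countable_finite)
qed fact+

lemma laurent_lepoll:
  assumes "(UNIV :: 'k::field set) \<lesssim> (UNIV :: 'u set)" "infinite (UNIV :: 'u set)"
  shows "(UNIV :: ('n::finite, 'k) laurent set) \<lesssim> (UNIV :: 'u set)"
  using assms countable_lepoll_infinite[of "UNIV :: int set"] by (intro poly_mapping_lepoll mpoly_lepoll) auto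

section \<open>Polynomials over a localization\<close>

text \<open>This is \<open>k[X][t]\<close>, realized inside the Laurent polynomials in order to
  intersect it with the Rees ring.\<close>

definition laurent_pos :: "('n, 'k::field) laurent set" where
  "laurent_pos = {p. \<forall>e<0. lookup p e = 0}"

lemma laurent_pos_zero [simp]: "0 \<in> laurent_pos"
  by (simp add: laurent_pos_def)

lemma laurent_pos_add: "p \<in> laurent_pos \<Longrightarrow> q \<in> laurent_pos \<Longrightarrow> p + q \<in> laurent_pos"
  by (simp add: laurent_pos_def lookup_add)

lemma laurent_pos_single: "e \<ge> 0 \<Longrightarrow> single e f \<in> laurent_pos"
  by (simp add: laurent_pos_def lookup_single when_def)

lemma laurent_pos_induct [consumes 1, case_names zero add single]:
  assumes "p \<in> laurent_pos" "P 0" "\<And>p q. P p \<Longrightarrow> P q \<Longrightarrow> P (p + q)" "\<And>e f. e \<ge> 0 \<Longrightarrow> P (single e f)"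
  shows "P p"
proof (induction p rule: poly_mapping_sum_induct)
  case (single e)
  then have "e \<ge> 0" using assms(1) by (auto simp: laurent_pos_def in_keys_iff not_less[symmetric])
  then show ?case by (rule assms(4))
qed (fact assms)+

lemma laurent_pos_mult: "p \<in> laurent_pos \<Longrightarrow> q \<in> laurent_pos \<Longrightarrow> p * q \<in> laurent_pos"
proof (induction p rule: laurent_pos_induct)
  case (single e f)
  from single(2) show ?case
  proof (induction q rule: laurent_pos_induct)
    case (single e' f')
    then show ?case using \<open>e \<ge> 0\<close> by (simp add: mult_single laurent_pos_single)
  qed (auto simp: algebra_simps laurent_pos_add)
qed (auto simp: algebra_simps laurent_pos_add)

lemma laurent_pos_cring: "cring (subring_of laurent_pos)"
proof (rule subring_of_cring)
  show "1 \<in> laurent_pos" using laurent_pos_single[of 0 1] by simp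
  show "a - b \<in> laurent_pos" if "a \<in> laurent_pos" "b \<in> laurent_pos" for a b
    using that by (simp add: laurent_pos_def lookup_minus)
qed (rule laurent_pos_mult)

lemma UP_ops:
  assumes "cring A" "p \<in> carrier (UP A)" "q \<in> carrier (UP A)"
  shows "(p \<oplus>\<^bsub>UP A\<^esub> q) n = p n \<oplus>\<^bsub>A\<^esub> q n" "\<zero>\<^bsub>UP A\<^esub> n = \<zero>\<^bsub>A\<^esub>"
    "a \<in> carrier A \<Longrightarrow> up_ring.monom (UP A) a m n = (if m = n then a else \<zero>\<^bsub>A\<^esub>)"
    "a \<in> carrier A \<Longrightarrow> (up_ring.monom (UP A) a 0 \<otimes>\<^bsub>UP A\<^esub> p) n = a \<otimes>\<^bsub>A\<^esub> p n"
proof -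
  interpret UP_cring A "UP A" by (rule UP_cring.intro) fact
  note coeff = coeff_UP[of _ A]
  show "(p \<oplus>\<^bsub>UP A\<^esub> q) n = p n \<oplus>\<^bsub>A\<^esub> q n"
    using coeff_add[of p q n] assms by (simp add: coeff)
  show "\<zero>\<^bsub>UP A\<^esub> n = \<zero>\<^bsub>A\<^esub>" using coeff_zero[of n] coeff[OF UP_zero_closed, of n] by simp
  show "a \<in> carrier A \<Longrightarrow> up_ring.monom (UP A) a m n = (if m = n then a else \<zero>\<^bsub>A\<^esub>)"
    using coeff_monom[of a m n] by (simp add: coeff)
  show "a \<in> carrier A \<Longrightarrow> (up_ring.monom (UP A) a 0 \<otimes>\<^bsub>UP A\<^esub> p) n = a \<otimes>\<^bsub>A\<^esub> p n"
    using coeff_smult[of a p n] assms by (simp add: monom_mult_is_smult coeff)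
qed

text \<open>Constants suffice as denominators: a polynomial over \<open>B\<close> has finitely many
  coefficients, and these have a common denominator in \<open>S\<close>.\<close>

lemma frac_hom_UP:
  fixes S :: "('n, 'k::field) mpoly set"
  assumes "frac_hom ring_of_type_algebra S B \<beta>"
  shows "frac_hom (subring_of laurent_pos) (single 0 ` S) (UP B) (\<lambda>p n. \<beta> (lookup p (int n)))"
    (is "frac_hom ?D ?S _ ?\<phi>")
proof -
  define h where "h = ?\<phi>"
  have h_apply: "h p n = \<beta> (lookup p (int n))" for p n by (simp add: h_def)
  interpret frac ring_of_type_algebra S B \<beta> by unfold_locales fact
  interpret U: UP_cring B "UP B" by (rule UP_cring.intro) (rule T.is_cring)
  interpret D: cring ?D by (rule laurent_pos_cring)
  note ops = UP_ops[OF T.is_cring]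
  have carr: "carrier (UP B) = up B" by (simp add: UP_def)
  have \<beta>: "\<beta> a \<in> carrier B" "\<beta> (a + b) = \<beta> a \<oplus>\<^bsub>B\<^esub> \<beta> b" "\<beta> (a * b) = \<beta> a \<otimes>\<^bsub>B\<^esub> \<beta> b" "\<beta> 0 = \<zero>\<^bsub>B\<^esub>" "\<beta> 1 = \<one>\<^bsub>B\<^esub>" for a b
    using \<phi>.hom_closed[of a] \<phi>.hom_add[of a b] \<phi>.hom_mult[of a b] \<phi>.hom_zero \<phi>.hom_one by simp_all
  have closed: "h p \<in> carrier (UP B)" for p
    unfolding carr
  proof
    show "h p n \<in> carrier B" for n unfolding h_apply by (rule \<beta>)
    have "bound \<zero>\<^bsub>B\<^esub> (nat (Max (insert 0 (keys p)))) (h p)"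
    proof
      fix m assume m: "nat (Max (insert 0 (keys p))) < m"
      have "int m \<notin> keys p"
      proof
        assume "int m \<in> keys p"
        then have "int m \<le> Max (insert 0 (keys p))" by (intro Max_ge) auto
        then show False using m by simp
      qed
      then show "h p m = \<zero>\<^bsub>B\<^esub>" by (simp add: h_apply in_keys_iff \<beta>)
    qed
    then show "\<exists>n. bound \<zero>\<^bsub>B\<^esub> n (h p)" by blast
  qed
  have add: "h (p + q) = h p \<oplus>\<^bsub>UP B\<^esub> h q" for p q
    by (rule ext) (simp only: ops(1)[OF closed closed] h_apply lookup_add \<beta>)
  have zero: "h 0 = \<zero>\<^bsub>UP B\<^esub>"
    by (rule ext) (simp add: h_apply ops(2)[OF closed closed] \<beta>)
  have single: "h (single e f) = up_ring.monom (UP B) (\<beta> f) (nat e)" if "e \<ge> 0" for e f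
  proof (rule ext)
    fix n
    have "nat e = n \<longleftrightarrow> e = int n" using that by auto
    then show "h (single e f) n = up_ring.monom (UP B) (\<beta> f) (nat e) n"
      using \<beta> by (simp add: h_apply ops(3)[OF closed closed \<beta>(1)] lookup_single when_def)
  qed
  note h_add = add and h_single = single
  have mult: "h (p * q) = h p \<otimes>\<^bsub>UP B\<^esub> h q" if "p \<in> laurent_pos" "q \<in> laurent_pos" for p q
    using that
  proof (induction p rule: laurent_pos_induct)
    case zero
    then show ?case using U.P.l_null[OF closed[of q]] by (simp add: \<open>h 0 = \<zero>\<^bsub>UP B\<^esub>\<close>)
  next
    case (add p p')
    then show ?case using U.P.l_distr[OF closed[of p] closed[of p'] closed[of q]] by (simp add: ring_distribs h_add)
  next
    case (single e f)
    from single(2) show ?case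
    proof (induction q rule: laurent_pos_induct)
      case zero
      then show ?case using U.P.r_null[OF closed] by (simp add: \<open>h 0 = \<zero>\<^bsub>UP B\<^esub>\<close>)
    next
      case (add q q')
      then show ?case using U.P.r_distr[OF closed[of q] closed[of q'] closed[of "single e f"]] by (simp add: ring_distribs h_add)
    next
      case (single e' f')
      have "h (single e f * single e' f') = up_ring.monom (UP B) (\<beta> f \<otimes>\<^bsub>B\<^esub> \<beta> f') (nat e + nat e')"
        using \<open>e \<ge> 0\<close> \<open>e' \<ge> 0\<close> by (simp add: mult_single h_single \<beta> nat_add_distrib)
      also have "\<dots> = h (single e f) \<otimes>\<^bsub>UP B\<^esub> h (single e' f')"
        using \<open>e \<ge> 0\<close> \<open>e' \<ge> 0\<close> by (simp add: h_single \<beta> U.monom_mult)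
      finally show ?case .
    qed
  qed
  have one: "h 1 = \<one>\<^bsub>UP B\<^esub>"
    using single[of 0 1] U.monom_one by (simp add: \<beta>)
  show ?thesis unfolding frac_hom_def h_def[symmetric]
  proof (intro conjI ballI)
    show "h \<in> ring_hom ?D (UP B)"
      by (rule ring_hom_memI) (simp_all add: closed add mult one)
    show "single 0 ` S \<subseteq> carrier ?D" by (auto intro: laurent_pos_single)
    show "\<one>\<^bsub>?D\<^esub> \<in> ?S" using S_one by (auto intro: image_eqI[of _ _ 1])
    fix s t assume "s \<in> ?S" "t \<in> ?S"
    then show "s \<otimes>\<^bsub>?D\<^esub> t \<in> ?S" using S_mult by (auto simp: mult_single intro!: imageI)
  next
    show "h ` ?S \<subseteq> Units (UP B)"
    proof safe
      fix s assume s: "s \<in> S"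
      have "up_ring.monom (UP B) (inv\<^bsub>B\<^esub> (\<beta> s)) 0 \<otimes>\<^bsub>UP B\<^esub> up_ring.monom (UP B) (\<beta> s) 0 = \<one>\<^bsub>UP B\<^esub>"
        using s U.monom_mult[of "inv\<^bsub>B\<^esub> (\<beta> s)" "\<beta> s" 0 0] by (simp add: \<beta> U.monom_one)
      moreover have "up_ring.monom (UP B) (\<beta> s) 0 \<otimes>\<^bsub>UP B\<^esub> up_ring.monom (UP B) (inv\<^bsub>B\<^esub> (\<beta> s)) 0 = \<one>\<^bsub>UP B\<^esub>"
        using s U.monom_mult[of "\<beta> s" "inv\<^bsub>B\<^esub> (\<beta> s)" 0 0] by (simp add: \<beta> U.monom_one)
      ultimately show "h (single 0 s) \<in> Units (UP B)"
        using s single[of 0 s] U.monom_closed[OF \<beta>(1)] U.monom_closed[OF S_inv_closed[OF s]]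
        unfolding Units_def by auto
    qed
    fix P assume P: "P \<in> carrier (UP B)"
    then obtain N where N: "bound \<zero>\<^bsub>B\<^esub> N P" unfolding carr up_def by blast
    have Pn: "P n \<in> carrier B" for n using P mem_upD carr by blast
    \<comment> \<open>A common denominator of the first coefficients is multiplied by a denominator
      of the next one.\<close>
    have "\<exists>s\<in>S. \<forall>i\<le>n. \<exists>a. P i \<otimes>\<^bsub>B\<^esub> \<beta> s = \<beta> a" for n
    proof (induction n)
      case 0
      then show ?case using fraction[OF Pn[of 0]] by (metis le_zero_eq)
    next
      case (Suc n)
      then obtain s where s: "s \<in> S" "\<forall>i\<le>n. \<exists>a. P i \<otimes>\<^bsub>B\<^esub> \<beta> s = \<beta> a" by blast
      obtain b t where t: "t \<in> S" "P (Suc n) \<otimes>\<^bsub>B\<^esub> \<beta> t = \<beta> b" using fraction[OF Pn[of "Suc n"]] by metis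
      have "\<exists>a. P i \<otimes>\<^bsub>B\<^esub> \<beta> (s * t) = \<beta> a" if "i \<le> Suc n" for i
      proof (cases "i = Suc n")
        case True
        have "P i \<otimes>\<^bsub>B\<^esub> \<beta> (s * t) = \<beta> (b * s)"
          using t(2) Pn[of i] \<beta>(1) unfolding \<beta>(3) True by (metis T.m_assoc T.m_comm)
        then show ?thesis by blast
      next
        case False
        then obtain a where "P i \<otimes>\<^bsub>B\<^esub> \<beta> s = \<beta> a" using s(2) \<open>i \<le> Suc n\<close> by (metis le_SucE)
        then have "P i \<otimes>\<^bsub>B\<^esub> \<beta> (s * t) = \<beta> (a * t)"
          using Pn[of i] \<beta>(1) unfolding \<beta>(3) by (metis T.m_assoc)
        then show ?thesis by blast
      qed
      moreover have "s * t \<in> S" using S_mult[OF s(1) t(1)] by simp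
      ultimately show ?case by blast
    qed
    then obtain s where s: "s \<in> S" "\<forall>i\<le>N. \<exists>a. P i \<otimes>\<^bsub>B\<^esub> \<beta> s = \<beta> a" by blast
    then obtain a where a: "\<And>i. i \<le> N \<Longrightarrow> P i \<otimes>\<^bsub>B\<^esub> \<beta> s = \<beta> (a i)" by metis
    define p :: "('n, 'k) laurent" where "p = (\<Sum>i\<le>N. single (int i) (a i))"
    have lookup_p: "lookup p (int n) = (if n \<le> N then a n else 0)" for n
    proof -
      have "lookup p (int n) = (\<Sum>i\<le>N. if i = n then a n else 0)"
        unfolding p_def lookup_sum by (intro sum.cong) (auto simp: lookup_single when_def)
      then show ?thesis by simp
    qed
    have "(\<Sum>i\<in>A. single (int i) (a i)) \<in> laurent_pos" for A
      by (induction A rule: infinite_finite_induct) (simp_all add: laurent_pos_add laurent_pos_single)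
    then have p: "p \<in> laurent_pos" by (simp add: p_def)
    have "P \<otimes>\<^bsub>UP B\<^esub> h (single 0 s) = h p"
    proof (rule ext)
      fix n
      have "(P \<otimes>\<^bsub>UP B\<^esub> h (single 0 s)) n = (up_ring.monom (UP B) (\<beta> s) 0 \<otimes>\<^bsub>UP B\<^esub> P) n"
        using single[of 0 s] U.P.m_comm[OF P U.monom_closed[OF \<beta>(1)]] by simp
      also have "\<dots> = \<beta> s \<otimes>\<^bsub>B\<^esub> P n" by (rule ops(4)[OF P P \<beta>(1)])
      also have "\<dots> = h p n"
      proof (cases "n \<le> N")
        case True
        then show ?thesis using a[OF True] T.m_comm[OF \<beta>(1) Pn, of s n] by (simp add: h_apply lookup_p)
      next
        case False
        then have "P n = \<zero>\<^bsub>B\<^esub>" using bound.bound[OF N] by simp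
        then show ?thesis using False \<beta> T.r_null[OF \<beta>(1)] by (simp add: h_apply lookup_p)
      qed
      finally show "(P \<otimes>\<^bsub>UP B\<^esub> h (single 0 s)) n = h p n" .
    qed
    then show "\<exists>a\<in>carrier ?D. \<exists>s\<in>?S. P \<otimes>\<^bsub>UP B\<^esub> h s = h a"
      using p s(1) by (intro bexI[of _ p] bexI[of _ "single 0 s"]) auto
  qed (auto simp: D.is_cring U.P.is_cring)
qed

section \<open>Passage of primes and generators to rings of fractions\<close>

lemma frac_hom_primeideal:
  assumes "frac_hom R S T \<phi>" "ideal I T" "primeideal Q R" "\<And>c. c \<in> carrier R \<Longrightarrow> \<phi> c \<in> I \<longleftrightarrow> c \<in> Q"
  shows "primeideal I T"
proof -
  interpret frac R S T \<phi> by unfold_locales fact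
  interpret Q: primeideal Q R by fact
  interpret I: ideal I T by fact
  have unit_cancel: "x \<in> I" if "x \<in> carrier T" "s \<in> S" "x \<otimes>\<^bsub>T\<^esub> \<phi> s \<in> I" for x s
  proof -
    have "x \<otimes>\<^bsub>T\<^esub> \<phi> s \<otimes>\<^bsub>T\<^esub> inv\<^bsub>T\<^esub> (\<phi> s) \<in> I" using that by (intro I.I_r_closed[of "x \<otimes>\<^bsub>T\<^esub> \<phi> s"]) auto
    also have "x \<otimes>\<^bsub>T\<^esub> \<phi> s \<otimes>\<^bsub>T\<^esub> inv\<^bsub>T\<^esub> (\<phi> s) = x" using that(1,2) by (simp add: T.m_assoc)
    finally show ?thesis .
  qed
  show ?thesis
  proof (rule primeidealI)
    show "ideal I T" "cring T" by (fact assms, rule T.is_cring)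
    show "carrier T \<noteq> I"
      using assms(4)[of "\<one>\<^bsub>R\<^esub>"] Q.one_imp_carrier Q.I_notcarr by auto
    fix x y assume x: "x \<in> carrier T" and y: "y \<in> carrier T" and xy: "x \<otimes>\<^bsub>T\<^esub> y \<in> I"
    obtain a s where a: "a \<in> carrier R" "s \<in> S" "x \<otimes>\<^bsub>T\<^esub> \<phi> s = \<phi> a" using fraction[OF x] .
    obtain b t where b: "b \<in> carrier R" "t \<in> S" "y \<otimes>\<^bsub>T\<^esub> \<phi> t = \<phi> b" using fraction[OF y] .
    have c: "\<phi> s \<in> carrier T" "\<phi> t \<in> carrier T" using a b by auto
    have "\<phi> (a \<otimes>\<^bsub>R\<^esub> b) = (x \<otimes>\<^bsub>T\<^esub> y) \<otimes>\<^bsub>T\<^esub> (\<phi> s \<otimes>\<^bsub>T\<^esub> \<phi> t)"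
      using fraction_mult[OF a(1) b(1) a(2) b(2) x y a(3) b(3)] a(2) b(2) by simp
    also have "\<dots> \<in> I" using xy c by (intro I.I_r_closed[of "x \<otimes>\<^bsub>T\<^esub> y"]) auto
    finally have "a \<otimes>\<^bsub>R\<^esub> b \<in> Q" using assms(4)[OF R.m_closed[OF a(1) b(1)]] by blast
    then have "\<phi> a \<in> I \<or> \<phi> b \<in> I" using Q.I_prime[OF a(1) b(1)] assms(4) a(1) b(1) by blast
    then show "x \<in> I \<or> y \<in> I" using unit_cancel[OF x a(2)] unit_cancel[OF y b(2)] unfolding a(3) b(3) by blast
  qed
qed

lemma primeideal_image:
  assumes "frac_hom R {\<one>\<^bsub>R\<^esub>} T \<phi>" "primeideal Q R" "\<And>c. c \<in> carrier R \<Longrightarrow> \<phi> c = \<zero>\<^bsub>T\<^esub> \<Longrightarrow> c \<in> Q"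
  shows "primeideal (\<phi> ` Q) T" "\<And>c. c \<in> carrier R \<Longrightarrow> \<phi> c \<in> \<phi> ` Q \<longleftrightarrow> c \<in> Q"
proof -
  interpret frac R "{\<one>\<^bsub>R\<^esub>}" T \<phi> by unfold_locales fact
  interpret Q: primeideal Q R by fact
  have surj: "\<exists>a\<in>carrier R. x = \<phi> a" if "x \<in> carrier T" for x
    using fraction[OF that] that by (metis \<phi>.hom_one T.r_one singletonD)
  show mem: "\<phi> c \<in> \<phi> ` Q \<longleftrightarrow> c \<in> Q" if c: "c \<in> carrier R" for c
  proof
    assume "\<phi> c \<in> \<phi> ` Q"
    then obtain q where q: "q \<in> Q" "\<phi> c = \<phi> q" by blast
    have qc: "q \<in> carrier R" using q(1) by (rule Q.Icarr)
    have "\<phi> (c \<ominus>\<^bsub>R\<^esub> q) = \<zero>\<^bsub>T\<^esub>" using q(2) qc c by (simp add: R.minus_eq T.r_neg)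
    then have "c \<ominus>\<^bsub>R\<^esub> q \<in> Q" using assms(3) c qc by simp
    then have "c \<ominus>\<^bsub>R\<^esub> q \<oplus>\<^bsub>R\<^esub> q \<in> Q" using q(1) by (rule Q.a_closed)
    also have "c \<ominus>\<^bsub>R\<^esub> q \<oplus>\<^bsub>R\<^esub> q = c" using c qc by algebra
    finally show "c \<in> Q" .
  qed simp
  have "ideal (\<phi> ` Q) T"
  proof (rule idealI)
    show "ring T" by (rule T.ring_axioms)
    show "subgroup (\<phi> ` Q) (add_monoid T)"
    proof (rule T.add.subgroupI)
      show "\<phi> ` Q \<subseteq> carrier T" using Q.Icarr by auto
      show "\<phi> ` Q \<noteq> {}" using Q.zero_closed by blast
      fix x assume "x \<in> \<phi> ` Q"
      then obtain q where q: "q \<in> Q" "x = \<phi> q" by blast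
      have "\<ominus>\<^bsub>T\<^esub> x = \<phi> (\<ominus>\<^bsub>R\<^esub> q)" using q Q.Icarr by simp
      then show "\<ominus>\<^bsub>T\<^esub> x \<in> \<phi> ` Q" using Q.a_inv_closed[OF q(1)] by blast
      fix y assume "y \<in> \<phi> ` Q"
      then obtain r where r: "r \<in> Q" "y = \<phi> r" by blast
      have "x \<oplus>\<^bsub>T\<^esub> y = \<phi> (q \<oplus>\<^bsub>R\<^esub> r)" using q r Q.Icarr by simp
      then show "x \<oplus>\<^bsub>T\<^esub> y \<in> \<phi> ` Q" using Q.a_closed[OF q(1) r(1)] by blast
    qed
    fix x y assume "x \<in> \<phi> ` Q" and y: "y \<in> carrier T"
    then obtain q where q: "q \<in> Q" "x = \<phi> q" by blast
    obtain a where a: "a \<in> carrier R" "y = \<phi> a" using surj[OF y] by blast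
    have qc: "q \<in> carrier R" using q(1) by (rule Q.Icarr)
    have "y \<otimes>\<^bsub>T\<^esub> x = \<phi> (a \<otimes>\<^bsub>R\<^esub> q)" using q a qc by simp
    then show "y \<otimes>\<^bsub>T\<^esub> x \<in> \<phi> ` Q" using Q.I_l_closed[OF q(1) a(1)] by blast
    have "x \<otimes>\<^bsub>T\<^esub> y = \<phi> (q \<otimes>\<^bsub>R\<^esub> a)" using q a qc by simp
    then show "x \<otimes>\<^bsub>T\<^esub> y \<in> \<phi> ` Q" using Q.I_r_closed[OF q(1) a(1)] by blast
  qed
  then show "primeideal (\<phi> ` Q) T"
    by (rule frac_hom_primeideal[OF assms(1) _ assms(2)]) (rule mem)
qed

text \<open>A high power of \<open>t\<close> lifts all exponents above 0 and above the weights. So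
  the Rees ring and \<open>k[X][t]\<close> become equal once \<open>t\<close> is inverted. The
  induction treats all sufficiently high powers at once, so that bounds for two summands can be
  combined.\<close>

lemma ex_laurent_var_power_mem:
  fixes p :: "('n::finite, 'k::field) laurent"
  shows "\<exists>N. laurent_var ^ N * p \<in> rees w \<inter> laurent_pos"
proof -
  let ?C = "rees w \<inter> laurent_pos :: ('n, 'k) laurent set"
  have add: "p + q \<in> ?C" if "p \<in> ?C" "q \<in> ?C" for p q
    using that rees_add laurent_pos_add by blast
  have "\<exists>N. \<forall>M\<ge>N. laurent_var ^ M * p \<in> ?C"
  proof (induction p rule: poly_mapping_sum_induct)
    case zero
    show ?case by simp
  next
    case (add p q)
    then obtain N N' where "\<forall>M\<ge>N. laurent_var ^ M * p \<in> ?C" "\<forall>M\<ge>N'. laurent_var ^ M * q \<in> ?C" by blast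
    then show ?case
      by (intro exI[of _ "max N N'"]) (auto simp: ring_distribs rees_add laurent_pos_add)
  next
    case (single e)
    define f where "f = lookup p e"
    have "\<exists>N. \<forall>M\<ge>N. laurent_var ^ M * single e f \<in> ?C"
    proof (induction f rule: poly_mapping_sum_induct)
      case zero
      show ?case by simp
    next
      case (add f g)
      then obtain N N' where "\<forall>M\<ge>N. laurent_var ^ M * single e f \<in> ?C" "\<forall>M\<ge>N'. laurent_var ^ M * single e g \<in> ?C" by blast
      then show ?case
        by (intro exI[of _ "max N N'"]) (auto simp: ring_distribs single_add rees_add laurent_pos_add)
    next
      case (single a)
      have "laurent_var ^ M * single e (single a (lookup f a)) \<in> ?C"
        if "M \<ge> nat (max (- e) (weight w a - e))" for M
      proof -
        have "laurent_var ^ M * single e (single a (lookup f a)) = laurent_monomial (lookup f a) a (int M + e)"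
          by (simp add: laurent_var_power mult_single laurent_monomial_def)
        moreover have "int M + e \<ge> 0" "int M + e \<ge> weight w a" using that by auto
        ultimately show ?thesis
          using rees_monomial[of w a "int M + e" "lookup f a"]
            laurent_pos_single[of "int M + e" "single a (lookup f a)"] by (simp add: laurent_monomial_def)
      qed
      then show ?case by blast
    qed
    then show ?case by (simp add: f_def)
  qed
  then show ?thesis by blast
qed

text \<open>The base field, too, has to be carried by a subset of \<open>'u\<close>, so
  \<open>k\<close> enters through a copy \<open>K\<close>, which \<open>\<phi>'\<close> decodes
  before including the constants. The finite set \<open>F\<close> consists of the images of
  \<open>t\<close> and of the \<open>x_i t^(w i)\<close>.\<close>

lemma fin_gen_rees_quotient:
  fixes \<gamma> :: "('n::finite, 'k::field) laurent \<Rightarrow> 'u"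
  assumes "frac_hom (subring_of (rees w)) {\<one>\<^bsub>subring_of (rees w)\<^esub>} R' \<gamma>" "(UNIV :: 'k set) \<lesssim> (UNIV :: 'u set)"
  shows "fin_gen_algebra_over_field R'"
proof -
  let ?C = "subring_of (rees w :: ('n, 'k) laurent set)"
  interpret frac ?C "{\<one>\<^bsub>?C\<^esub>}" R' \<gamma> by unfold_locales fact
  have k: "field (ring_of_type_algebra :: 'k ring)" by (rule field_from_type_algebra)
  then have kc: "cring (ring_of_type_algebra :: 'k ring)" by (simp add: field_def domain_def)
  obtain K :: "'u ring" and h where K: "cring K" "h \<in> ring_iso (ring_of_type_algebra :: 'k ring) K"
    using ring_iso_copy[OF kc] assms(2) by auto
  interpret K: cring K by fact
  have hK: "h 0 = \<zero>\<^bsub>K\<^esub>"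
    using ring_hom_zero[of h ring_of_type_algebra K] K(2) kc K(1) by (auto simp: ring_iso_def cring_def)
  have "field K"
    using field.ring_iso_imp_img_field[OF k K(2)] hK by simp
  define g where "g = inv_into UNIV h"
  have "ring (ring_of_type_algebra :: 'k ring)" using kc by (simp add: cring_def)
  then have g: "g \<in> ring_iso K (ring_of_type_algebra :: 'k ring)"
    using ring_iso_set_sym[OF _ K(2)] by (simp add: g_def)
  have g_surj: "g ` carrier K = UNIV" using g by (auto simp: ring_iso_def bij_betw_def)
  define const where "const c = laurent_monomial c (0 :: 'n monomial) 0" for c :: 'k
  have const_rees: "const c \<in> rees w" for c unfolding const_def by (rule rees_monomial) simp
  have const_hom: "const \<in> ring_hom ring_of_type_algebra ?C"
    by (rule ring_hom_memI)
      (auto simp: const_rees, auto simp: const_def laurent_monomial_mult, auto simp: laurent_monomial_def single_add)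
  define \<phi>' where "\<phi>' = (\<lambda>x. \<gamma> (const (g x)))"
  have \<phi>'_hom: "\<phi>' \<in> ring_hom K R'"
    using ring_hom_trans[OF ring_hom_trans[OF _ const_hom] \<phi>.homh, of g K] g
    by (simp add: ring_iso_def comp_def \<phi>'_def)
  have \<phi>'_image: "\<phi>' ` carrier K = range (\<lambda>c. \<gamma> (const c))"
    unfolding \<phi>'_def using g_surj by (metis image_image)
  define F where "F = insert (\<gamma> laurent_var) (range (\<lambda>i. \<gamma> (laurent_monomial 1 (var_monomial i) (w i))))"
  have var_rees: "(laurent_monomial 1 (var_monomial i) (w i) :: ('n, 'k) laurent) \<in> rees w" for i
    by (rule rees_monomial) (simp add: weight_var_monomial)
  have F_carrier: "F \<subseteq> carrier R'"
    unfolding F_def using \<phi>.hom_closed[of laurent_var] \<phi>.hom_closed[of "laurent_monomial 1 (var_monomial i) (w i)" for i] var_rees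
    by auto
  let ?G = "generate_ring R' (\<phi>' ` carrier K \<union> F)"
  have sub: "\<phi>' ` carrier K \<union> F \<subseteq> carrier R'"
    using F_carrier \<phi>'_hom by (auto simp: ring_hom_def)
  have "carrier R' \<subseteq> ?G"
  proof
    fix y assume y: "y \<in> carrier R'"
    obtain p s where ps: "p \<in> carrier ?C" "s \<in> {\<one>\<^bsub>?C\<^esub>}" "y \<otimes>\<^bsub>R'\<^esub> \<gamma> s = \<gamma> p" using fraction[OF y] .
    have "\<gamma> s = \<one>\<^bsub>R'\<^esub>" using ps(2) \<phi>.hom_one by blast
    then have p: "p \<in> rees w" "y = \<gamma> p" using ps(1,3) y by simp_all
    define W where "W = {p \<in> rees w. \<gamma> p \<in> ?G}"
    have W_add: "p + q \<in> W" if "p \<in> W" "q \<in> W" for p q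
      using that \<phi>.hom_add[of p q] by (auto simp: W_def rees_add intro: generate_ring.eng_add)
    have W_mult: "p * q \<in> W" if "p \<in> W" "q \<in> W" for p q
      using that \<phi>.hom_mult[of p q] by (auto simp: W_def rees_mult intro: generate_ring.eng_mult)
    have "laurent_monomial c 0 0 \<in> W" for c
      using const_rees[of c] \<phi>'_image by (auto simp: W_def const_def intro!: generate_ring.incl)
    moreover have "laurent_var \<in> W" "laurent_monomial 1 (var_monomial i) (w i) \<in> W" for i
      using var_rees by (auto simp: W_def F_def intro!: generate_ring.incl)
    ultimately have "p \<in> W" using rees_generators[OF p(1), of W] W_add W_mult by blast
    then show "y \<in> ?G" using p(2) by (simp add: W_def)
  qed
  moreover have "?G \<subseteq> carrier R'" by (rule T.generate_ring_incl[OF sub])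
  ultimately have "?G = carrier R'" by blast
  moreover have "finite F" by (simp add: F_def)
  ultimately show ?thesis
    unfolding fin_gen_algebra_over_field_def using T.is_cring \<open>field K\<close> \<phi>'_hom F_carrier by blast
qed

text \<open>Finitely many coefficients are involved, and the product of their individual multipliers
  stays outside the prime \<open>Q\<close>. This trades multipliers for the coefficients for one
  constant multiplier of the whole polynomial.\<close>

lemma ex_common_annihilator:
  fixes x :: "'a \<Rightarrow>\<^sub>0 'b::comm_ring_1"
  assumes J: "ideal J ring_of_type_algebra"
    and Q: "1 \<notin> Q" "\<And>a b. a * b \<in> Q \<Longrightarrow> a \<in> Q \<or> b \<in> Q"
    and ex: "\<And>e. e \<in> keys x \<Longrightarrow> \<exists>s. s \<notin> Q \<and> s * lookup x e \<in> J"
  shows "\<exists>s. s \<notin> Q \<and> (\<forall>e. s * lookup x e \<in> J)"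
proof -
  have "\<exists>s. s \<notin> Q \<and> (\<forall>e\<in>A. s * lookup x e \<in> J)" if "A \<subseteq> keys x" for A
    using finite_subset[OF that finite_keys] that
  proof (induction A)
    case empty
    then show ?case using Q(1) by auto
  next
    case (insert e A)
    then obtain s where s: "s \<notin> Q" "\<forall>e\<in>A. s * lookup x e \<in> J" by auto
    obtain t where t: "t \<notin> Q" "t * lookup x e \<in> J" using ex[of e] insert.prems by auto
    have "s * t * lookup x e \<in> J" using ideal_type_ring_closed(3)[OF J t(2), of s] by (simp add: mult.assoc)
    moreover have "s * t * lookup x d \<in> J" if "d \<in> A" for d
      using ideal_type_ring_closed(3)[OF J, of "s * lookup x d" t] s(2) that by (simp add: mult_ac)
    ultimately show ?case using Q(2)[of s t] s(1) t(1) by (intro exI[of _ "s * t"]) auto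
  qed
  then obtain s where s: "s \<notin> Q" "\<forall>e\<in>keys x. s * lookup x e \<in> J" by blast
  have "s * lookup x e \<in> J" for e
    using s(2) ideal_type_ring_closed(1)[OF J] by (cases "e \<in> keys x") (auto simp: in_keys_iff)
  then show ?thesis using s(1) by blast
qed

lemma primeideal_type_ring_iff:
  fixes Q :: "'a::comm_ring_1 set"
  shows "primeideal Q ring_of_type_algebra \<longleftrightarrow> ideal Q ring_of_type_algebra \<and> 1 \<notin> Q \<and> (\<forall>a b. a * b \<in> Q \<longrightarrow> a \<in> Q \<or> b \<in> Q)"
proof
  assume "primeideal Q ring_of_type_algebra"
  then interpret primeideal Q ring_of_type_algebra .
  have "1 \<notin> Q" using I_notcarr one_imp_carrier by auto
  then show "ideal Q ring_of_type_algebra \<and> 1 \<notin> Q \<and> (\<forall>a b. a * b \<in> Q \<longrightarrow> a \<in> Q \<or> b \<in> Q)"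
    using is_ideal I_prime by simp
next
  assume "ideal Q ring_of_type_algebra \<and> 1 \<notin> Q \<and> (\<forall>a b. a * b \<in> Q \<longrightarrow> a \<in> Q \<or> b \<in> Q)"
  then show "primeideal Q ring_of_type_algebra"
    by (intro primeidealI type_ring_cring) auto
qed

section \<open>The degeneration of \<open>k[X]/J\<close> to \<open>k[X]/L\<close>\<close>

locale degeneration =
  fixes w :: "'n::finite \<Rightarrow> int" and J Q L :: "('n, 'k::field) mpoly set"
  assumes ideal_J: "ideal J ring_of_type_algebra" and ideal_L: "ideal L ring_of_type_algebra"
    and prime_Q: "primeideal Q ring_of_type_algebra" and J_Q: "J \<subseteq> Q"
    and leading_J: "\<And>f. f \<in> J \<Longrightarrow> leading_part (weight_less w) f \<in> L"
    and L_leading: "L \<subseteq> Idl\<^bsub>ring_of_type_algebra\<^esub> (leading_part (weight_less w) ` J)"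
    and leading_Q: "\<And>f. f \<in> Q \<Longrightarrow> lookup (leading_part (weight_less w) f) 0 = 0"
    and L_vars: "L \<subseteq> vars_ideal"
begin

abbreviation "C \<equiv> subring_of (rees w :: ('n, 'k) laurent set)"

definition "J_rees = rees w \<inter> coeffs_in J"
definition "Q_rees = rees w \<inter> coeffs_in Q"
text \<open>The origin of the special fibre: the preimage of \<open>(X)\<close> under reduction
  modulo \<open>t\<close>.\<close>

definition "M_rees = {p \<in> rees w. lookup (initial w p :: ('n, 'k) mpoly) 0 = 0}"

lemma Q_props: "ideal Q ring_of_type_algebra" "1 \<notin> Q" "\<And>a b. a * b \<in> Q \<Longrightarrow> a \<in> Q \<or> b \<in> Q"
  using prime_Q by (auto simp: primeideal_type_ring_iff)

lemma coeffs_in_Q_prime: "p * q \<in> coeffs_in Q \<Longrightarrow> p \<in> coeffs_in Q \<or> q \<in> coeffs_in Q"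
  by (rule coeffs_in_prime[OF Q_props(1,3)])

lemma one_coeffs_in_Q: "1 \<notin> coeffs_in Q"
  using Q_props(2) by (auto simp: coeffs_in_def intro!: exI[of _ 0])

lemma ideal_J_rees: "ideal J_rees C"
  using ideal_type_ring_closed[OF ideal_coeffs_in[OF ideal_J]]
  by (intro ideal_subring_of rees_cring) (auto simp: J_rees_def rees_add rees_mult)

lemma prime_Q_rees: "primeideal Q_rees C"
proof (rule primeideal_subring_of[OF rees_cring])
  show "ideal Q_rees C"
    using ideal_type_ring_closed[OF ideal_coeffs_in[OF Q_props(1)]]
    by (intro ideal_subring_of rees_cring) (auto simp: Q_rees_def rees_add rees_mult)
qed (use one_coeffs_in_Q coeffs_in_Q_prime in \<open>auto simp: Q_rees_def\<close>)

lemma prime_M_rees: "primeideal M_rees C"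
proof (rule primeideal_subring_of[OF rees_cring])
  show "ideal M_rees C"
    by (intro ideal_subring_of rees_cring)
      (auto simp: M_rees_def rees_add rees_mult initial_add initial_mult lookup_add lookup_mult_zero)
  show "1 \<notin> M_rees"
    by (simp add: M_rees_def lookup_initial)
qed (auto simp: M_rees_def initial_mult lookup_mult_zero)

text \<open>The constant term of \<open>initial w p\<close> comes from the coefficient of
  \<open>t^0\<close>, all of whose monomials have weight at most 0. There 1 is maximal, so this
  constant term already appears in the leading part of an element of \<open>Q\<close>.\<close>

lemma Q_rees_subset_M_rees: "Q_rees \<subseteq> M_rees"
proof
  fix p assume "p \<in> Q_rees"
  then have p: "p \<in> rees w" "lookup p 0 \<in> Q" by (auto simp: Q_rees_def coeffs_in_def)
  interpret mon_preorder "weight_less w" by (rule mon_preorder_weight_less)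
  have "\<forall>b\<in>keys (lookup p 0). \<not> weight_less w 0 b"
    using p(1) by (force simp: rees_def weight_less_def)
  then have "lookup (leading_part (weight_less w) (lookup p 0)) 0 = lookup (lookup p 0) 0"
    by (simp add: lookup_leading_part)
  then show "p \<in> M_rees" using p leading_Q by (simp add: M_rees_def lookup_initial)
qed

lemma J_rees_subset_Q_rees: "J_rees \<subseteq> Q_rees"
  using J_Q by (auto simp: J_rees_def Q_rees_def coeffs_in_def)

lemma initial_J_rees: "initial w ` J_rees = L"
proof
  show "initial w ` J_rees \<subseteq> L"
    using initial_mem[OF ideal_L, of w J] leading_J by (auto simp: J_rees_def)
  interpret R: cring "ring_of_type_algebra :: ('n, 'k) mpoly ring" by (rule type_ring_cring)
  have "Idl\<^bsub>ring_of_type_algebra\<^esub> (leading_part (weight_less w) ` J) \<subseteq> initial w ` J_rees"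
    unfolding J_rees_def
  proof (rule R.genideal_minimal[OF initial_image_ideal[OF ideal_J]])
    show "leading_part (weight_less w) ` J \<subseteq> initial w ` (rees w \<inter> coeffs_in J)"
      using leading_part_eq_initial[OF ideal_J] by (force simp: image_iff)
  qed
  with L_leading show "L \<subseteq> initial w ` J_rees" by blast
qed

lemma laurent_var_M_rees: "laurent_var \<in> M_rees"
  using initial_laurent_var_mult[of "1 :: ('n, 'k) laurent" w] by (simp add: M_rees_def)

lemma laurent_var_not_Q: "laurent_var ^ n \<notin> coeffs_in Q"
  using laurent_var_mult_coeffs_in_iff[of n 1 Q] one_coeffs_in_Q by simp

lemma laurent_var_mult_J_rees: "p \<in> rees w \<Longrightarrow> s * (laurent_var * p) \<in> J_rees \<Longrightarrow> s * p \<in> coeffs_in J"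
  using laurent_var_mult_coeffs_in_iff[of 1 "s * p" J] by (simp add: J_rees_def mult_ac)

text \<open>Both sides are rings of fractions of \<open>C\<close> with denominators outside
  \<open>M_rees\<close>. Their kernels agree because \<open>initial\<close> maps
  \<open>J_rees\<close> onto \<open>L\<close> and has kernel \<open>tC\<close>.\<close>

lemma special_fibre:
  assumes "frac_hom C (rees w - M_rees) A \<alpha>"
    and ker: "\<And>a. a \<in> rees w \<Longrightarrow> \<alpha> a = \<zero>\<^bsub>A\<^esub> \<longleftrightarrow> (\<exists>s\<in>rees w. s \<notin> M_rees \<and> s * a \<in> J_rees)"
  shows "localization_at (ring_of_type_algebra Quot L) (quot_ideal ring_of_type_algebra vars_ideal L)
    \<simeq> A Quot (PIdl\<^bsub>A\<^esub> (\<alpha> laurent_var))"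
proof -
  interpret frac C "rees w - M_rees" A \<alpha> by unfold_locales fact
  let ?R = "ring_of_type_algebra :: ('n, 'k) mpoly ring"
  let ?proj = "\<lambda>x. L +>\<^bsub>?R\<^esub> x"
  let ?V = "quot_ideal ?R vars_ideal L"
  have \<alpha>: "\<alpha> p \<in> carrier A" if "p \<in> rees w" for p using \<phi>.hom_closed[of p] that by simp
  have \<alpha>_mult: "\<alpha> (p * q) = \<alpha> p \<otimes>\<^bsub>A\<^esub> \<alpha> q" and \<alpha>_add: "\<alpha> (p + q) = \<alpha> p \<oplus>\<^bsub>A\<^esub> \<alpha> q" if "p \<in> rees w" "q \<in> rees w" for p q
    using \<phi>.hom_mult[of p q] \<phi>.hom_add[of p q] that by simp_all
  have "frac_hom ?R {\<one>\<^bsub>?R\<^esub>} ?R (\<lambda>x. x)"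
    by (rule frac_hom_surj) (auto simp: type_ring_cring intro: ring_hom_memI)
  note proj = frac_hom_quotient[OF this ideal_L]
  have "primeideal vars_ideal ?R"
    unfolding primeideal_type_ring_iff
    by (simp add: ideal_type_ring_iff vars_ideal_eq lookup_add lookup_mult_zero)
  moreover have "c \<in> vars_ideal" if "?proj c = \<zero>\<^bsub>?R Quot L\<^esub>" for c
    using proj(2)[of c] that L_vars by auto
  ultimately have V: "primeideal (?proj ` vars_ideal) (?R Quot L)" "?proj c \<in> ?proj ` vars_ideal \<longleftrightarrow> c \<in> vars_ideal" for c
    using primeideal_image[OF proj(1), of vars_ideal] by auto
  have V_prime: "primeideal ?V (?R Quot L)" and V_mem: "?proj x \<in> ?V \<longleftrightarrow> x \<in> vars_ideal" for x
    using V by (simp_all add: quot_ideal_def)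
  have "initial w ` rees w = (UNIV :: ('n, 'k) mpoly set)"
    using initial_surj[of w] by (metis UNIV_eq_I image_eqI)
  then have "frac_hom C {\<one>\<^bsub>C\<^esub>} ?R (initial w)"
    by (intro frac_hom_surj rees_cring type_ring_cring initial_hom) simp
  note init = frac_hom_quotient[OF this ideal_L]
  note loc = frac_hom_localization_at[OF init(1) V_prime]
  have set_eq: "{c \<in> carrier C. ?proj (initial w c) \<notin> ?V} = rees w - M_rees"
    unfolding V_mem by (auto simp: M_rees_def vars_ideal_eq)
  have tA: "\<alpha> laurent_var \<in> carrier A" by (rule \<alpha>) simp
  note quot = frac_hom_quotient[OF frac T.cgenideal_ideal[OF tA]]
  show ?thesis
  proof (rule frac_hom_imp_ring_iso[OF loc(1)[unfolded set_eq] quot(1)])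
    fix a assume "a \<in> carrier C"
    then have a: "a \<in> rees w" by simp
    have "(fraction_of (?R Quot L) (carrier (?R Quot L) - ?V) (?proj (initial w a)) \<one>\<^bsub>?R Quot L\<^esub> = \<zero>\<^bsub>localization_at (?R Quot L) ?V\<^esub>)
      \<longleftrightarrow> (\<exists>s\<in>rees w. s \<notin> M_rees \<and> initial w (s * a) \<in> L)"
      unfolding loc(2)[OF \<open>a \<in> carrier C\<close>]
    proof -
      have "(?proj (initial w s) \<notin> ?V \<and> ?proj (initial w (s \<otimes>\<^bsub>C\<^esub> a)) = \<zero>\<^bsub>?R Quot L\<^esub>) \<longleftrightarrow> (s \<notin> M_rees \<and> initial w (s * a) \<in> L)"
        if s: "s \<in> rees w" for s
        unfolding V_mem using init(2)[of "s \<otimes>\<^bsub>C\<^esub> a"] rees_mult[OF s a] s by (auto simp: M_rees_def vars_ideal_eq)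
      then show "(\<exists>s\<in>carrier C. ?proj (initial w s) \<notin> ?V \<and> ?proj (initial w (s \<otimes>\<^bsub>C\<^esub> a)) = \<zero>\<^bsub>?R Quot L\<^esub>)
        \<longleftrightarrow> (\<exists>s\<in>rees w. s \<notin> M_rees \<and> initial w (s * a) \<in> L)" by simp
    qed
    also have "\<dots> \<longleftrightarrow> \<alpha> a \<in> PIdl\<^bsub>A\<^esub> (\<alpha> laurent_var)"
    proof
      assume "\<exists>s\<in>rees w. s \<notin> M_rees \<and> initial w (s * a) \<in> L"
      then obtain s where s: "s \<in> rees w" "s \<notin> M_rees" "initial w (s * a) \<in> L" by blast
      \<comment> \<open>The initial form of \<open>s * a\<close> is lifted to \<open>J_rees\<close>;
        what is left over has initial form 0 and is therefore a multiple of
        \<open>t\<close>.\<close>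
      from s(3) obtain j where j: "j \<in> J_rees" "initial w (s * a) = initial w j"
        unfolding initial_J_rees[symmetric] by blast
      have jr: "j \<in> rees w" using j(1) by (simp add: J_rees_def)
      have "s * a - j \<in> rees w" using rees_add[OF rees_mult[OF s(1) a] rees_uminus[OF jr]] by simp
      moreover have "initial w (s * a - j) = 0" using j(2) by (simp add: initial_diff)
      ultimately obtain c where c: "c \<in> rees w" "s * a - j = laurent_var * c" using initial_eq_zero_imp by blast
      have "\<alpha> j = \<zero>\<^bsub>A\<^esub>"
        using ker[OF jr] j(1) primeideal.I_notcarr[OF prime_M_rees] S_one by (force intro: bexI[of _ 1])
      moreover have "s * a = laurent_var * c + j" using c(2) by (simp add: algebra_simps)
      ultimately have "\<alpha> s \<otimes>\<^bsub>A\<^esub> \<alpha> a = \<alpha> laurent_var \<otimes>\<^bsub>A\<^esub> \<alpha> c"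
        using \<alpha>_mult[OF s(1) a] \<alpha>_add[OF rees_mult[OF laurent_var_rees c(1)] jr] \<alpha>_mult[OF laurent_var_rees c(1)] \<alpha>[OF c(1)] tA by simp
      moreover have sS: "s \<in> rees w - M_rees" using s by blast
      then have "\<alpha> a = inv\<^bsub>A\<^esub> (\<alpha> s) \<otimes>\<^bsub>A\<^esub> (\<alpha> s \<otimes>\<^bsub>A\<^esub> \<alpha> a)"
        using \<alpha>[OF s(1)] \<alpha>[OF a] S_inv_closed[OF sS] S_inv(2)[OF sS] by (simp add: T.m_assoc[symmetric])
      ultimately have "\<alpha> a = (inv\<^bsub>A\<^esub> (\<alpha> s) \<otimes>\<^bsub>A\<^esub> \<alpha> c) \<otimes>\<^bsub>A\<^esub> \<alpha> laurent_var"
        using tA \<alpha>[OF c(1)] S_inv_closed[OF sS] by (simp add: T.m_ac)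
      then show "\<alpha> a \<in> PIdl\<^bsub>A\<^esub> (\<alpha> laurent_var)"
        unfolding cgenideal_def using \<alpha>[OF c(1)] S_inv_closed[OF sS] by blast
    next
      assume "\<alpha> a \<in> PIdl\<^bsub>A\<^esub> (\<alpha> laurent_var)"
      then obtain x where x: "x \<in> carrier A" "\<alpha> a = x \<otimes>\<^bsub>A\<^esub> \<alpha> laurent_var" unfolding cgenideal_def by blast
      obtain b s where "b \<in> carrier C" "s \<in> rees w - M_rees" and xs: "x \<otimes>\<^bsub>A\<^esub> \<alpha> s = \<alpha> b" using fraction[OF x(1)] .
      then have b: "b \<in> rees w" and s: "s \<in> rees w" "s \<notin> M_rees" by auto
      \<comment> \<open>Clearing the denominator of \<open>x\<close> shows that
        \<open>a * s - b * t\<close> lies in \<open>J_rees\<close> after multiplication by some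
        \<open>r\<close> outside \<open>M_rees\<close>. Taking initial forms removes the multiple of
        \<open>t\<close>.\<close>
      have "\<alpha> (a * s) = \<alpha> (b * laurent_var)"
        using \<alpha>_mult[OF a s(1)] \<alpha>_mult[OF b laurent_var_rees] x(1) tA \<alpha>[OF s(1)]
        by (simp add: x(2) xs[symmetric] T.m_ac)
      moreover have as: "a * s \<in> rees w" and bt: "- (b * laurent_var) \<in> rees w" and bt': "b * laurent_var \<in> rees w"
        by (intro rees_mult rees_uminus a b s laurent_var_rees)+
      have "\<alpha> (b * laurent_var) \<oplus>\<^bsub>A\<^esub> \<alpha> (- (b * laurent_var)) = \<zero>\<^bsub>A\<^esub>"
        using \<alpha>_add[OF bt' bt] \<phi>.hom_zero by simp
      ultimately have "\<alpha> (a * s + - (b * laurent_var)) = \<zero>\<^bsub>A\<^esub>" using \<alpha>_add[OF as bt] by simp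
      then obtain r where r: "r \<in> rees w" "r \<notin> M_rees" "r * (a * s + - (b * laurent_var)) \<in> J_rees"
        using ker[OF rees_add[OF as bt]] by blast
      have "initial w (r * (a * s + - (b * laurent_var))) = initial w (r * (a * s) - laurent_var * (r * b))"
        by (simp add: algebra_simps)
      also have "\<dots> = initial w ((r * s) * a)"
        using initial_laurent_var_mult[OF rees_mult[OF r(1) b]] by (simp add: initial_diff mult_ac)
      finally have "initial w ((r * s) * a) \<in> L" using r(3) initial_J_rees by (metis imageI)
      moreover have "r * s \<notin> M_rees"
        using r s by (auto simp: M_rees_def initial_mult lookup_mult_zero)
      ultimately show "\<exists>s\<in>rees w. s \<notin> M_rees \<and> initial w (s * a) \<in> L" using rees_mult[OF r(1) s(1)] by blast
    qed
    also have "\<dots> \<longleftrightarrow> (PIdl\<^bsub>A\<^esub> (\<alpha> laurent_var) +>\<^bsub>A\<^esub> \<alpha> a = \<zero>\<^bsub>A Quot (PIdl\<^bsub>A\<^esub> (\<alpha> laurent_var))\<^esub>)"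
      by (rule quot(2)[OF \<open>a \<in> carrier C\<close>, symmetric])
    finally show "(fraction_of (?R Quot L) (carrier (?R Quot L) - ?V) (?proj (initial w a)) \<one>\<^bsub>?R Quot L\<^esub> = \<zero>\<^bsub>localization_at (?R Quot L) ?V\<^esub>)
      \<longleftrightarrow> (PIdl\<^bsub>A\<^esub> (\<alpha> laurent_var) +>\<^bsub>A\<^esub> \<alpha> a = \<zero>\<^bsub>A Quot (PIdl\<^bsub>A\<^esub> (\<alpha> laurent_var))\<^esub>)" .
  qed
qed

text \<open>Both rings are rings of fractions of \<open>C \<inter> k[X][t]\<close>, because \<open>t\<close> is invertible in both.\<close>

lemma generic_fibre:
  assumes "frac_hom C (rees w - Q_rees) N \<nu>"
    and kerN: "\<And>a. a \<in> rees w \<Longrightarrow> \<nu> a = \<zero>\<^bsub>N\<^esub> \<longleftrightarrow> (\<exists>s\<in>rees w. s \<notin> Q_rees \<and> s * a \<in> J_rees)"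
    and "frac_hom ring_of_type_algebra (UNIV - Q) B \<beta>"
    and kerB: "\<And>a. \<beta> a = \<zero>\<^bsub>B\<^esub> \<longleftrightarrow> (\<exists>s. s \<notin> Q \<and> s * a \<in> J)"
    and "ideal m B" and m: "\<And>a. \<beta> a \<in> m \<longleftrightarrow> a \<in> Q"
  shows "N \<simeq> localization_at (UP B) (extend_to_UP B m)"
proof -
  interpret B: frac ring_of_type_algebra "UNIV - Q" B \<beta> by unfold_locales fact
  let ?D = "subring_of (laurent_pos :: ('n, 'k) laurent set)"
  let ?ext = "extend_to_UP B m"
  note ext = extend_to_UP_eq[OF B.T.is_cring \<open>ideal m B\<close>]
  define h where "h = (\<lambda>(p :: ('n, 'k) laurent) n. \<beta> (lookup p (int n)))"
  have D: "frac_hom ?D (single 0 ` (UNIV - Q)) (UP B) h"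
    unfolding h_def by (rule frac_hom_UP) fact
  interpret D: frac ?D "single 0 ` (UNIV - Q)" "UP B" h by unfold_locales fact
  \<comment> \<open>Polynomials over \<open>B\<close> are indexed by natural numbers, Laurent
    polynomials by integers; the coefficients at negative exponents are 0 and lie in
    \<open>K\<close> anyway.\<close>
  have nonneg: "(\<forall>n. lookup p (int n) \<in> K) \<longleftrightarrow> (\<forall>e. lookup p e \<in> K)" if "p \<in> laurent_pos" "0 \<in> K" for p :: "('n, 'k) laurent" and K
    using that unfolding laurent_pos_def by (metis (mono_tags, lifting) mem_Collect_eq nonneg_int_cases not_le)
  have h_ext: "h p \<in> ?ext \<longleftrightarrow> p \<in> coeffs_in Q" if "p \<in> laurent_pos" for p
    using D.\<phi>.hom_closed[of p] that nonneg[OF that ideal_type_ring_closed(1)[OF Q_props(1)]]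
    by (simp add: ext(1) coeffs_in_def m h_def)
  \<comment> \<open>Each coefficient dies in \<open>B\<close> with a multiplier of its own;
    \<open>ex_common_annihilator\<close> makes it one \<open>u\<close> for all.\<close>
  have h_zero: "h p = \<zero>\<^bsub>UP B\<^esub> \<longleftrightarrow> (\<exists>u. u \<notin> Q \<and> single 0 u * p \<in> coeffs_in J)" if p: "p \<in> laurent_pos" for p
  proof -
    have "h p = \<zero>\<^bsub>UP B\<^esub> \<longleftrightarrow> (\<forall>n. \<beta> (lookup p (int n)) = \<zero>\<^bsub>B\<^esub>)"
      using UP_ops(2)[OF B.T.is_cring, of "\<zero>\<^bsub>UP B\<^esub>" "\<zero>\<^bsub>UP B\<^esub>"] by (auto simp: h_def fun_eq_iff)
    also have "\<dots> \<longleftrightarrow> (\<forall>n. lookup p (int n) \<in> {a. \<exists>s. s \<notin> Q \<and> s * a \<in> J})" by (simp add: kerB)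
    also have "\<dots> \<longleftrightarrow> (\<forall>e. lookup p e \<in> {a. \<exists>s. s \<notin> Q \<and> s * a \<in> J})"
      using ideal_type_ring_closed(1)[OF ideal_J] Q_props(2) by (intro nonneg[OF p]) auto
    also have "\<dots> \<longleftrightarrow> (\<exists>u. u \<notin> Q \<and> (\<forall>e. u * lookup p e \<in> J))"
      using ex_common_annihilator[OF ideal_J Q_props(2,3), of p] by blast
    finally show ?thesis by (simp add: coeffs_in_def)
  qed
  have "primeideal (laurent_pos \<inter> coeffs_in Q) ?D"
  proof (rule primeideal_subring_of[OF laurent_pos_cring])
    show "ideal (laurent_pos \<inter> coeffs_in Q) ?D"
      using ideal_type_ring_closed[OF ideal_coeffs_in[OF Q_props(1)]]
      by (intro ideal_subring_of laurent_pos_cring) (auto simp: laurent_pos_add laurent_pos_mult)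
  qed (use one_coeffs_in_Q coeffs_in_Q_prime in auto)
  then have ext_prime: "primeideal ?ext (UP B)"
    by (rule frac_hom_primeideal[OF D ext(2)]) (simp add: h_ext)
  define \<upsilon> where "\<upsilon> = (\<lambda>p. fraction_of (UP B) (carrier (UP B) - ?ext) (h p) \<one>\<^bsub>UP B\<^esub>)"
  have U: "frac_hom ?D (laurent_pos - coeffs_in Q) (localization_at (UP B) ?ext) \<upsilon>"
  proof -
    have "{c \<in> carrier ?D. h c \<notin> ?ext} = laurent_pos - coeffs_in Q" using h_ext by auto
    then show ?thesis using frac_hom_localization_at(1)[OF D ext_prime] by (simp add: \<upsilon>_def)
  qed
  have kerU: "\<upsilon> a = \<zero>\<^bsub>localization_at (UP B) ?ext\<^esub> \<longleftrightarrow>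
      (\<exists>s\<in>laurent_pos. s \<notin> coeffs_in Q \<and> (\<exists>u. u \<notin> Q \<and> single 0 u * (s * a) \<in> coeffs_in J))"
    if a: "a \<in> laurent_pos" for a
  proof -
    have "\<upsilon> a = \<zero>\<^bsub>localization_at (UP B) ?ext\<^esub> \<longleftrightarrow> (\<exists>s\<in>laurent_pos. h s \<notin> ?ext \<and> h (s * a) = \<zero>\<^bsub>UP B\<^esub>)"
      using frac_hom_localization_at(2)[OF D ext_prime, of a] a by (simp add: \<upsilon>_def)
    also have "\<dots> \<longleftrightarrow> (\<exists>s\<in>laurent_pos. s \<notin> coeffs_in Q \<and> (\<exists>u. u \<notin> Q \<and> single 0 u * (s * a) \<in> coeffs_in J))"
      by (intro bex_cong refl) (simp only: h_ext h_zero[OF laurent_pos_mult[OF _ a]])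
    finally show ?thesis .
  qed
  let ?C0 = "rees w \<inter> laurent_pos :: ('n, 'k) laurent set"
  have C0: "cring (subring_of ?C0)"
  proof (rule subring_of_cring)
    show "1 \<in> ?C0" using laurent_pos_single[of 0 1] by simp
    show "a - b \<in> ?C0" if "a \<in> ?C0" "b \<in> ?C0" for a b
      using that rees_add[of a w "- b"] rees_uminus[of b w] by (auto simp: laurent_pos_def lookup_minus)
  qed (auto intro: rees_mult laurent_pos_mult)
  have power_C0: "laurent_var ^ n \<in> ?C0" for n
    using rees_monomial[of w 0 "int n" 1] laurent_pos_single[of "int n" 1] by (simp add: laurent_var_power laurent_monomial_def)
  have r1: "frac_hom (subring_of ?C0) ((rees w - Q_rees) \<inter> ?C0) N \<nu>"
  proof -
    have "frac_hom (C\<lparr>carrier := ?C0\<rparr>) ((rees w - Q_rees) \<inter> ?C0) N \<nu>"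
    proof (rule frac_hom_restrict[OF assms(1)])
      fix a :: "('n, 'k) laurent"
      obtain k where "laurent_var ^ k * a \<in> ?C0" using ex_laurent_var_power_mem by blast
      then show "\<exists>v\<in>(rees w - Q_rees) \<inter> ?C0. v \<otimes>\<^bsub>C\<^esub> a \<in> ?C0"
        using power_C0[of k] laurent_var_not_Q[of k] by (intro bexI[of _ "laurent_var ^ k"]) (auto simp: Q_rees_def)
    qed (use C0 in auto)
    then show ?thesis by simp
  qed
  have r2: "frac_hom (subring_of ?C0) ((laurent_pos - coeffs_in Q) \<inter> ?C0) (localization_at (UP B) ?ext) \<upsilon>"
  proof -
    have "frac_hom (?D\<lparr>carrier := ?C0\<rparr>) ((laurent_pos - coeffs_in Q) \<inter> ?C0) (localization_at (UP B) ?ext) \<upsilon>"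
    proof (rule frac_hom_restrict[OF U])
      fix a :: "('n, 'k) laurent"
      obtain k where "laurent_var ^ k * a \<in> ?C0" using ex_laurent_var_power_mem by blast
      then show "\<exists>v\<in>(laurent_pos - coeffs_in Q) \<inter> ?C0. v \<otimes>\<^bsub>?D\<^esub> a \<in> ?C0"
        using power_C0[of k] laurent_var_not_Q[of k] by (intro bexI[of _ "laurent_var ^ k"]) auto
    qed (use C0 in auto)
    then show ?thesis by simp
  qed
  have "(rees w - Q_rees) \<inter> ?C0 = (laurent_pos - coeffs_in Q) \<inter> ?C0" by (auto simp: Q_rees_def)
  with r1 have r1: "frac_hom (subring_of ?C0) ((laurent_pos - coeffs_in Q) \<inter> ?C0) N \<nu>" by simp
  show ?thesis
  proof (rule frac_hom_imp_ring_iso[OF r1 r2])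
    fix a assume "a \<in> carrier (subring_of ?C0)"
    then have a: "a \<in> rees w" "a \<in> laurent_pos" by auto
    show "\<nu> a = \<zero>\<^bsub>N\<^esub> \<longleftrightarrow> \<upsilon> a = \<zero>\<^bsub>localization_at (UP B) ?ext\<^esub>"
      unfolding kerN[OF a(1)] kerU[OF a(2)]
    proof
      assume "\<exists>s\<in>rees w. s \<notin> Q_rees \<and> s * a \<in> J_rees"
      then obtain s where s: "s \<in> rees w" "s \<notin> coeffs_in Q" "s * a \<in> coeffs_in J"
        by (auto simp: J_rees_def Q_rees_def)
      \<comment> \<open>The multiplier \<open>s\<close> may contain negative powers of
        \<open>t\<close>. A power of \<open>t\<close> removes them and affects neither membership in
        \<open>coeffs_in Q\<close> nor in \<open>coeffs_in J\<close>.\<close>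
      obtain k where k: "laurent_var ^ k * s \<in> ?C0" using ex_laurent_var_power_mem by blast
      have "laurent_var ^ k * s \<notin> coeffs_in Q" using s(2) by (simp add: laurent_var_mult_coeffs_in_iff)
      moreover have "single 0 1 * (laurent_var ^ k * s * a) \<in> coeffs_in J"
        using s(3) laurent_var_mult_coeffs_in_iff[of k "s * a" J] by (simp add: mult.assoc)
      ultimately show "\<exists>s\<in>laurent_pos. s \<notin> coeffs_in Q \<and> (\<exists>u. u \<notin> Q \<and> single 0 u * (s * a) \<in> coeffs_in J)"
        using k Q_props(2) by blast
    next
      assume "\<exists>s\<in>laurent_pos. s \<notin> coeffs_in Q \<and> (\<exists>u. u \<notin> Q \<and> single 0 u * (s * a) \<in> coeffs_in J)"
      then obtain s u where s: "s \<notin> coeffs_in Q" "u \<notin> Q" "single 0 u * (s * a) \<in> coeffs_in J" by blast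
      \<comment> \<open>The constant \<open>u\<close> is absorbed into the multiplier; the product
        avoids \<open>coeffs_in Q\<close> by primeness, and a power of \<open>t\<close> moves it
        into the Rees ring.\<close>
      obtain k where k: "laurent_var ^ k * (single 0 u * s) \<in> ?C0" using ex_laurent_var_power_mem by blast
      have "single 0 u \<notin> coeffs_in Q"
        using s(2) by (auto simp: coeffs_in_def intro!: exI[of _ 0])
      then have "laurent_var ^ k * (single 0 u * s) \<notin> coeffs_in Q"
        using s(1) coeffs_in_Q_prime by (auto simp: laurent_var_mult_coeffs_in_iff)
      moreover have "laurent_var ^ k * (single 0 u * s) * a \<in> J_rees"
        using s(3) laurent_var_mult_coeffs_in_iff[of k "single 0 u * (s * a)" J] rees_mult[of "laurent_var ^ k * (single 0 u * s)" w a] k a(1)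
        by (simp add: mult.assoc J_rees_def)
      ultimately show "\<exists>s\<in>rees w. s \<notin> Q_rees \<and> s * a \<in> J_rees"
        using k by (intro bexI[of _ "laurent_var ^ k * (single 0 u * s)"]) (auto simp: Q_rees_def)
    qed
  qed
qed

end

text \<open>The hypotheses on \<open>P\<close> meet three copies in \<open>'u\<close>:
  \<open>R'\<close> of the ring \<open>C\<close> modulo \<open>J_rees\<close> for openness,
  \<open>A\<close> of its local ring at the origin for (F2), and \<open>B\<close> of
  \<open>T\<close> for (F1).\<close>

lemma (in degeneration) property_descends:
  fixes P :: "'u ring \<Rightarrow> bool"
  assumes card: "(UNIV :: 'k set) \<lesssim> (UNIV :: 'u set)" "infinite (UNIV :: 'u set)"
    and P: "open_property P" "faithful_property P"
    and special: "holds_at P (ring_of_type_algebra Quot L) (quot_ideal ring_of_type_algebra vars_ideal L)"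
    and T: "frac_hom ring_of_type_algebra (UNIV - Q) T \<beta>"
    and kerT: "\<And>a. \<beta> a = \<zero>\<^bsub>T\<^esub> \<longleftrightarrow> (\<exists>s. s \<notin> Q \<and> s * a \<in> J)"
  shows "has_property P T"
proof -
  interpret T: frac ring_of_type_algebra "UNIV - Q" T \<beta> by unfold_locales fact
  have cardC: "carrier C \<lesssim> (UNIV :: 'u set)"
    using lepoll_trans[OF subset_imp_lepoll[OF subset_UNIV] laurent_lepoll[OF card]] by simp
  have "frac_hom C {\<one>\<^bsub>C\<^esub>} C (\<lambda>a. a)"
    by (intro frac_hom_surj rees_cring) (auto intro: ring_hom_memI)
  note quot = frac_hom_quotient[OF this ideal_J_rees]
  have quot_cring: "cring (C Quot J_rees)" using quot(1) by (simp add: frac_hom_def)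
  obtain R' :: "'u ring" and h where R': "cring R'" "h \<in> ring_iso (C Quot J_rees) R'"
    using ring_iso_copy[OF quot_cring frac_hom_lepoll[OF quot(1) cardC card(2)]] .
  define \<gamma> where "\<gamma> = (\<lambda>a. h (J_rees +>\<^bsub>C\<^esub> a))"
  have \<gamma>: "frac_hom C {\<one>\<^bsub>C\<^esub>} R' \<gamma>" and ker\<gamma>: "\<gamma> a = \<zero>\<^bsub>R'\<^esub> \<longleftrightarrow> a \<in> J_rees" if "a \<in> rees w" for a
    using ring_iso_imp_frac_hom[OF quot(1) R'(2,1)] quot(2) that unfolding \<gamma>_def by auto
  have \<gamma>: "frac_hom C {\<one>\<^bsub>C\<^esub>} R' \<gamma>" using \<gamma>[of 1] by simp
  have J_M: "J_rees \<subseteq> M_rees" using J_rees_subset_Q_rees Q_rees_subset_M_rees by blast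
  have M': "primeideal (\<gamma> ` M_rees) R'" "\<And>c. c \<in> rees w \<Longrightarrow> \<gamma> c \<in> \<gamma> ` M_rees \<longleftrightarrow> c \<in> M_rees"
    using primeideal_image[OF \<gamma> prime_M_rees] ker\<gamma> J_M by auto
  have Q': "primeideal (\<gamma> ` Q_rees) R'" "\<And>c. c \<in> rees w \<Longrightarrow> \<gamma> c \<in> \<gamma> ` Q_rees \<longleftrightarrow> c \<in> Q_rees"
    using primeideal_image[OF \<gamma> prime_Q_rees] ker\<gamma> J_rees_subset_Q_rees by auto
  \<comment> \<open>Used for \<open>M_rees\<close> and for \<open>Q_rees\<close>: the local ring of
    \<open>R'\<close> is a ring of fractions of \<open>C\<close>, with a kernel that no longer
    mentions \<open>R'\<close>.\<close>
  have localize: "\<exists>\<nu>. frac_hom C (rees w - K) (localization_at R' (\<gamma> ` K)) \<nu> \<and>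
      (\<forall>a\<in>rees w. \<nu> a = \<zero>\<^bsub>localization_at R' (\<gamma> ` K)\<^esub> \<longleftrightarrow> (\<exists>s\<in>rees w. s \<notin> K \<and> s * a \<in> J_rees))"
    if "primeideal (\<gamma> ` K) R'" and mem: "\<And>c. c \<in> rees w \<Longrightarrow> \<gamma> c \<in> \<gamma> ` K \<longleftrightarrow> c \<in> K" for K
  proof (intro exI conjI ballI)
    note loc = frac_hom_localization_at[OF \<gamma> that(1)]
    have "{c \<in> carrier C. \<gamma> c \<notin> \<gamma> ` K} = rees w - K" using mem by auto
    with loc(1) show "frac_hom C (rees w - K) (localization_at R' (\<gamma> ` K))
        (\<lambda>a. fraction_of R' (carrier R' - \<gamma> ` K) (\<gamma> a) \<one>\<^bsub>R'\<^esub>)" by simp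
    fix a :: "('n, 'k) laurent" assume a: "a \<in> rees w"
    have "(\<exists>s\<in>carrier C. \<gamma> s \<notin> \<gamma> ` K \<and> \<gamma> (s \<otimes>\<^bsub>C\<^esub> a) = \<zero>\<^bsub>R'\<^esub>) \<longleftrightarrow> (\<exists>s\<in>rees w. s \<notin> K \<and> s * a \<in> J_rees)"
      using mem ker\<gamma>[OF rees_mult[OF _ a]] by simp
    then show "fraction_of R' (carrier R' - \<gamma> ` K) (\<gamma> a) \<one>\<^bsub>R'\<^esub> = \<zero>\<^bsub>localization_at R' (\<gamma> ` K)\<^esub> \<longleftrightarrow>
        (\<exists>s\<in>rees w. s \<notin> K \<and> s * a \<in> J_rees)"
      using loc(2)[of a] a by simp
  qed
  have "has_property P (localization_at R' (\<gamma> ` M_rees))"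
  proof -
    obtain \<alpha>0 where \<alpha>0: "frac_hom C (rees w - M_rees) (localization_at R' (\<gamma> ` M_rees)) \<alpha>0"
      "\<And>a. a \<in> rees w \<Longrightarrow> \<alpha>0 a = \<zero>\<^bsub>localization_at R' (\<gamma> ` M_rees)\<^esub> \<longleftrightarrow> (\<exists>s\<in>rees w. s \<notin> M_rees \<and> s * a \<in> J_rees)"
      using localize[OF M'] by blast
    have loc_cring: "cring (localization_at R' (\<gamma> ` M_rees))" using \<alpha>0(1) by (simp add: frac_hom_def)
    obtain A :: "'u ring" and g where A: "cring A" "g \<in> ring_iso (localization_at R' (\<gamma> ` M_rees)) A"
      using ring_iso_copy[OF loc_cring frac_hom_lepoll[OF \<alpha>0(1) cardC card(2)]] .
    define \<alpha> where "\<alpha> = (\<lambda>a. g (\<alpha>0 a))"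
    have \<alpha>: "frac_hom C (rees w - M_rees) A \<alpha>" unfolding \<alpha>_def by (rule ring_iso_imp_frac_hom[OF \<alpha>0(1) A(2,1)])
    have ker\<alpha>: "\<alpha> a = \<zero>\<^bsub>A\<^esub> \<longleftrightarrow> (\<exists>s\<in>rees w. s \<notin> M_rees \<and> s * a \<in> J_rees)" if "a \<in> rees w" for a
      using ring_iso_imp_frac_hom(2)[OF \<alpha>0(1) A(2,1), of a] \<alpha>0(2)[OF that] that by (simp add: \<alpha>_def)
    interpret \<alpha>: frac C "rees w - M_rees" A \<alpha> by unfold_locales fact
    have ker_M: "a \<in> M_rees" if a: "a \<in> rees w" and zero: "\<alpha> a = \<zero>\<^bsub>A\<^esub>" for a
    proof -
      obtain s where "s \<in> rees w" "s \<notin> M_rees" "s * a \<in> M_rees" using ker\<alpha>[OF a] zero J_M by blast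
      then show ?thesis using primeideal.I_prime[OF prime_M_rees, of s a] a by auto
    qed
    have \<alpha>': "frac_hom C (carrier C - M_rees) A \<alpha>" using \<alpha> by simp
    have "a \<in> M_rees" if "a \<in> carrier C" "\<alpha> a = \<zero>\<^bsub>A\<^esub>" for a using ker_M that by simp
    note local = frac_hom_local[OF \<alpha>' prime_M_rees this]
    have noeth: "noetherian_ring A" by (rule frac_hom_noetherian[OF \<alpha> rees_noetherian])
    \<comment> \<open>If \<open>t * a\<close> is killed modulo \<open>J_rees\<close> by some
      \<open>r\<close> outside \<open>M_rees\<close>, then \<open>r * a\<close> already lies in
      \<open>J_rees\<close>, because \<open>t\<close> can be cancelled in
      \<open>coeffs_in J\<close>.\<close>
    have nonzerodivisor: "x = \<zero>\<^bsub>A\<^esub>" if x: "x \<in> carrier A" "\<alpha> laurent_var \<otimes>\<^bsub>A\<^esub> x = \<zero>\<^bsub>A\<^esub>" for x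
    proof -
      obtain a s where "a \<in> carrier C" and s: "s \<in> rees w - M_rees" and xs: "x \<otimes>\<^bsub>A\<^esub> \<alpha> s = \<alpha> a"
        using \<alpha>.fraction[OF x(1)] .
      then have a: "a \<in> rees w" by simp
      have t: "\<alpha> laurent_var \<in> carrier A" using \<alpha>.\<phi>.hom_closed[of laurent_var] by simp
      have "\<alpha> (laurent_var * a) = \<alpha> laurent_var \<otimes>\<^bsub>A\<^esub> (x \<otimes>\<^bsub>A\<^esub> \<alpha> s)"
        using \<alpha>.\<phi>.hom_mult[of laurent_var a] a by (simp add: xs)
      also have "\<dots> = \<zero>\<^bsub>A\<^esub>"
        using x t \<alpha>.\<phi>.hom_closed[OF \<alpha>.S_carrier[OF s]] by (simp add: \<alpha>.T.m_assoc[symmetric])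
      finally obtain r where r: "r \<in> rees w" "r \<notin> M_rees" "r * (laurent_var * a) \<in> J_rees"
        using ker\<alpha>[OF rees_mult[OF laurent_var_rees a]] by blast
      then have "r * a \<in> J_rees" using laurent_var_mult_J_rees[OF a] rees_mult[OF r(1) a] by (simp add: J_rees_def)
      then have "\<alpha> a = \<zero>\<^bsub>A\<^esub>" using ker\<alpha>[OF a] r by blast
      then have "x \<otimes>\<^bsub>A\<^esub> \<alpha> s = \<zero>\<^bsub>A\<^esub> \<otimes>\<^bsub>A\<^esub> \<alpha> s"
        using xs \<alpha>.\<phi>.hom_closed[OF \<alpha>.S_carrier[OF s]] by simp
      then show ?thesis by (rule \<alpha>.cancel[OF s x(1) \<alpha>.T.zero_closed])
    qed
    have "has_property P (A Quot (PIdl\<^bsub>A\<^esub> (\<alpha> laurent_var)))"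
      using has_property_iso[OF special[unfolded holds_at_def] special_fibre[OF \<alpha> ker\<alpha>]] .
    moreover have "\<alpha> laurent_var \<in> carrier A - Units A"
      using local(3)[of laurent_var] laurent_var_M_rees by simp
    ultimately have "has_property P A"
      using P(2) noeth local(1,2) nonzerodivisor unfolding faithful_property_def by blast
    moreover have "localization_at R' (\<gamma> ` M_rees) \<simeq> A" using A(2) unfolding is_ring_iso_def by blast
    ultimately show ?thesis using has_property_iso_iff loc_cring by (metis cring.axioms(1))
  qed
  then have "\<gamma> ` M_rees \<in> Spec_property P R'" using M'(1) by (simp add: Spec_property_def Spec_def holds_at_def)
  moreover obtain E where "Spec_property P R' = {K \<in> Spec R'. \<not> E \<subseteq> K}"
    using P(1) fin_gen_rees_quotient[OF \<gamma> card(1)] unfolding open_property_def zariski_open_def by blast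
  \<comment> \<open>A set \<open>E\<close> that is not contained in the larger prime is not
    contained in the smaller one.\<close>
  ultimately have "\<gamma> ` Q_rees \<in> Spec_property P R'"
    using Q'(1) Q_rees_subset_M_rees by (auto simp: Spec_def)
  then have generic: "has_property P (localization_at R' (\<gamma> ` Q_rees))" by (simp add: Spec_property_def holds_at_def)
  obtain \<nu> where \<nu>: "frac_hom C (rees w - Q_rees) (localization_at R' (\<gamma> ` Q_rees)) \<nu>"
    "\<And>a. a \<in> rees w \<Longrightarrow> \<nu> a = \<zero>\<^bsub>localization_at R' (\<gamma> ` Q_rees)\<^esub> \<longleftrightarrow> (\<exists>s\<in>rees w. s \<notin> Q_rees \<and> s * a \<in> J_rees)"
    using localize[OF Q'] by blast
  have "carrier (ring_of_type_algebra :: ('n, 'k) mpoly ring) \<lesssim> (UNIV :: 'u set)" using mpoly_lepoll[OF card] by simp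
  from ring_iso_copy[OF T.T.is_cring frac_hom_lepoll[OF T this card(2)]]
  obtain B :: "'u ring" and g where B: "cring B" "g \<in> ring_iso T B" .
  define \<beta>' where "\<beta>' = (\<lambda>a. g (\<beta> a))"
  have \<beta>': "frac_hom ring_of_type_algebra (UNIV - Q) B \<beta>'" unfolding \<beta>'_def by (rule ring_iso_imp_frac_hom[OF T B(2,1)])
  have ker\<beta>': "\<beta>' a = \<zero>\<^bsub>B\<^esub> \<longleftrightarrow> (\<exists>s. s \<notin> Q \<and> s * a \<in> J)" for a
    using ring_iso_imp_frac_hom(2)[OF T B(2,1), of a] kerT by (simp add: \<beta>'_def)
  have ker_Q: "a \<in> Q" if "\<beta>' a = \<zero>\<^bsub>B\<^esub>" for a
    using that J_Q Q_props(3) unfolding ker\<beta>' by blast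
  have "frac_hom ring_of_type_algebra (carrier ring_of_type_algebra - Q) B \<beta>'" using \<beta>' by simp
  note local = frac_hom_local[OF this prime_Q ker_Q]
  have mem_Q: "\<beta>' a \<in> carrier B - Units B \<longleftrightarrow> a \<in> Q" for a
    using local(3)[of a] by simp
  have noeth: "noetherian_ring B" by (rule frac_hom_noetherian[OF \<beta>' mpoly_noetherian])
  have "has_property P (localization_at (UP B) (extend_to_UP B (carrier B - Units B)))"
    using has_property_iso[OF generic generic_fibre[OF \<nu> \<beta>' ker\<beta>' maximalideal.axioms(1)[OF local(2)] mem_Q]] .
  then have "has_property P B"
    using P(2) noeth local(1,2) unfolding faithful_property_def by blast
  moreover have "T \<simeq> B" using B(2) unfolding is_ring_iso_def by blast
  ultimately show ?thesis using has_property_iso_iff[OF _ T.T.ring_axioms] by blast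
qed

section \<open>The localization at polynomials with leading part 1\<close>

context mon_preorder
begin

lemma unit_leading_iff:
  "leading_part lt u = 1 \<longleftrightarrow> lookup u 0 = 1 \<and> (\<forall>a\<in>keys u. a \<noteq> 0 \<longrightarrow> lt a 0)"
proof
  assume u: "leading_part lt u = 1"
  have lp: "(if \<forall>b\<in>keys u. \<not> lt k b then lookup u k else 0) = (1 when k = 0)" for k
    using arg_cong[OF u, of "\<lambda>p. lookup p k"] by (simp add: lookup_leading_part lookup_one)
  have zero: "lookup u 0 = 1" "\<forall>b\<in>keys u. \<not> lt 0 b" using lp[of 0] by (auto split: if_splits)
  have "lt a 0" if a: "a \<in> keys u" "a \<noteq> 0" for a
  proof (rule ccontr)
    assume "\<not> lt a 0"
    then have "\<forall>b\<in>keys u. \<not> lt a b" using zero(2) not_lt_trans by blast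
    then show False using lp[of a] a by (auto simp: in_keys_iff)
  qed
  then show "lookup u 0 = 1 \<and> (\<forall>a\<in>keys u. a \<noteq> 0 \<longrightarrow> lt a 0)" using zero by blast
next
  assume u: "lookup u 0 = 1 \<and> (\<forall>a\<in>keys u. a \<noteq> 0 \<longrightarrow> lt a 0)"
  then have 0: "0 \<in> keys u" by (simp add: in_keys_iff)
  show "leading_part lt u = 1"
  proof (rule poly_mapping_eqI)
    fix k
    show "lookup (leading_part lt u) k = lookup 1 k"
    proof (cases "k = 0")
      case True
      then show ?thesis using u lt_asym by (auto simp: lookup_leading_part lookup_one)
    next
      case False
      then have "k \<in> keys u \<Longrightarrow> \<not> (\<forall>b\<in>keys u. \<not> lt k b)" using u 0 by blast
      then show ?thesis using False by (auto simp: lookup_leading_part lookup_one in_keys_iff)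
    qed
  qed
qed

text \<open>Writing \<open>u = 1 + v\<close> with all monomials of \<open>v\<close> below 1, the
  product \<open>v * g\<close> has only monomials strictly below some monomial of \<open>g\<close>,
  so the maximal terms of \<open>g\<close> are unchanged.\<close>

lemma leading_part_unit_mult:
  fixes u g :: "('n, 'k::field) mpoly"
  assumes u: "leading_part lt u = 1"
  shows "leading_part lt (u * g) = leading_part lt g"
proof (cases "g = 0")
  case False
  note u' = u[unfolded unit_leading_iff]
  have key: "\<exists>b\<in>keys g. lt k b \<or> k = b" if k: "k \<in> keys (u * g)" for k
  proof -
    obtain a b where ab: "k = a + b" "a \<in> keys u" "b \<in> keys g" using keys_mult[of u g] k by blast
    then show ?thesis using u' lt_add_iff(1)[of a b 0] by (cases "a = 0") auto
  qed
  have max: "lookup (u * g) k = lookup g k" if k: "\<forall>b\<in>keys g. \<not> lt k b" for k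
  proof -
    define v where "v = u - 1"
    have v: "lt a 0" if "a \<in> keys v" for a
      using that u' by (cases "a = 0") (auto simp: v_def in_keys_iff lookup_minus lookup_one)
    have "k \<notin> keys (v * g)"
    proof
      assume "k \<in> keys (v * g)"
      then obtain a b where ab: "k = a + b" "a \<in> keys v" "b \<in> keys g" using keys_mult[of v g] by blast
      then have "lt k b" using v[OF ab(2)] lt_add_iff(1)[of a b 0] by simp
      then show False using k ab(3) by blast
    qed
    moreover have "u * g = g + v * g" by (simp add: v_def algebra_simps)
    ultimately show ?thesis by (simp add: lookup_add in_keys_iff)
  qed
  show ?thesis
  proof (rule poly_mapping_eqI)
    fix k
    show "lookup (leading_part lt (u * g)) k = lookup (leading_part lt g) k"
    proof (cases "\<forall>b\<in>keys g. \<not> lt k b")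
      case True
      then have "\<forall>b\<in>keys (u * g). \<not> lt k b" using key lt_trans by blast
      then show ?thesis using True max by (simp add: lookup_leading_part)
    next
      case False
      \<comment> \<open>A non-maximal \<open>k\<close> must stay non-maximal in
        \<open>u * g\<close>: a maximal monomial of \<open>g\<close> above \<open>k\<close> keeps
        its coefficient there.\<close>
      define K where "K = {b \<in> keys g. lt k b}"
      have "finite K" "K \<noteq> {}" using False by (auto simp: K_def)
      then obtain b where b: "b \<in> K" "\<forall>c\<in>K. \<not> lt b c" using ex_maximal by blast
      have "\<forall>c\<in>keys g. \<not> lt b c" using b lt_trans unfolding K_def by blast
      then have "b \<in> keys (u * g)" using max[of b] b(1) by (simp add: K_def in_keys_iff)
      then have "\<not> (\<forall>b\<in>keys (u * g). \<not> lt k b)" using b(1) by (auto simp: K_def)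
      then show ?thesis using False by (simp only: lookup_leading_part if_False)
    qed
  qed
qed simp

lemma mult_subset_unit_leading: "mult_subset mpoly_ring (unit_leading lt :: ('n, 'k::field) mpoly set)"
proof (rule mult_subset.intro)
  show "cring (mpoly_ring :: ('n, 'k) mpoly ring)" unfolding mpoly_ring_def by (rule type_ring_cring)
  show "mult_subset_axioms (mpoly_ring :: ('n, 'k) mpoly ring) (unit_leading lt)"
  proof
    show "\<one>\<^bsub>mpoly_ring\<^esub> \<in> (unit_leading lt :: ('n, 'k) mpoly set)"
      by (simp add: unit_leading_def mpoly_ring_def unit_leading_iff)
    show "s \<otimes>\<^bsub>mpoly_ring\<^esub> t \<in> unit_leading lt"
      if "s \<in> unit_leading lt" "t \<in> unit_leading lt" for s t :: "('n, 'k) mpoly"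
      using that by (simp add: unit_leading_def mpoly_ring_def leading_part_unit_mult)
  qed (simp add: mpoly_ring_def)
qed

lemma frac_hom_embed:
  "frac_hom mpoly_ring (unit_leading lt) (loc_mpoly_ring lt) (embed lt :: ('n, 'k::field) mpoly \<Rightarrow> _)"
proof -
  have "frac_hom mpoly_ring (unit_leading lt) (loc_mpoly_ring lt) (\<lambda>a :: ('n, 'k) mpoly. fraction_of mpoly_ring (unit_leading lt) a \<one>\<^bsub>mpoly_ring\<^esub>)"
    unfolding loc_mpoly_ring_def by (rule mult_subset.frac_hom_localization[OF mult_subset_unit_leading])
  moreover have "(\<lambda>a :: ('n, 'k) mpoly. fraction_of mpoly_ring (unit_leading lt) a \<one>\<^bsub>mpoly_ring\<^esub>) = embed lt"
    by (simp add: embed_def mpoly_ring_def fun_eq_iff)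
  ultimately show ?thesis by simp
qed

text \<open>This removes the choice in \<open>loc_leading_part\<close> and replaces \<open>I\<close>
  by its contraction to \<open>k[X]\<close>. Numerators of the same element agree up to factors from
  \<open>S_<\<close>, which do not change leading parts.\<close>

lemma leading_ideal_eq:
  fixes I :: "('n, 'k::field) mpoly fraction set"
  assumes "ideal I (loc_mpoly_ring lt)"
  shows "leading_ideal lt I = Idl\<^bsub>mpoly_ring\<^esub> (leading_part lt ` {g. embed lt g \<in> I})"
proof -
  interpret frac mpoly_ring "unit_leading lt" "loc_mpoly_ring lt" "embed lt :: ('n, 'k) mpoly \<Rightarrow> _"
    by unfold_locales (rule frac_hom_embed)
  interpret I: ideal I "loc_mpoly_ring lt" by fact
  have carr [simp]: "a \<in> carrier mpoly_ring" for a :: "('n, 'k) mpoly" by (simp add: mpoly_ring_def)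
  have embed_mult: "embed lt (a * b) = embed lt a \<otimes>\<^bsub>loc_mpoly_ring lt\<^esub> embed lt b" for a b :: "('n, 'k) mpoly"
    using \<phi>.hom_mult[of a b] by (simp add: mpoly_ring_def)
  have choice: "\<exists>g. leading_part lt g = loc_leading_part lt f \<and> (\<exists>u\<in>unit_leading lt. embed lt u \<otimes>\<^bsub>loc_mpoly_ring lt\<^esub> f = embed lt g)"
    if f: "f \<in> carrier (loc_mpoly_ring lt)" for f :: "('n, 'k) mpoly fraction"
  proof -
    obtain a s where "a \<in> carrier mpoly_ring" and s: "s \<in> unit_leading lt" "f \<otimes>\<^bsub>loc_mpoly_ring lt\<^esub> embed lt s = embed lt a"
      using fraction[OF f] .
    then have "\<exists>g. \<exists>u\<in>unit_leading lt. embed lt u \<otimes>\<^bsub>loc_mpoly_ring lt\<^esub> f = embed lt g"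
      using T.m_comm[OF f, of "embed lt s"] by (intro exI[of _ a] bexI[of _ s]) auto
    then have "\<exists>u\<in>unit_leading lt. embed lt u \<otimes>\<^bsub>loc_mpoly_ring lt\<^esub> f = embed lt (SOME g. \<exists>u\<in>unit_leading lt. embed lt u \<otimes>\<^bsub>loc_mpoly_ring lt\<^esub> f = embed lt g)"
      by (rule someI_ex)
    then show ?thesis unfolding loc_leading_part_def by blast
  qed
  have "loc_leading_part lt ` I = leading_part lt ` {g. embed lt g \<in> I}"
  proof (intro equalityI subsetI)
    fix x assume "x \<in> loc_leading_part lt ` I"
    then obtain f where f: "f \<in> I" "x = loc_leading_part lt f" by blast
    obtain g u where g: "leading_part lt g = x" "u \<in> unit_leading lt" "embed lt u \<otimes>\<^bsub>loc_mpoly_ring lt\<^esub> f = embed lt g"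
      using choice[OF I.Icarr[OF f(1)]] f(2) by blast
    have "embed lt g \<in> I" unfolding g(3)[symmetric] using f(1) by (intro I.I_l_closed) auto
    then show "x \<in> leading_part lt ` {g. embed lt g \<in> I}" using g(1) by blast
  next
    fix x assume "x \<in> leading_part lt ` {g. embed lt g \<in> I}"
    then obtain g where g: "x = leading_part lt g" "embed lt g \<in> I" by blast
    obtain g' u where g': "leading_part lt g' = loc_leading_part lt (embed lt g)" "u \<in> unit_leading lt"
      "embed lt u \<otimes>\<^bsub>loc_mpoly_ring lt\<^esub> embed lt g = embed lt g'"
      using choice[OF I.Icarr[OF g(2)]] by blast
    \<comment> \<open>Equality in the localization gives \<open>v u g = v g'\<close> with
      \<open>v\<close> in \<open>S_<\<close>, so \<open>g\<close> and \<open>g'\<close> have the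
      same leading part.\<close>
    have "embed lt (u * g) = embed lt g'" using g'(3) by (simp add: embed_mult)
    then obtain v where v: "v \<in> unit_leading lt" "v * (u * g) = v * g'"
      unfolding embed_def using mult_subset.fr_eq_iff[OF mult_subset_unit_leading, of "u * g" 1 g' 1] S_one
      by (auto simp: mpoly_ring_def)
    have "leading_part lt g = leading_part lt (v * (u * g))"
      using v(1) g'(2) by (simp add: leading_part_unit_mult unit_leading_def)
    also have "\<dots> = leading_part lt g'" unfolding v(2) using v(1) by (simp add: leading_part_unit_mult unit_leading_def)
    finally have "x = loc_leading_part lt (embed lt g)" using g(1) g'(1) by simp
    then show "x \<in> loc_leading_part lt ` I" using g(2) by blast
  qed
  then show ?thesis by (simp add: leading_ideal_def)
qed

text \<open>If all variables lie on the same side of 1, multiplying by one variable at a time keeps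
  every nontrivial monomial on that side.\<close>

lemma one_comparable_if:
  assumes "(\<forall>i. lt 0 (var_monomial i)) \<or> (\<forall>i. lt (var_monomial i) 0) \<or> monomial_order lt"
  shows "one_comparable lt"
  using assms
proof (elim disjE)
  assume "monomial_order lt"
  then show ?thesis
    unfolding monomial_order_def one_comparable_def comparable_def totalp_on_def by auto
next
  assume pos: "\<forall>i. lt 0 (var_monomial i)"
  have "a = 0 \<or> lt 0 a" for a :: "'n monomial"
  proof (induction a rule: monomial_induct)
    case (add a i)
    then have "a = 0 \<or> lt (0 + var_monomial i) (a + var_monomial i)" by (simp only: lt_add_iff)
    then show ?case using pos lt_trans[of 0 "var_monomial i" "a + var_monomial i"] by auto
  qed simp
  then show ?thesis unfolding one_comparable_def comparable_def by blast
next
  assume neg: "\<forall>i. lt (var_monomial i) 0"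
  have "a = 0 \<or> lt a 0" for a :: "'n monomial"
  proof (induction a rule: monomial_induct)
    case (add a i)
    then have "a = 0 \<or> lt (a + var_monomial i) (0 + var_monomial i)" by (simp only: lt_add_iff)
    then show ?case using neg lt_trans[of "a + var_monomial i" "var_monomial i" 0] by auto
  qed simp
  then show ?thesis unfolding one_comparable_def comparable_def by blast
qed

end

theorem corollary4p7:
  fixes lt :: "'n::finite monomial \<Rightarrow> 'n monomial \<Rightarrow> bool"
  assumes "monomial_preorder lt"
    and "(UNIV :: 'k::field set) \<lesssim> (UNIV :: 'u set)"
    and "infinite (UNIV :: 'u set)"
  shows "((\<forall>i. lt 0 (var_monomial i)) \<or> (\<forall>i. lt (var_monomial i) 0) \<or> monomial_order lt
            \<longrightarrow> one_comparable lt) \<and>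
    (one_comparable lt \<longrightarrow>
      (\<forall>(P :: 'u ring \<Rightarrow> bool) (I :: ('n, 'k) mpoly fraction set).
         local_ring_property P \<longrightarrow> open_property P \<longrightarrow> faithful_property P \<longrightarrow>
         ideal I (loc_mpoly_ring lt) \<longrightarrow> I \<noteq> carrier (loc_mpoly_ring lt) \<longrightarrow>
         holds_at P (mpoly_ring Quot leading_ideal lt I)
           (quot_ideal mpoly_ring vars_ideal (leading_ideal lt I)) \<longrightarrow>
         (\<forall>Q \<in> Spec (loc_mpoly_ring lt Quot I). holds_at P (loc_mpoly_ring lt Quot I) Q)))"
proof -
  interpret mon_preorder lt by unfold_locales fact
  have "holds_at P (loc_mpoly_ring lt Quot I) Q'"
    if one: "one_comparable lt" and P: "open_property P" "faithful_property P"
      and I: "ideal I (loc_mpoly_ring lt)"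
      and special: "holds_at P (mpoly_ring Quot leading_ideal lt I) (quot_ideal mpoly_ring vars_ideal (leading_ideal lt I))"
      and Q': "Q' \<in> Spec (loc_mpoly_ring lt Quot I)"
    for P :: "'u ring \<Rightarrow> bool" and I :: "('n, 'k) mpoly fraction set" and Q'
  proof -
    let ?R = "ring_of_type_algebra :: ('n, 'k) mpoly ring"
    let ?k = "loc_mpoly_ring lt :: ('n, 'k) mpoly fraction ring"
    interpret R: cring ?R by (rule type_ring_cring)
    note quot = frac_hom_quotient[OF frac_hom_embed I, unfolded mpoly_ring_def]
    \<comment> \<open>Composing the embedding with the projection makes the local rings of
      \<open>k[X]_</I\<close> rings of fractions of \<open>k[X]\<close>.\<close>
    define \<theta> where "\<theta> = (\<lambda>a :: ('n, 'k) mpoly. I +>\<^bsub>?k\<^esub> embed lt a)"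
    have \<theta>: "frac_hom ?R (unit_leading lt) (?k Quot I) \<theta>" and ker\<theta>: "\<theta> a = \<zero>\<^bsub>?k Quot I\<^esub> \<longleftrightarrow> embed lt a \<in> I" for a
      using quot by (auto simp: \<theta>_def)
    interpret \<theta>: frac ?R "unit_leading lt" "?k Quot I" \<theta> by unfold_locales fact
    have prime_Q': "primeideal Q' (?k Quot I)" using Q' by (simp add: Spec_def)
    interpret Q': primeideal Q' "?k Quot I" by fact
    define J where "J = {a. embed lt a \<in> I}"
    define Q where "Q = {a. \<theta> a \<in> Q'}"
    have \<theta>_mult: "\<theta> (a * b) = \<theta> a \<otimes>\<^bsub>?k Quot I\<^esub> \<theta> b" and \<theta>_closed: "\<theta> a \<in> carrier (?k Quot I)" for a b
      using \<theta>.\<phi>.hom_mult[of a b] \<theta>.\<phi>.hom_closed[of a] by simp_all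
    have vimage: "ideal {a. \<theta> a \<in> K} ?R" if "ideal K (?k Quot I)" for K
      using ring_hom_ring.ideal_vimage[OF ring_hom_ringI2[OF R.ring_axioms \<theta>.T.ring_axioms \<theta>.\<phi>.homh] that] by simp
    have ideal_J: "ideal J ?R"
      using vimage[OF \<theta>.T.zeroideal] by (simp add: J_def ker\<theta>)
    have unit_notin: "u \<notin> Q" if "u \<in> unit_leading lt" for u
    proof
      assume "u \<in> Q"
      then have "inv\<^bsub>?k Quot I\<^esub> (\<theta> u) \<otimes>\<^bsub>?k Quot I\<^esub> \<theta> u \<in> Q'"
        using \<theta>.S_inv_closed[OF that] by (intro Q'.I_l_closed) (simp_all add: Q_def)
      then show False using \<theta>.S_inv(2)[OF that] Q'.one_imp_carrier Q'.I_notcarr by simp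
    qed
    have prime_Q: "primeideal Q ?R"
      unfolding primeideal_type_ring_iff
    proof (intro conjI allI impI)
      show "ideal Q ?R" using vimage[OF Q'.is_ideal] by (simp add: Q_def)
      show "1 \<notin> Q" using unit_notin[of 1] by (simp add: unit_leading_def unit_leading_iff)
      show "a \<in> Q \<or> b \<in> Q" if "a * b \<in> Q" for a b
        using that Q'.I_prime[OF \<theta>_closed \<theta>_closed] by (simp add: Q_def \<theta>_mult)
    qed
    have "\<zero>\<^bsub>?k Quot I\<^esub> \<in> Q'" by (rule additive_subgroup.zero_closed[OF ideal.axioms(1)[OF Q'.is_ideal]])
    moreover have "\<theta> a = \<zero>\<^bsub>?k Quot I\<^esub>" if "a \<in> J" for a using that by (simp add: J_def ker\<theta>)
    ultimately have J_Q: "J \<subseteq> Q" unfolding Q_def by (metis mem_Collect_eq subsetI)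
    have ideal_Q: "ideal Q ?R" using prime_Q by (simp add: primeideal_type_ring_iff)
    have leading_Q: "lookup (leading_part lt f) 0 = 0" if f: "f \<in> Q" for f
    proof (rule ccontr)
      assume "lookup (leading_part lt f) 0 \<noteq> 0"
      then have max: "\<forall>b\<in>keys f. \<not> lt 0 b" and f0: "lookup f 0 \<noteq> 0"
        by (auto simp: lookup_leading_part split: if_splits)
      \<comment> \<open>The one place where comparability with 1 is used: "not above 1" becomes
        "below 1". Hence \<open>f\<close>, scaled to constant term 1, would be an element of
        \<open>S_<\<close> in \<open>Q\<close>.\<close>
      have "lt a 0" if "a \<in> keys f" "a \<noteq> 0" for a
        using one max that unfolding one_comparable_def comparable_def by blast
      then have "single 0 (inverse (lookup f 0)) * f \<in> unit_leading lt"
        using f0 by (auto simp: unit_leading_def unit_leading_iff in_keys_iff)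
      then show False using unit_notin ideal_type_ring_closed(3)[OF ideal_Q f] by blast
    qed
    let ?Idl = "\<lambda>K. Idl\<^bsub>?R\<^esub> (leading_part lt ` K)"
    have vars: "ideal (vars_ideal :: ('n, 'k) mpoly set) ?R"
      unfolding vars_ideal_def mpoly_ring_def by (rule R.genideal_ideal) simp
    have Idl_Q: "?Idl Q \<subseteq> vars_ideal"
      using leading_Q by (intro R.genideal_minimal[OF vars]) (auto simp: vars_ideal_eq)
    have Idl_J: "?Idl J \<subseteq> ?Idl Q"
      using J_Q by (intro R.subset_Idl_subset) auto
    \<comment> \<open>One weight for both ideals: \<open>J\<close> determines the special fibre,
      while \<open>Q\<close> must degenerate into the ideal of the origin.\<close>
    obtain w where w: "\<And>K f. K \<in> {J, Q} \<Longrightarrow> f \<in> K \<Longrightarrow> leading_part (weight_less w) f \<in> ?Idl K"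
      "\<And>K f. K \<in> {J, Q} \<Longrightarrow> f \<in> K \<Longrightarrow> leading_part lt f \<in> Idl\<^bsub>?R\<^esub> (leading_part (weight_less w) ` K)"
      using ex_weight_leading_ideal[OF mon_preorder_axioms, of "{J, Q}"] ideal_J ideal_Q by blast
    interpret degeneration w J Q "?Idl J"
    proof (rule degeneration.intro)
      show "ideal J ?R" "primeideal Q ?R" "J \<subseteq> Q" by fact+
      show "ideal (?Idl J) ?R" by (rule R.genideal_ideal) simp
      show "leading_part (weight_less w) f \<in> ?Idl J" if "f \<in> J" for f using w(1) that by blast
      show "?Idl J \<subseteq> Idl\<^bsub>?R\<^esub> (leading_part (weight_less w) ` J)"
        using w(2) by (intro R.genideal_minimal R.genideal_ideal) auto
      \<comment> \<open>The leading part for the weight may differ from that for \<open>lt\<close>,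
        but it lies in the leading ideal of \<open>Q\<close> for \<open>lt\<close> and thus in
        \<open>(X)\<close>.\<close>
      show "lookup (leading_part (weight_less w) f) 0 = 0" if "f \<in> Q" for f
        using w(1)[of Q f] that Idl_Q by (auto simp: vars_ideal_eq)
      show "?Idl J \<subseteq> vars_ideal" using Idl_J Idl_Q by blast
    qed
    note loc = frac_hom_localization_at[OF \<theta> prime_Q']
    show ?thesis
      unfolding holds_at_def
    proof (rule property_descends[OF assms(2,3) P])
      show "holds_at P (?R Quot ?Idl J) (quot_ideal ?R vars_ideal (?Idl J))"
        using special unfolding leading_ideal_eq[OF I] J_def mpoly_ring_def .
      have "{c \<in> carrier ?R. \<theta> c \<notin> Q'} = UNIV - Q" by (auto simp: Q_def)
      with loc(1) show "frac_hom ?R (UNIV - Q) (localization_at (?k Quot I) Q')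
          (\<lambda>a. fraction_of (?k Quot I) (carrier (?k Quot I) - Q') (\<theta> a) \<one>\<^bsub>?k Quot I\<^esub>)" by simp
      show "fraction_of (?k Quot I) (carrier (?k Quot I) - Q') (\<theta> a) \<one>\<^bsub>?k Quot I\<^esub> = \<zero>\<^bsub>localization_at (?k Quot I) Q'\<^esub> \<longleftrightarrow>
          (\<exists>s. s \<notin> Q \<and> s * a \<in> J)" for a
        using loc(2)[of a] by (simp add: Q_def J_def ker\<theta>)
    qed
  qed
  then show ?thesis using one_comparable_if by blast
qed

end
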